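(* Assume $(S-1)\alpha\in\ell^2$. Then $$\int_0^{2\pi}(1-\cos\theta)^2(1+\cos\theta)\log w(\theta)\frac{d\theta}{2\pi}>-\infty\iff\alpha\in\ell^6.$$
   Context: $\mu$ is a probability measure with infinite support on the unit circle (identified with $[0,2\pi]$ via $e^{i\theta}\mapsto\theta$), with Lebesgue decomposition $d\mu(\theta)=w(\theta)\frac{d\theta}{2\pi}+d\mu_s(\theta)$. $\Phi_n$ are its monic orthogonal polynomials, and its sequence of Verblunsky coefficients is $\alpha=(\alpha_n)_{n\ge0}$, $\alpha_n=-\overline{\Phi_{n+1}(0)}\in\mathbb{D}$. $S$ is the left shift on sequences, $(S\alpha)_n=\alpha_{n+1}$. The integral is well defined in $[-\infty,\infty)$. *)

theory Defs
  imports
    "HOL-Probability.Probability"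
    "HOL-Computational_Algebra.Polynomial"
begin

definition circle_borel :: "complex measure" where
  "circle_borel = restrict_space borel (sphere 0 1)"

text \<open>The measure \<open>d\<theta>/2\<pi>\<close> on \<open>[0,2\<pi>]\<close>.\<close>

definition dtheta :: "real measure" where
  "dtheta = uniform_measure lborel {0..2*pi}"

definition prob_on_circle :: "complex measure \<Rightarrow> bool" where
  "prob_on_circle \<mu> \<longleftrightarrow> prob_space \<mu> \<and> sets \<mu> = sets circle_borel"

definition measure_support :: "complex measure \<Rightarrow> complex set" where
  "measure_support \<mu> =
     {z \<in> sphere 0 1. \<forall>U. open U \<and> z \<in> U \<longrightarrow> emeasure \<mu> (U \<inter> sphere 0 1) > 0}"

text \<open>\<open>d\<mu> = w d\<theta>/2\<pi> + d\<mu>\<^sub>s\<close>, where \<open>[0,2\<pi>]\<close> is mapped to the circle by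
  \<open>\<theta> \<mapsto> e\<^sup>i\<^sup>\<theta>\<close>, i.e. by \<^term>\<open>cis\<close>. The density \<open>w\<close> is determined only up to equality almost
  everywhere; any version is admitted.\<close>

definition lebesgue_decomposition ::
    "complex measure \<Rightarrow> (real \<Rightarrow> real) \<Rightarrow> complex measure \<Rightarrow> bool" where
  "lebesgue_decomposition \<mu> w \<mu>s \<longleftrightarrow>
     w \<in> borel_measurable borel \<and> (\<forall>\<theta>\<in>{0..2*pi}. 0 \<le> w \<theta>) \<and>
     sets \<mu>s = sets circle_borel \<and>
     (\<exists>N\<in>sets circle_borel. emeasure (distr dtheta circle_borel cis) N = 0 \<and>
                            emeasure \<mu>s (sphere 0 1 - N) = 0) \<and>
     (\<forall>A\<in>sets circle_borel.
        emeasure \<mu> A =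
          emeasure (distr (density dtheta (\<lambda>\<theta>. ennreal (w \<theta>))) circle_borel cis) A
          + emeasure \<mu>s A)"

text \<open>For \<open>\<mu>\<close> of infinite support these conditions determine \<open>\<Phi>\<close> uniquely.\<close>

definition monic_orthogonal_polys :: "complex measure \<Rightarrow> (nat \<Rightarrow> complex poly) \<Rightarrow> bool" where
  "monic_orthogonal_polys \<mu> \<Phi> \<longleftrightarrow>
     (\<forall>n. degree (\<Phi> n) = n \<and> lead_coeff (\<Phi> n) = 1) \<and>
     (\<forall>m n. m \<noteq> n \<longrightarrow> (\<integral>z. cnj (poly (\<Phi> m) z) * poly (\<Phi> n) z \<partial>\<mu>) = 0)"

definition verblunsky :: "(nat \<Rightarrow> complex poly) \<Rightarrow> nat \<Rightarrow> complex" where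
  "verblunsky \<Phi> n = - cnj (poly (\<Phi> (Suc n)) 0)"

definition left_shift :: "(nat \<Rightarrow> complex) \<Rightarrow> nat \<Rightarrow> complex" where
  "left_shift a n = a (Suc n)"

definition ell :: "nat \<Rightarrow> (nat \<Rightarrow> complex) set" where
  "ell p = {a. summable (\<lambda>n. norm (a n) ^ p)}"

text \<open>The library has \<open>ln 0 = 0\<close>, whereas here \<open>log 0 = -\<infinity>\<close>.\<close>

definition elog :: "real \<Rightarrow> ereal" where
  "elog x = (if x > 0 then ereal (ln x) else - \<infinity>)"

text \<open>Integral of an extended-real function as the integral of its positive part minus that of its
  negative part (\<^const>\<open>e2ennreal\<close> sends negative values to \<open>0\<close>). It is meaningful if one
  of the two is finite; for the integrand below the positive part always is, since
  \<open>log w \<le> w\<close>.\<close>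

definition ext_integral :: "'a measure \<Rightarrow> ('a \<Rightarrow> ereal) \<Rightarrow> ereal" where
  "ext_integral M f =
     enn2ereal (\<integral>\<^sup>+x. e2ennreal (f x) \<partial>M) - enn2ereal (\<integral>\<^sup>+x. e2ennreal (- f x) \<partial>M)"

end

theory Submission
  imports Defs "HOL-Complex_Analysis.Complex_Analysis"
begin

text \<open>
  Let \<open>V(\<theta>) = (1 - cos \<theta>)\<^sup>2 (1 + cos \<theta>)\<close>, and let \<open>w\<^sub>n = \<parallel>\<Phi>\<^sub>n\<parallel>\<^sup>2 / |\<Phi>\<^sub>n|\<^sup>2\<close> be the weights of the
  Bernstein--Szego approximations of \<open>\<mu>\<close>. The integrals \<open>J\<^sub>n = \<integral> V log w\<^sub>n\<close> are bounded
  below if and only if \<open>\<integral> V log w > -\<infinity>\<close>. In one direction, \<open>log w - log w\<^sub>n \<le> w / w\<^sub>n\<close> and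
  \<open>\<integral> w / w\<^sub>n \<le> 1\<close>, so no step-by-step sum rule for \<open>\<mu>\<close> is needed. In the other direction,
  \<open>w\<^sub>n d\<theta>/2\<pi>\<close> converges weakly to \<open>\<mu>\<close>, and \<open>log w\<^sub>n \<le> w\<^sub>n g - 1 - log g\<close> for every \<open>g > 0\<close>;
  the choice of \<open>g\<close> close to \<open>1 / min(1, w)\<close> off the singular part gives the bound.

  As \<open>V\<close> has degree 3, the increment \<open>J\<^sub>n\<^sub>+\<^sub>1 - J\<^sub>n\<close> is an explicit function of \<open>\<alpha>\<^sub>n, \<dots>, \<alpha>\<^sub>n\<^sub>-\<^sub>3\<close>: it
  involves \<open>log (1 - |\<alpha>\<^sub>n|\<^sup>2)\<close> and three Taylor coefficients of \<open>log (1 - \<alpha>\<^sub>n z b\<^sub>n(z))\<close>, where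
  \<open>b\<^sub>n = \<Phi>\<^sub>n / \<Phi>\<^sub>n\<^sup>*\<close>. Up to telescoping and terms quadratic in the differences of \<open>\<alpha>\<close>, each balanced
  monomial of degree \<open>2d\<close> equals \<open>|\<alpha>\<^sub>n|\<^sup>2\<^sup>d\<close>. The contributions of degrees 2 and 4 cancel, and what
  remains behaves like \<open>-|\<alpha>\<^sub>n|\<^sup>6\<close>.
\<close>

section \<open>The sum rule as a function of the coefficients\<close>

text \<open>The hypothesis gives no decay of \<alpha>, only square-summable differences, so an error
  of first order in the differences is fatal unless it telescopes. Polarization removes the phases
  at first order: Re (P cnj Q) is the mean of |P|^2 and |Q|^2 minus |P - Q|^2 / 2, and |P - Q| is of
  first order. What remains are differences of powers of moduli at shifted indices, which telescope
  with bounded sums because |\<alpha>| < 1. The exponent 6 comes from freezing all four coefficients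
  at one value, with x = |\<alpha>|^2. The logarithm is kept exact, since \<alpha> is not known to
  stay away from the unit circle. The entropies are followed only from index 3 on: earlier
  increments would involve the initial value b_0 = 1 in place of coefficients.\<close>

lemma Re_mult_cnj_polarization:
  "Re (z * cnj w) = ((cmod z)\<^sup>2 + (cmod w)\<^sup>2) / 2 - (cmod (z - w))\<^sup>2 / 2"
proof -
  have "(cmod (z - w))\<^sup>2 = (cmod z)\<^sup>2 + (cmod w)\<^sup>2 - 2 * Re (z * cnj w)"
    by (simp only: cmod_power2) (simp add: power2_eq_square algebra_simps)
  then show ?thesis by (simp add: field_simps)
qed

lemma norm_mult_diff_le:
  fixes x y x' y' :: "'a::real_normed_algebra"
  assumes "norm x \<le> 1" "norm y' \<le> 1"
  shows "norm (x * y - x' * y') \<le> norm (x - x') + norm (y - y')"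
proof -
  have "x * y - x' * y' = x * (y - y') + (x - x') * y'" by (simp add: algebra_simps)
  then have "norm (x * y - x' * y') \<le> norm (x * (y - y')) + norm ((x - x') * y')"
    by (metis norm_triangle_ineq)
  also have "\<dots> \<le> norm x * norm (y - y') + norm (x - x') * norm y'"
    by (intro add_mono norm_mult_ineq)
  also have "\<dots> \<le> 1 * norm (y - y') + norm (x - x') * 1"
    using assms by (intro add_mono mult_mono) auto
  finally show ?thesis by simp
qed

lemma square_norm_diff_le:
  fixes u v :: complex
  assumes "cmod u \<le> 1" "cmod v \<le> 1" "cmod (u - v) \<le> D"
  shows "\<bar>(cmod u)\<^sup>2 - (cmod v)\<^sup>2\<bar> \<le> 2 * D"
proof -
  have "(cmod u)\<^sup>2 - (cmod v)\<^sup>2 = (cmod u - cmod v) * (cmod u + cmod v)"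
    by (simp add: power2_eq_square algebra_simps)
  then have "\<bar>(cmod u)\<^sup>2 - (cmod v)\<^sup>2\<bar> = \<bar>cmod u - cmod v\<bar> * (cmod u + cmod v)"
    by (simp add: abs_mult)
  also have "\<dots> \<le> D * 2"
    using assms norm_triangle_ineq3[of u v] by (intro mult_mono) auto
  finally show ?thesis by simp
qed

text \<open>To first order in the differences, the real part of a balanced monomial only sees the moduli:
  this is why \<open>\<ell>\<^sup>2\<close> differences produce summable errors.\<close>

lemma Re_monomial2:
  fixes u v :: complex
  assumes "cmod (u - v) \<le> D"
  shows "\<bar>Re (u * cnj v) - ((cmod u)\<^sup>2 + (cmod v)\<^sup>2) / 2\<bar> \<le> D\<^sup>2"
proof -
  have "(cmod (u - v))\<^sup>2 \<le> D\<^sup>2" using assms by (intro power_mono) auto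
  then show ?thesis unfolding Re_mult_cnj_polarization
    by (simp add: abs_le_iff) (smt (verit) zero_le_power2)
qed

text \<open>Two replacements are made, each with an error quadratic in D: polarization for the two
  products, then AM-GM for the moduli inside each product.\<close>

lemma Re_monomial4:
  fixes u1 u2 v1 v2 :: complex
  assumes "cmod u1 \<le> 1" "cmod u2 \<le> 1" "cmod v1 \<le> 1" "cmod v2 \<le> 1"
    and "cmod (u1 - v1) \<le> D" "cmod (u2 - v2) \<le> D" "cmod (u1 - u2) \<le> D" "cmod (v1 - v2) \<le> D"
  shows "\<bar>Re (u1 * u2 * cnj (v1 * v2))
          - ((cmod u1)^4 + (cmod u2)^4 + (cmod v1)^4 + (cmod v2)^4) / 4\<bar> \<le> 5 * D\<^sup>2"
proof -
  have "cmod (u1 * u2 - v1 * v2) \<le> 2 * D"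
    using norm_mult_diff_le[of u1 v2 u2 v1] assms by simp
  then have "(cmod (u1 * u2 - v1 * v2))\<^sup>2 \<le> (2 * D)\<^sup>2"
    by (intro power_mono) auto
  then have a: "(cmod (u1 * u2 - v1 * v2))\<^sup>2 \<le> 4 * D\<^sup>2"
    by (simp add: power_mult_distrib)
  have pq: "\<bar>(cmod (z * w))\<^sup>2 - ((cmod z)^4 + (cmod w)^4) / 2\<bar> \<le> 2 * D\<^sup>2"
    if "cmod z \<le> 1" "cmod w \<le> 1" "cmod (z - w) \<le> D" for z w :: complex
  proof -
    have "\<bar>(cmod z)\<^sup>2 - (cmod w)\<^sup>2\<bar>\<^sup>2 \<le> (2 * D)\<^sup>2"
      using square_norm_diff_le[OF that] by (intro power_mono) auto
    \<comment> \<open>AM-GM with its exact defect: p q = (p^2 + q^2) / 2 - (p - q)^2 / 2 for the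
      squared moduli p and q.\<close>
    moreover have "(cmod (z * w))\<^sup>2 - ((cmod z)^4 + (cmod w)^4) / 2 = - (((cmod z)\<^sup>2 - (cmod w)\<^sup>2)\<^sup>2) / 2"
      by (simp add: norm_mult power2_eq_square power4_eq_xxxx field_simps)
    ultimately show ?thesis by (simp add: power_mult_distrib)
  qed
  show ?thesis
    using a pq[OF assms(1,2,7)] pq[OF assms(3,4,8)]
      zero_le_power2[of "cmod (u1 * u2 - v1 * v2)"]
    unfolding Re_mult_cnj_polarization by argo
qed

lemma Re_monomial6:
  fixes u1 u2 u3 v1 v2 v3 :: complex
  assumes "cmod u1 \<le> 1" "cmod u2 \<le> 1" "cmod u3 \<le> 1" "cmod v1 \<le> 1" "cmod v2 \<le> 1" "cmod v3 \<le> 1"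
    and "cmod (u1 - v1) \<le> D" "cmod (u2 - v2) \<le> D" "cmod (u3 - v3) \<le> D"
    and "cmod (u1 - u2) \<le> D" "cmod (u2 - u3) \<le> D" "cmod (u1 - u3) \<le> D"
    and "cmod (v1 - v2) \<le> D" "cmod (v2 - v3) \<le> D" "cmod (v1 - v3) \<le> D"
  shows "\<bar>Re (u1 * u2 * u3 * cnj (v1 * v2 * v3))
          - ((cmod u1)^6 + (cmod u2)^6 + (cmod u3)^6 + (cmod v1)^6 + (cmod v2)^6 + (cmod v3)^6) / 6\<bar>
        \<le> 20 * D\<^sup>2"
proof -
  have "cmod (u1 * u2 * u3 - v1 * v2 * v3) \<le> 3 * D"
    using norm_mult_diff_le[of "u1 * u2" v3 u3 "v1 * v2"] norm_mult_diff_le[of u1 v2 u2 v1] assms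
    by (simp add: norm_mult mult_le_one)
  then have "(cmod (u1 * u2 * u3 - v1 * v2 * v3))\<^sup>2 \<le> (3 * D)\<^sup>2"
    by (intro power_mono) auto
  then have a: "(cmod (u1 * u2 * u3 - v1 * v2 * v3))\<^sup>2 \<le> 9 * D\<^sup>2"
    by (simp add: power_mult_distrib)
  have pqr: "\<bar>(cmod (z * w * t))\<^sup>2 - ((cmod z)^6 + (cmod w)^6 + (cmod t)^6) / 3\<bar> \<le> 6 * D\<^sup>2"
    if "cmod z \<le> 1" "cmod w \<le> 1" "cmod t \<le> 1"
      "cmod (z - w) \<le> D" "cmod (w - t) \<le> D" "cmod (z - t) \<le> D" for z w t :: complex
  proof -
    define p q r where "p = (cmod z)\<^sup>2" and "q = (cmod w)\<^sup>2" and "r = (cmod t)\<^sup>2"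
    have b: "0 \<le> p" "0 \<le> q" "0 \<le> r" "p \<le> 1" "q \<le> 1" "r \<le> 1"
      using that by (auto simp: p_def q_def r_def power_le_one)
    have "\<bar>p - q\<bar>\<^sup>2 \<le> (2 * D)\<^sup>2" "\<bar>q - r\<bar>\<^sup>2 \<le> (2 * D)\<^sup>2" "\<bar>p - r\<bar>\<^sup>2 \<le> (2 * D)\<^sup>2"
      unfolding p_def q_def r_def using that by (intro power_mono square_norm_diff_le; simp)+
    then have s: "(p - q)\<^sup>2 + (q - r)\<^sup>2 + (p - r)\<^sup>2 \<le> 12 * D\<^sup>2"
      by (simp add: power_mult_distrib)
    \<comment> \<open>The factorization of p^3 + q^3 + r^3 - 3 p q r shows that the defect of AM-GM
      for three numbers is also quadratic in their differences.\<close>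
    have "(p^3 + q^3 + r^3) / 3 - p * q * r
        = (p + q + r) * ((p - q)\<^sup>2 + (q - r)\<^sup>2 + (p - r)\<^sup>2) / 6"
      by (simp add: field_simps power2_eq_square power3_eq_cube)
    moreover have "0 \<le> (p + q + r) * ((p - q)\<^sup>2 + (q - r)\<^sup>2 + (p - r)\<^sup>2)"
      using b by (intro mult_nonneg_nonneg) auto
    moreover have "(p + q + r) * ((p - q)\<^sup>2 + (q - r)\<^sup>2 + (p - r)\<^sup>2) \<le> 3 * (12 * D\<^sup>2)"
      using b s by (intro mult_mono) auto
    ultimately have "\<bar>p * q * r - (p^3 + q^3 + r^3) / 3\<bar> \<le> 6 * D\<^sup>2" by linarith
    then show ?thesis
      by (simp add: p_def q_def r_def norm_mult power_mult_distrib flip: power_mult)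
  qed
  show ?thesis
    using a pqr[OF assms(1-3) assms(10-12)] pqr[OF assms(4-6) assms(13-15)]
      zero_le_power2[of "cmod (u1 * u2 * u3 - v1 * v2 * v3)"]
    unfolding Re_mult_cnj_polarization by argo
qed

text \<open>This is \<open>sum_rule_term\<close> at a = b = c = d with x = |d|^2. There the Taylor
  coefficients are x, x - 3 x^2 / 2 and x - 4 x^2 + 10 x^3 / 3; combined with weights 1/4, 1/2, -1/4
  they cancel the logarithm through order x^2.\<close>

definition sum_rule_main :: "real \<Rightarrow> real" where
  "sum_rule_main x = ln (1 - x) / 2 + x / 2 + x\<^sup>2 / 4 - 5 / 6 * x ^ 3"

text \<open>For four consecutive coefficients \<open>a, b, c, d\<close>, the first three Taylor coefficients at \<open>0\<close> of
  \<open>log (1 - d z b\<^sub>n(z))\<close>, where \<open>n\<close> is the index of \<open>d\<close>.\<close>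

definition taylor1 :: "complex \<Rightarrow> complex \<Rightarrow> complex" where
  "taylor1 c d = d * cnj c"

definition taylor2 :: "complex \<Rightarrow> complex \<Rightarrow> complex \<Rightarrow> complex" where
  "taylor2 b c d = d * (1 - c * cnj c) * cnj b - d\<^sup>2 * (cnj c)\<^sup>2 / 2"

definition taylor3 :: "complex \<Rightarrow> complex \<Rightarrow> complex \<Rightarrow> complex \<Rightarrow> complex" where
  "taylor3 a b c d = d * (1 - c * cnj c) * (1 - b * cnj b) * cnj a
     - d * (1 - c * cnj c) * c * (cnj b)\<^sup>2 - d\<^sup>2 * (1 - c * cnj c) * cnj c * cnj b
     + d ^ 3 * (cnj c) ^ 3 / 3"

text \<open>The factor 1/2 of the logarithm is the mean of V. The weights 1/4, 1/2, -1/4 are -2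
  times the Fourier coefficients -1/8, -1/4, 1/8 of V, because the logarithm of the weight changes
  by -2 times the real part of the expanded logarithm.\<close>

definition sum_rule_term :: "complex \<Rightarrow> complex \<Rightarrow> complex \<Rightarrow> complex \<Rightarrow> real" where
  "sum_rule_term a b c d = ln (1 - (cmod d)\<^sup>2) / 2
     + Re (taylor1 c d / 4 + taylor2 b c d / 2 - taylor3 a b c d / 4)"

text \<open>The Taylor coefficients expand into thirteen balanced monomials. Replacing each by a
  mean of powers of moduli, and then every modulus by that of d, yields the main part and the
  displayed differences. The latter are of first order in D and stay explicit, because they become
  harmless only when summed over n.\<close>

lemma sum_rule_term_approx:
  assumes n: "cmod a \<le> 1" "cmod b \<le> 1" "cmod c \<le> 1" "cmod d \<le> 1"
    and D: "cmod (a - b) \<le> D" "cmod (a - c) \<le> D" "cmod (a - d) \<le> D"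
      "cmod (b - c) \<le> D" "cmod (b - d) \<le> D" "cmod (c - d) \<le> D"
  shows "\<bar>sum_rule_term a b c d - sum_rule_main ((cmod d)\<^sup>2)
     - (((cmod c)\<^sup>2 - (cmod d)\<^sup>2) / 8 + ((cmod b)\<^sup>2 - (cmod d)\<^sup>2) / 4 - ((cmod a)\<^sup>2 - (cmod d)\<^sup>2) / 8
        - ((cmod c) ^ 4 - (cmod d) ^ 4) / 8 + 3 * ((cmod b) ^ 4 - (cmod d) ^ 4) / 16
        + ((cmod a) ^ 4 - (cmod d) ^ 4) / 8
        - 3 * ((cmod c) ^ 6 - (cmod d) ^ 6) / 8 - 5 * ((cmod b) ^ 6 - (cmod d) ^ 6) / 24
        - ((cmod a) ^ 6 - (cmod d) ^ 6) / 24)\<bar> \<le> 100 * D\<^sup>2"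
proof -
  have D': "cmod (b - a) \<le> D" "cmod (c - a) \<le> D" "cmod (d - a) \<le> D"
    "cmod (c - b) \<le> D" "cmod (d - b) \<le> D" "cmod (d - c) \<le> D"
    using D by (simp_all add: norm_minus_commute)
  have D0: "0 \<le> D" using D(1) norm_ge_zero order_trans by blast
  note facts = n D D' D0
  have "Re (taylor1 c d / 4 + taylor2 b c d / 2 - taylor3 a b c d / 4) =
      Re (d * cnj c) / 4 + Re (d * cnj b) / 2 - Re (d * cnj a) / 4
      - Re (d * c * cnj (c * b)) / 2 - Re (d * d * cnj (c * c)) / 4
      + Re (d * c * cnj (c * a)) / 4 + Re (d * b * cnj (b * a)) / 4
      + Re (d * c * cnj (b * b)) / 4 + Re (d * d * cnj (c * b)) / 4
      - Re (d * c * b * cnj (c * b * a)) / 4 - Re (d * c * c * cnj (c * b * b)) / 4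
      - Re (d * d * c * cnj (c * c * b)) / 4 - Re (d * d * d * cnj (c * c * c)) / 12"
  proof -
    have "taylor1 c d / 4 + taylor2 b c d / 2 - taylor3 a b c d / 4 =
      (d * cnj c) / 4 + (d * cnj b) / 2 - (d * cnj a) / 4
      - (d * c * cnj (c * b)) / 2 - (d * d * cnj (c * c)) / 4
      + (d * c * cnj (c * a)) / 4 + (d * b * cnj (b * a)) / 4
      + (d * c * cnj (b * b)) / 4 + (d * d * cnj (c * b)) / 4
      - (d * c * b * cnj (c * b * a)) / 4 - (d * c * c * cnj (c * b * b)) / 4
      - (d * d * c * cnj (c * c * b)) / 4 - (d * d * d * cnj (c * c * c)) / 12"
      unfolding taylor1_def taylor2_def taylor3_def complex_cnj_mult
      by (simp add: field_simps power2_eq_square power3_eq_cube)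
    then show ?thesis by (simp only: minus_complex.simps plus_complex.simps Re_divide_numeral)
  qed
  note eq = this
  have h2: "\<bar>Re (d * cnj c) - ((cmod d)\<^sup>2 + (cmod c)\<^sup>2) / 2\<bar> \<le> D\<^sup>2"
    "\<bar>Re (d * cnj b) - ((cmod d)\<^sup>2 + (cmod b)\<^sup>2) / 2\<bar> \<le> D\<^sup>2"
    "\<bar>Re (d * cnj a) - ((cmod d)\<^sup>2 + (cmod a)\<^sup>2) / 2\<bar> \<le> D\<^sup>2"
    by (intro Re_monomial2 facts)+
  have h4:
    "\<bar>Re (d * c * cnj (c * b)) - ((cmod d)^4 + (cmod c)^4 + (cmod c)^4 + (cmod b)^4) / 4\<bar> \<le> 5 * D\<^sup>2"
    "\<bar>Re (d * d * cnj (c * c)) - ((cmod d)^4 + (cmod d)^4 + (cmod c)^4 + (cmod c)^4) / 4\<bar> \<le> 5 * D\<^sup>2"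
    "\<bar>Re (d * c * cnj (c * a)) - ((cmod d)^4 + (cmod c)^4 + (cmod c)^4 + (cmod a)^4) / 4\<bar> \<le> 5 * D\<^sup>2"
    "\<bar>Re (d * b * cnj (b * a)) - ((cmod d)^4 + (cmod b)^4 + (cmod b)^4 + (cmod a)^4) / 4\<bar> \<le> 5 * D\<^sup>2"
    "\<bar>Re (d * c * cnj (b * b)) - ((cmod d)^4 + (cmod c)^4 + (cmod b)^4 + (cmod b)^4) / 4\<bar> \<le> 5 * D\<^sup>2"
    "\<bar>Re (d * d * cnj (c * b)) - ((cmod d)^4 + (cmod d)^4 + (cmod c)^4 + (cmod b)^4) / 4\<bar> \<le> 5 * D\<^sup>2"
    by (intro Re_monomial4; use facts in simp)+
  have h6:
    "\<bar>Re (d * c * b * cnj (c * b * a)) - ((cmod d)^6 + (cmod c)^6 + (cmod b)^6 + (cmod c)^6 + (cmod b)^6 + (cmod a)^6) / 6\<bar> \<le> 20 * D\<^sup>2"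
    "\<bar>Re (d * c * c * cnj (c * b * b)) - ((cmod d)^6 + (cmod c)^6 + (cmod c)^6 + (cmod c)^6 + (cmod b)^6 + (cmod b)^6) / 6\<bar> \<le> 20 * D\<^sup>2"
    "\<bar>Re (d * d * c * cnj (c * c * b)) - ((cmod d)^6 + (cmod d)^6 + (cmod c)^6 + (cmod c)^6 + (cmod c)^6 + (cmod b)^6) / 6\<bar> \<le> 20 * D\<^sup>2"
    "\<bar>Re (d * d * d * cnj (c * c * c)) - ((cmod d)^6 + (cmod d)^6 + (cmod d)^6 + (cmod c)^6 + (cmod c)^6 + (cmod c)^6) / 6\<bar> \<le> 20 * D\<^sup>2"
    by (intro Re_monomial6; use facts in simp)+
  have pw: "((cmod d)\<^sup>2)\<^sup>2 = (cmod d) ^ 4" "((cmod d)\<^sup>2) ^ 3 = (cmod d) ^ 6"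
    by (simp_all flip: power_mult)
  have D2: "0 \<le> D\<^sup>2" by simp
  \<comment> \<open>With the thirteen errors named, the claim is a linear identity in the powers of
    the moduli.\<close>
  define e0 where "e0 = Re (d * cnj c) - ((cmod d)\<^sup>2 + (cmod c)\<^sup>2) / 2"
  define e1 where "e1 = Re (d * cnj b) - ((cmod d)\<^sup>2 + (cmod b)\<^sup>2) / 2"
  define e2 where "e2 = Re (d * cnj a) - ((cmod d)\<^sup>2 + (cmod a)\<^sup>2) / 2"
  define e3 where "e3 = Re (d * c * cnj (c * b)) - ((cmod d)^4 + (cmod c)^4 + (cmod c)^4 + (cmod b)^4) / 4"
  define e4 where "e4 = Re (d * d * cnj (c * c)) - ((cmod d)^4 + (cmod d)^4 + (cmod c)^4 + (cmod c)^4) / 4"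
  define e5 where "e5 = Re (d * c * cnj (c * a)) - ((cmod d)^4 + (cmod c)^4 + (cmod c)^4 + (cmod a)^4) / 4"
  define e6 where "e6 = Re (d * b * cnj (b * a)) - ((cmod d)^4 + (cmod b)^4 + (cmod b)^4 + (cmod a)^4) / 4"
  define e7 where "e7 = Re (d * c * cnj (b * b)) - ((cmod d)^4 + (cmod c)^4 + (cmod b)^4 + (cmod b)^4) / 4"
  define e8 where "e8 = Re (d * d * cnj (c * b)) - ((cmod d)^4 + (cmod d)^4 + (cmod c)^4 + (cmod b)^4) / 4"
  define e9 where "e9 = Re (d * c * b * cnj (c * b * a)) - ((cmod d)^6 + (cmod c)^6 + (cmod b)^6 + (cmod c)^6 + (cmod b)^6 + (cmod a)^6) / 6"
  define e10 where "e10 = Re (d * c * c * cnj (c * b * b)) - ((cmod d)^6 + (cmod c)^6 + (cmod c)^6 + (cmod c)^6 + (cmod b)^6 + (cmod b)^6) / 6"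
  define e11 where "e11 = Re (d * d * c * cnj (c * c * b)) - ((cmod d)^6 + (cmod d)^6 + (cmod c)^6 + (cmod c)^6 + (cmod c)^6 + (cmod b)^6) / 6"
  define e12 where "e12 = Re (d * d * d * cnj (c * c * c)) - ((cmod d)^6 + (cmod d)^6 + (cmod d)^6 + (cmod c)^6 + (cmod c)^6 + (cmod c)^6) / 6"
  note e_defs = e0_def e1_def e2_def e3_def e4_def e5_def e6_def e7_def e8_def e9_def e10_def e11_def e12_def
  have "sum_rule_term a b c d - sum_rule_main ((cmod d)\<^sup>2)
     - (((cmod c)\<^sup>2 - (cmod d)\<^sup>2) / 8 + ((cmod b)\<^sup>2 - (cmod d)\<^sup>2) / 4 - ((cmod a)\<^sup>2 - (cmod d)\<^sup>2) / 8
        - ((cmod c) ^ 4 - (cmod d) ^ 4) / 8 + 3 * ((cmod b) ^ 4 - (cmod d) ^ 4) / 16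
        + ((cmod a) ^ 4 - (cmod d) ^ 4) / 8
        - 3 * ((cmod c) ^ 6 - (cmod d) ^ 6) / 8 - 5 * ((cmod b) ^ 6 - (cmod d) ^ 6) / 24
        - ((cmod a) ^ 6 - (cmod d) ^ 6) / 24)
    = e0 / 4 + e1 / 2 - e2 / 4 - e3 / 2 - e4 / 4 + e5 / 4 + e6 / 4 + e7 / 4 + e8 / 4
      - e9 / 4 - e10 / 4 - e11 / 4 - e12 / 12"
    unfolding sum_rule_term_def sum_rule_main_def eq pw e_defs by argo
  \<comment> \<open>The groups add up to at most (1 + 5 + 5 + 20 + 20) D^2, so the constant 100
    leaves ample room.\<close>
  moreover have "\<bar>e0 / 4 + e1 / 2 - e2 / 4\<bar> \<le> D\<^sup>2"
    using h2[folded e_defs] by argo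
  moreover have "\<bar>e3 / 2 + e4 / 4 - e5 / 4\<bar> \<le> 5 * D\<^sup>2" "\<bar>e6 / 4 + e7 / 4 + e8 / 4\<bar> \<le> 5 * D\<^sup>2"
    using h4[folded e_defs] by argo+
  moreover have "\<bar>e9 / 4 + e10 / 4\<bar> \<le> 20 * D\<^sup>2" "\<bar>e11 / 4 + e12 / 12\<bar> \<le> 20 * D\<^sup>2"
    using h6[folded e_defs] by argo+
  ultimately show ?thesis by argo
qed

text \<open>A shift by j is a chain of j unit shifts, and each of these telescopes to a difference
  of two values in [0, 1].\<close>

lemma telescope_bound:
  fixes f :: "nat \<Rightarrow> real"
  assumes "\<And>n. 0 \<le> f n" "\<And>n. f n \<le> 1" "m = k + j"
  shows "\<bar>\<Sum>n<N. f (n + k) - f (n + m)\<bar> \<le> real j"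
  unfolding assms(3)
proof (induction j)
  case (Suc j)
  have "(\<Sum>n<N. f (n + k) - f (n + (k + Suc j)))
      = (\<Sum>n<N. f (n + k) - f (n + (k + j))) + (\<Sum>n<N. f (n + (k + j)) - f (Suc n + (k + j)))"
    unfolding sum.distrib[symmetric] by (intro sum.cong) (auto simp: algebra_simps)
  also have "(\<Sum>n<N. f (n + (k + j)) - f (Suc n + (k + j))) = f (k + j) - f (N + (k + j))"
    by (induction N) auto
  finally show ?case
    using Suc assms(1)[of "k + j"] assms(2)[of "k + j"] assms(1)[of "N + (k + j)"] assms(2)[of "N + (k + j)"]
    by simp
qed simp

text \<open>The part of -ln (1 - x) beyond order 3 is nonnegative; dropping it leaves the cubic
  coefficient -1/6 - 5/6 = -1. This is valid on all of [0, 1), hence for coefficients arbitrarily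
  close to the circle.\<close>

lemma sum_rule_main_le:
  assumes "0 \<le> x" "x < 1"
  shows "sum_rule_main x \<le> - (x ^ 3)"
proof -
  define f where "f t = - ln (1 - t) - t - t\<^sup>2 / 2 - t ^ 3 / 3" for t :: real
  have "f 0 \<le> f x"
  proof (rule DERIV_nonneg_imp_nondecreasing[OF assms(1)])
    fix t assume t: "0 \<le> t" "t \<le> x"
    have "(f has_real_derivative (1 / (1 - t) - 1 - t - t\<^sup>2)) (at t)"
      unfolding f_def using t assms
      by (auto intro!: derivative_eq_intros simp: field_simps power2_eq_square)
    moreover have "1 / (1 - t) - 1 - t - t\<^sup>2 = t ^ 3 / (1 - t)"
      using t assms by (simp add: field_simps power2_eq_square power3_eq_cube)
    moreover have "t ^ 3 / (1 - t) \<ge> 0" using t assms by simp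
    ultimately show "\<exists>y. (f has_real_derivative y) (at t) \<and> y \<ge> 0" by metis
  qed
  then show ?thesis by (simp add: f_def sum_rule_main_def)
qed

text \<open>The auxiliary function has derivative t^2 (2 - 3 t) / (1 - t), nonnegative up to t =
  2/3. It contributes half of itself and leaves -1/2 - 5/6 = -4/3 as cubic coefficient, above
  -2.\<close>

lemma sum_rule_main_ge:
  assumes "0 \<le> x" "x \<le> 1 / 2"
  shows "sum_rule_main x \<ge> - 2 * x ^ 3"
proof -
  define f where "f t = ln (1 - t) + t + t\<^sup>2 / 2 + t ^ 3" for t :: real
  have "f 0 \<le> f x"
  proof (rule DERIV_nonneg_imp_nondecreasing[OF assms(1)])
    fix t assume t: "0 \<le> t" "t \<le> x"
    have "(f has_real_derivative (- 1 / (1 - t) + 1 + t + 3 * t\<^sup>2)) (at t)"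
      unfolding f_def using t assms
      by (auto intro!: derivative_eq_intros simp: field_simps power2_eq_square)
    moreover have "- 1 / (1 - t) + 1 + t + 3 * t\<^sup>2 = t\<^sup>2 * (2 - 3 * t) / (1 - t)"
      using t assms by (simp add: field_simps power2_eq_square)
    moreover have "t\<^sup>2 * (2 - 3 * t) / (1 - t) \<ge> 0" using t assms by simp
    ultimately show "\<exists>y. (f has_real_derivative y) (at t) \<and> y \<ge> 0" by metis
  qed
  moreover have "0 \<le> x ^ 3" using assms by simp
  moreover have "f 0 = 0" by (simp add: f_def)
  ultimately show ?thesis unfolding f_def sum_rule_main_def by linarith
qed

text \<open>Each term differs from its main part by a first-order expression \<open>L n\<close>,
  whose sums telescope, and by an error of size \<open>(D n)\<^sup>2\<close>, which is summable by
  hypothesis.\<close>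

lemma sum_rule_terms_bounded_diff:
  assumes n: "\<And>n. cmod (\<alpha> n) < 1"
    and s: "summable (\<lambda>n. (cmod (\<alpha> (Suc n) - \<alpha> n))\<^sup>2)"
  shows "\<exists>K. \<forall>N. \<bar>\<Sum>n<N. sum_rule_term (\<alpha> n) (\<alpha> (n + 1)) (\<alpha> (n + 2)) (\<alpha> (n + 3))
            - sum_rule_main ((cmod (\<alpha> (n + 3)))\<^sup>2)\<bar> \<le> K"
proof -
  define \<delta> where "\<delta> n = cmod (\<alpha> (Suc n) - \<alpha> n)" for n
  \<comment> \<open>Three consecutive steps bound all six distances among the four
    coefficients.\<close>
  define D where "D n = \<delta> n + \<delta> (n + 1) + \<delta> (n + 2)" for n
  have sd: "summable (\<lambda>n. (\<delta> n)\<^sup>2)" using s by (simp add: \<delta>_def)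
  have d0: "\<delta> n \<ge> 0" for n by (simp add: \<delta>_def)
  have D2: "(D n)\<^sup>2 \<le> 3 * ((\<delta> n)\<^sup>2 + (\<delta> (n + 1))\<^sup>2 + (\<delta> (n + 2))\<^sup>2)" for n
  proof -
    have id: "(x + y + z)\<^sup>2 = 3 * (x\<^sup>2 + y\<^sup>2 + z\<^sup>2) - ((x - y)\<^sup>2 + (y - z)\<^sup>2 + (x - z)\<^sup>2)" for x y z :: real
      by (simp add: power2_eq_square algebra_simps)
    have "0 \<le> (x - y)\<^sup>2 + (y - z)\<^sup>2 + (x - z)\<^sup>2" for x y z :: real by simp
    from this[of "\<delta> n" "\<delta> (n + 1)" "\<delta> (n + 2)"] show ?thesis unfolding D_def id by argo
  qed
  have sD: "summable (\<lambda>n. (D n)\<^sup>2)"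
  proof (rule summable_comparison_test')
    show "summable (\<lambda>n. 3 * ((\<delta> n)\<^sup>2 + (\<delta> (n + 1))\<^sup>2 + (\<delta> (n + 2))\<^sup>2))"
      by (intro summable_mult summable_add sd summable_ignore_initial_segment[OF sd])
  qed (use D2 in auto)
  define f where "f p n = (cmod (\<alpha> n)) ^ p" for p n
  have f01: "0 \<le> f p n" "f p n \<le> 1" for p n
    using n[of n] by (auto simp: f_def intro!: power_le_one)
  define L where "L n = (f 2 (n+2) - f 2 (n+3)) / 8 + (f 2 (n+1) - f 2 (n+3)) / 4
      - (f 2 n - f 2 (n+3)) / 8 - (f 4 (n+2) - f 4 (n+3)) / 8 + 3 * (f 4 (n+1) - f 4 (n+3)) / 16
      + (f 4 n - f 4 (n+3)) / 8 - 3 * (f 6 (n+2) - f 6 (n+3)) / 8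
      - 5 * (f 6 (n+1) - f 6 (n+3)) / 24 - (f 6 n - f 6 (n+3)) / 24" for n
  define T where "T n = sum_rule_term (\<alpha> n) (\<alpha> (n + 1)) (\<alpha> (n + 2)) (\<alpha> (n + 3))
            - sum_rule_main ((cmod (\<alpha> (n + 3)))\<^sup>2)" for n
  have TL: "\<bar>T n - L n\<bar> \<le> 100 * (D n)\<^sup>2" for n
  proof -
    have e1: "cmod (\<alpha> n - \<alpha> (n+1)) = \<delta> n" "cmod (\<alpha> (n+1) - \<alpha> (n+2)) = \<delta> (n+1)"
      "cmod (\<alpha> (n+2) - \<alpha> (n+3)) = \<delta> (n+2)"
      by (simp_all add: \<delta>_def norm_minus_commute numeral_3_eq_3 numeral_2_eq_2)
    have e2: "cmod (\<alpha> n - \<alpha> (n+2)) \<le> \<delta> n + \<delta> (n+1)" "cmod (\<alpha> (n+1) - \<alpha> (n+3)) \<le> \<delta> (n+1) + \<delta> (n+2)"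
      using norm_triangle_ineq[of "\<alpha> n - \<alpha> (n+1)" "\<alpha> (n+1) - \<alpha> (n+2)"]
        norm_triangle_ineq[of "\<alpha> (n+1) - \<alpha> (n+2)" "\<alpha> (n+2) - \<alpha> (n+3)"] e1 by simp_all
    have e3: "cmod (\<alpha> n - \<alpha> (n+3)) \<le> \<delta> n + \<delta> (n+1) + \<delta> (n+2)"
      using norm_triangle_ineq[of "\<alpha> n - \<alpha> (n+2)" "\<alpha> (n+2) - \<alpha> (n+3)"] e1 e2 by simp
    show ?thesis
      unfolding T_def L_def f_def
      by (rule sum_rule_term_approx)
        (use e1 e2 e3 d0[of n] d0[of "n+1"] d0[of "n+2"] n in \<open>auto simp: D_def less_imp_le\<close>)
  qed
  have "\<bar>\<Sum>n<N. f p (n + 2) - f p (n + 3)\<bar> \<le> real 1" "\<bar>\<Sum>n<N. f p (n + 1) - f p (n + 3)\<bar> \<le> real 2"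
    "\<bar>\<Sum>n<N. f p (n + 0) - f p (n + 3)\<bar> \<le> real 3" for N p
    by (rule telescope_bound; use f01 in simp)+
  note tel = this[unfolded of_nat_numeral of_nat_1 add_0_right]
  have L: "\<bar>\<Sum>n<N. L n\<bar> \<le> 10" for N
  proof -
    have "(\<Sum>n<N. L n) = (\<Sum>n<N. f 2 (n+2) - f 2 (n+3)) / 8 + (\<Sum>n<N. f 2 (n+1) - f 2 (n+3)) / 4
      - (\<Sum>n<N. f 2 n - f 2 (n+3)) / 8 - (\<Sum>n<N. f 4 (n+2) - f 4 (n+3)) / 8
      + 3 * (\<Sum>n<N. f 4 (n+1) - f 4 (n+3)) / 16
      + (\<Sum>n<N. f 4 n - f 4 (n+3)) / 8 - 3 * (\<Sum>n<N. f 6 (n+2) - f 6 (n+3)) / 8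
      - 5 * (\<Sum>n<N. f 6 (n+1) - f 6 (n+3)) / 24 - (\<Sum>n<N. f 6 n - f 6 (n+3)) / 24"
      unfolding L_def by (simp add: sum.distrib sum_subtractf flip: sum_divide_distrib sum_distrib_left)
    then show ?thesis
      using tel[of 2 N] tel[of 4 N] tel[of 6 N] by argo
  qed
  have "\<bar>\<Sum>n<N. T n\<bar> \<le> 10 + 100 * (\<Sum>n. (D n)\<^sup>2)" for N
  proof -
    have "\<bar>\<Sum>n<N. T n - L n\<bar> \<le> (\<Sum>n<N. 100 * (D n)\<^sup>2)"
      by (rule order_trans[OF sum_abs sum_mono]) (rule TL)
    also have "\<dots> \<le> 100 * (\<Sum>n. (D n)\<^sup>2)"
      unfolding sum_distrib_left[symmetric]
      by (intro mult_left_mono sum_le_suminf sD) auto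
    finally show ?thesis using L[of N] by (simp add: sum_subtractf)
  qed
  then show ?thesis unfolding T_def by blast
qed

text \<open>Up to a bounded error the sums are those of \<open>sum_rule_main\<close>. It is at most
  -x^3 everywhere and at least -2 x^3 for x <= 1/2, so boundedness below means summability of x^3,
  the sixth power of the modulus.\<close>

lemma sum_rule_bounded_below_iff:
  assumes n: "\<And>n. cmod (\<alpha> n) < 1"
    and s: "summable (\<lambda>n. (cmod (\<alpha> (Suc n) - \<alpha> n))\<^sup>2)"
  shows "(\<exists>C. \<forall>N. - C \<le> (\<Sum>n<N. sum_rule_term (\<alpha> n) (\<alpha> (n + 1)) (\<alpha> (n + 2)) (\<alpha> (n + 3))))
     \<longleftrightarrow> summable (\<lambda>n. cmod (\<alpha> n) ^ 6)"
proof -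
  define T where "T n = sum_rule_term (\<alpha> n) (\<alpha> (n + 1)) (\<alpha> (n + 2)) (\<alpha> (n + 3))" for n
  define x where "x n = (cmod (\<alpha> (n + 3)))\<^sup>2" for n
  obtain K where K: "\<And>N. \<bar>(\<Sum>n<N. T n) - (\<Sum>n<N. sum_rule_main (x n))\<bar> \<le> K"
    using sum_rule_terms_bounded_diff[OF assms] unfolding T_def x_def sum_subtractf by blast
  have x01: "0 \<le> x n" "x n < 1" for n
    using n[of "n+3"] by (auto simp: x_def power_less_one_iff)
  have x3: "x n ^ 3 = cmod (\<alpha> (n + 3)) ^ 6" for n by (simp add: x_def flip: power_mult)
  have sx: "summable (\<lambda>n. cmod (\<alpha> n) ^ 6) \<longleftrightarrow> summable (\<lambda>n. x n ^ 3)"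
    unfolding x3 by (rule summable_iff_shift[symmetric])
  show ?thesis unfolding sx T_def[symmetric]
  proof
    assume "\<exists>C. \<forall>N. - C \<le> sum T {..<N}"
    then obtain C where C: "\<And>N. - C \<le> sum T {..<N}" by blast
    have "(\<Sum>n<N. x n ^ 3) \<le> K + C" for N
    proof -
      have "(\<Sum>n<N. sum_rule_main (x n)) \<le> (\<Sum>n<N. - (x n ^ 3))"
        by (intro sum_mono sum_rule_main_le x01)
      then show ?thesis using C[of N] K[of N] by (simp add: sum_negf)
    qed
    then show "summable (\<lambda>n. x n ^ 3)"
      using x01 by (intro bounded_imp_summable[where B = "K + C"]) (simp_all only: lessThan_Suc_atMost[symmetric] zero_le_power)
  next
    assume S: "summable (\<lambda>n. x n ^ 3)"
    \<comment> \<open>Summability forces x to 0, so the lower bound, restricted to x <= 1/2, applies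
      from some index on.\<close>
    have "(\<lambda>n. x n ^ 3) \<longlonglongrightarrow> 0" by (rule summable_LIMSEQ_zero[OF S])
    then have "\<forall>\<^sub>F n in sequentially. x n ^ 3 < (1/2) ^ 3"
      by (rule order_tendstoD) simp
    then obtain M where M: "\<And>n. n \<ge> M \<Longrightarrow> x n ^ 3 < (1/2) ^ 3"
      unfolding eventually_sequentially by blast
    \<comment> \<open>The minimum with 0 makes the sign visible, so the lower bound alone controls
      the absolute value.\<close>
    define g where "g n = min 0 (sum_rule_main (x n))" for n
    have xM: "x n \<le> 1/2" if "n \<ge> M" for n
      using power_less_imp_less_base[OF M[OF that]] by simp
    have "summable g"
    proof (rule summable_comparison_test')
      show "summable (\<lambda>n. 2 * x n ^ 3)" by (intro summable_mult S)
      fix n assume "n \<ge> M"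
      then have "sum_rule_main (x n) \<ge> - 2 * x n ^ 3" by (intro sum_rule_main_ge x01 xM)
      then show "norm (g n) \<le> 2 * x n ^ 3" using x01[of n] by (auto simp: g_def min_def)
    qed
    then have "Bseq (\<lambda>N. \<Sum>n<N. g n)"
      by (intro convergent_imp_Bseq) (simp add: summable_iff_convergent)
    then obtain G where G: "\<And>N. \<bar>\<Sum>n<N. g n\<bar> \<le> G" unfolding Bseq_def by auto
    have "- (G + K) \<le> sum T {..<N}" for N
    proof -
      have "(\<Sum>n<N. g n) \<le> (\<Sum>n<N. sum_rule_main (x n))" by (intro sum_mono) (simp add: g_def)
      then show ?thesis using G[of N] K[of N] by simp
    qed
    then show "\<exists>C. \<forall>N. - C \<le> sum T {..<N}" by blast
  qed
qed

section \<open>Orthogonal polynomials on the unit circle\<close>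

lemma dtheta_density: "dtheta = density lborel (\<lambda>\<theta>. ennreal (indicator {0..2*pi} \<theta> / (2 * pi)))"
  unfolding dtheta_def uniform_measure_def
  by (intro density_cong AE_I2)
    (auto simp: indicator_def divide_ennreal ennreal_1[symmetric] simp del: ennreal_1)

lemma sets_dtheta [simp, measurable_cong]: "sets dtheta = sets borel"
  and space_dtheta [simp]: "space dtheta = UNIV"
  by (simp_all add: dtheta_def)

lemma prob_space_dtheta: "prob_space dtheta"
  unfolding dtheta_def by (rule prob_space_uniform_measure) auto

interpretation dtheta: prob_space dtheta
  by (rule prob_space_dtheta)

lemma AE_dtheta_iff: "(AE \<theta> in dtheta. P \<theta>) \<longleftrightarrow> (AE \<theta> in lborel. \<theta> \<in> {0..2*pi} \<longrightarrow> P \<theta>)"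
  unfolding dtheta_def by (rule AE_uniform_measure) auto

lemma integral_dtheta:
  fixes f :: "real \<Rightarrow> 'a::euclidean_space"
  assumes "continuous_on UNIV f"
  shows "integral\<^sup>L dtheta f = (1 / (2 * pi)) *\<^sub>R integral {0..2*pi} f"
proof -
  have [measurable]: "f \<in> borel_measurable borel"
    using assms by (rule borel_measurable_continuous_onI)
  have "set_integrable lborel {0..2*pi} f"
    by (intro borel_integrable_atLeastAtMost' continuous_on_subset[OF assms]) auto
  then have "integral {0..2*pi} f = (LINT x:{0..2*pi}|lborel. f x)"
    by (rule set_borel_integral_eq_integral(2)[symmetric])
  moreover have "integral\<^sup>L dtheta f = integral\<^sup>L lborel (\<lambda>\<theta>. (indicator {0..2*pi} \<theta> / (2 * pi)) *\<^sub>R f \<theta>)"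
    unfolding dtheta_density by (rule integral_density) auto
  moreover have "\<dots> = (1 / (2 * pi)) *\<^sub>R (LINT x:{0..2*pi}|lborel. f x)"
    unfolding set_lebesgue_integral_def integral_scaleR_right[symmetric]
    by (intro Bochner_Integration.integral_cong) auto
  ultimately show ?thesis by simp
qed

lemma continuous_on_cis_compose:
  assumes "continuous_on (sphere 0 1) f"
  shows "continuous_on UNIV (\<lambda>\<theta>. f (cis \<theta>))"
  by (rule continuous_on_compose2[OF assms]) (auto intro: continuous_intros)

lemma integrable_dtheta_cis:
  fixes f :: "complex \<Rightarrow> 'a::{banach, second_countable_topology}"
  assumes "continuous_on (sphere 0 1) f"
  shows "integrable dtheta (\<lambda>\<theta>. f (cis \<theta>))"
proof -
  have "bounded (f ` sphere 0 1)"
    by (intro compact_imp_bounded compact_continuous_image assms) auto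
  then obtain B where B: "\<And>z. z \<in> sphere 0 1 \<Longrightarrow> norm (f z) \<le> B"
    unfolding bounded_iff by blast
  have "(\<lambda>\<theta>. f (cis \<theta>)) \<in> borel_measurable borel"
    by (intro borel_measurable_continuous_onI continuous_on_cis_compose assms)
  then show ?thesis
    by (intro dtheta.integrable_const_bound[where B = B]) (auto intro!: AE_I2 B)
qed

text \<open>Cauchy's formula at 0 on the unit circle itself. Continuity up to the boundary is
  enough, so analytic integrands built from polynomials without zeros in the closed disc are
  evaluated by their value at 0.\<close>

lemma mean_value_disc:
  assumes c: "continuous_on (cball 0 1) h" and h: "h holomorphic_on ball 0 1"
  shows "(LINT \<theta>|dtheta. h (cis \<theta>)) = h 0"
proof -
  have "((\<lambda>u. h u / (u - 0)) has_contour_integral (2 * of_real pi * \<i> * h 0)) (circlepath 0 1)"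
    by (rule Cauchy_integral_circlepath[OF c h]) auto
  then have "((\<lambda>t. h (0 + 1 * cis t) / (0 + 1 * cis t - 0) * of_real 1 * \<i> * cis t)
      has_integral (2 * of_real pi * \<i> * h 0)) {0..2*pi}"
    unfolding circlepath_def by (subst (asm) has_contour_integral_part_circlepath_iff) auto
  then have "((\<lambda>t. h (cis t) * \<i>) has_integral (2 * of_real pi * \<i> * h 0)) {0..2*pi}"
    by simp
  from has_integral_mult_left[OF this, of "-\<i>"]
  have "((\<lambda>t. h (cis t)) has_integral (2 * of_real pi * h 0)) {0..2*pi}"
    by (simp add: mult_ac)
  then have "integral {0..2*pi} (\<lambda>t. h (cis t)) = 2 * of_real pi * h 0"
    by (rule integral_unique)
  moreover have "continuous_on UNIV (\<lambda>\<theta>. h (cis \<theta>))"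
    by (intro continuous_on_cis_compose continuous_on_subset[OF c]) auto
  ultimately show ?thesis
    by (simp add: integral_dtheta scaleR_conv_of_real)
qed

section \<open>Reversed polynomials\<close>

lemma mult_cnj_on_circle: "z \<in> sphere 0 1 \<Longrightarrow> z * cnj z = 1"
  by (simp add: complex_norm_square[symmetric])

text \<open>The Szego dual z^d cnj (p (1 / cnj z)), where d is the actual degree of p. For \<Phi>_n
  this degree is n, as in the usual convention; for other polynomials a power of z may have to be
  supplied.\<close>

definition rev_poly :: "complex poly \<Rightarrow> complex poly" where
  "rev_poly p = reflect_poly (map_poly cnj p)"

lemma poly_rev_poly:
  assumes "z \<in> sphere 0 1"
  shows "poly (rev_poly p) z = z ^ degree p * cnj (poly p z)"
proof -
  have z: "z \<noteq> 0" "inverse z = cnj z"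
    using assms inverse_unique[OF mult_cnj_on_circle[OF assms]] by auto
  have d: "degree (map_poly cnj p) = degree p" by (intro degree_map_poly) auto
  have "poly (rev_poly p) z = z ^ degree p * poly (map_poly cnj p) (cnj z)"
    unfolding rev_poly_def using poly_reflect_poly_nz[OF z(1), of "map_poly cnj p"] z(2) d by simp
  then show ?thesis by (simp flip: poly_cnj)
qed

lemma degree_rev_poly: "degree (rev_poly p) \<le> degree p"
  unfolding rev_poly_def
  by (rule order_trans[OF degree_reflect_poly_le]) (simp add: degree_map_poly)

lemma poly_rev_poly_0: "poly (rev_poly p) 0 = cnj (lead_coeff p)"
  unfolding rev_poly_def by (simp add: degree_map_poly coeff_map_poly)

lemma cmod_poly_rev_poly: "z \<in> sphere 0 1 \<Longrightarrow> cmod (poly (rev_poly p) z) = cmod (poly p z)"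
  by (simp add: poly_rev_poly norm_mult norm_power)

text \<open>The circle is infinite. Polynomial identities can therefore be checked where cnj z = 1 /
  z, so that reversal is a conjugation.\<close>

lemma poly_eq_on_circle:
  fixes p q :: "complex poly"
  assumes "\<And>z. z \<in> sphere 0 1 \<Longrightarrow> poly p z = poly q z"
  shows "p = q"
proof (rule ccontr)
  assume "p \<noteq> q"
  then have "finite {z. poly (p - q) z = 0}" by (intro poly_roots_finite) auto
  moreover have "sphere 0 1 \<subseteq> {z. poly (p - q) z = 0}" using assms by auto
  ultimately have "finite (sphere 0 1 :: complex set)" by (rule finite_subset[rotated])
  moreover have "infinite (sphere 0 1 :: complex set)"
  proof
    assume "finite (sphere 0 1 :: complex set)"
    moreover have "connected (sphere 0 1 :: complex set)" by (rule connected_sphere) simp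
    ultimately have "sphere 0 1 = {} \<or> (\<exists>x. sphere 0 1 = {x :: complex})"
      by (simp add: connected_finite_iff_sing)
    moreover have "(1::complex) \<in> sphere 0 1" "(-1::complex) \<in> sphere 0 1" by auto
    ultimately have "(1::complex) = -1" by (metis empty_iff singletonD)
    then show False by simp
  qed
  ultimately show False by blast
qed

locale opuc =
  fixes \<mu> :: "complex measure" and \<Phi> :: "nat \<Rightarrow> complex poly"
  assumes prob_on_circle: "prob_on_circle \<mu>"
    and infinite_support: "infinite (measure_support \<mu>)"
    and orthogonal_polys: "monic_orthogonal_polys \<mu> \<Phi>"
begin

lemma sets_mu [measurable_cong]: "sets \<mu> = sets (restrict_space borel (sphere 0 1))"
  using prob_on_circle by (simp add: prob_on_circle_def circle_borel_def)

lemma space_mu [simp]: "space \<mu> = sphere 0 1"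
  using sets_eq_imp_space_eq[OF sets_mu] by (simp add: space_restrict_space)

sublocale prob_space \<mu>
  using prob_on_circle by (simp add: prob_on_circle_def)

lemma measurable_mu:
  fixes f :: "complex \<Rightarrow> 'a::topological_space"
  assumes "continuous_on (sphere 0 1) f"
  shows "f \<in> borel_measurable \<mu>"
  using borel_measurable_continuous_on_restrict[OF assms]
  by (simp cong: measurable_cong_sets add: sets_mu)

lemma integrable_mu:
  fixes f :: "complex \<Rightarrow> 'a::{banach, second_countable_topology}"
  assumes "continuous_on (sphere 0 1) f"
  shows "integrable \<mu> f"
proof -
  have "bounded (f ` sphere 0 1)"
    by (intro compact_imp_bounded compact_continuous_image assms) auto
  then obtain B where B: "\<And>z. z \<in> sphere 0 1 \<Longrightarrow> norm (f z) \<le> B"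
    unfolding bounded_iff by blast
  show ?thesis
    by (intro integrable_const_bound[where B = B] measurable_mu assms) (auto intro!: AE_I2 B)
qed

lemma degree_Phi [simp]: "degree (\<Phi> n) = n"
  and lead_coeff_Phi: "coeff (\<Phi> n) n = 1"
  using orthogonal_polys unfolding monic_orthogonal_polys_def by metis+

lemma Phi_0 [simp]: "\<Phi> 0 = 1"
  using degree_Phi[of 0] lead_coeff_Phi[of 0] by (metis degree_0_id of_nat_0 one_pCons)

text \<open>Infinite support enters here: if the polynomial vanished almost everywhere, the support
  would lie in its finite set of zeros.\<close>

lemma norm_pos:
  assumes "p \<noteq> 0"
  shows "0 < (LINT z|\<mu>. (cmod (poly p z))\<^sup>2)"
proof (rule ccontr)
  have int: "integrable \<mu> (\<lambda>z. (cmod (poly p z))\<^sup>2)"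
    by (intro integrable_mu continuous_intros)
  assume "\<not> ?thesis"
  moreover have "0 \<le> (LINT z|\<mu>. (cmod (poly p z))\<^sup>2)" by simp
  ultimately have "(LINT z|\<mu>. (cmod (poly p z))\<^sup>2) = 0" by linarith
  then have "AE z in \<mu>. (cmod (poly p z))\<^sup>2 = 0"
    using integral_nonneg_eq_0_iff_AE[OF int] by simp
  then have AE: "AE z in \<mu>. poly p z = 0" by simp
  have fin: "finite {z. poly p z = 0}" using assms by (rule poly_roots_finite)
  have "measure_support \<mu> \<subseteq> {z. poly p z = 0}"
  proof (rule subsetI, rule ccontr)
    fix z assume z: "z \<in> measure_support \<mu>" "z \<notin> {z. poly p z = 0}"
    have op: "open (- {z. poly p z = 0})" using fin by (simp add: finite_imp_closed open_Compl)
    have "{z \<in> space \<mu>. \<not> poly p z = 0} = - {z. poly p z = 0} \<inter> sphere 0 1" by auto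
    moreover have "- {z. poly p z = 0} \<inter> sphere 0 1 \<in> sets \<mu>"
      unfolding sets_mu sets_restrict_space
      by (rule image_eqI[OF _ borel_open[OF op]]) (rule Int_commute)
    ultimately have "emeasure \<mu> (- {z. poly p z = 0} \<inter> sphere 0 1) = 0"
      using AE AE_iff_measurable[of "- {z. poly p z = 0} \<inter> sphere 0 1" \<mu> "\<lambda>z. poly p z = 0"] by blast
    moreover have "emeasure \<mu> (- {z. poly p z = 0} \<inter> sphere 0 1) > 0"
      using z op unfolding measure_support_def by blast
    ultimately show False by simp
  qed
  then show False using fin infinite_support finite_subset by blast
qed

text \<open>Subtracting a multiple of the monic \<Phi>_d lowers the degree d of q, so q is a
  combination of \<Phi>_0, ..., \<Phi>_d.\<close>

lemma orthogonal_lower: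
  assumes "degree q < n"
  shows "(LINT z|\<mu>. cnj (poly q z) * poly (\<Phi> n) z) = 0"
  using assms
proof (induction "degree q" arbitrary: q rule: less_induct)
  case less
  define d where "d = degree q"
  define r where "r = q - smult (coeff q d) (\<Phi> d)"
  have q: "poly q z = coeff q d * poly (\<Phi> d) z + poly r z" for z by (simp add: r_def)
  have "coeff r d = 0" "degree r \<le> d"
    by (auto simp: r_def lead_coeff_Phi d_def intro!: degree_diff_le)
  then have "r = 0 \<or> degree r < d" using eq_zero_or_degree_less by blast
  then have r0: "(LINT z|\<mu>. cnj (poly r z) * poly (\<Phi> n) z) = 0"
    using less unfolding d_def by (auto simp: d_def)
  have d0: "(LINT z|\<mu>. cnj (poly (\<Phi> d) z) * poly (\<Phi> n) z) = 0"
    using orthogonal_polys less.prems unfolding monic_orthogonal_polys_def d_def by auto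
  have "(LINT z|\<mu>. cnj (poly q z) * poly (\<Phi> n) z)
      = (LINT z|\<mu>. cnj (coeff q d) * (cnj (poly (\<Phi> d) z) * poly (\<Phi> n) z)
            + cnj (poly r z) * poly (\<Phi> n) z)"
    by (simp add: q algebra_simps)
  also have "\<dots> = cnj (coeff q d) * (LINT z|\<mu>. cnj (poly (\<Phi> d) z) * poly (\<Phi> n) z)
      + (LINT z|\<mu>. cnj (poly r z) * poly (\<Phi> n) z)"
    by (subst Bochner_Integration.integral_add)
      (auto intro!: integrable_mu continuous_intros)
  finally show ?case using r0 d0 by simp
qed

text \<open>On the circle, pairing z q with the dual of \<Phi>_n is the conjugate of pairing z^(n-1)
  cnj q with \<Phi>_n, and the former is again given by a polynomial of degree below n.\<close>

lemma orthogonal_rev: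
  assumes "degree q < n"
  shows "(LINT z|\<mu>. cnj (z * poly q z) * poly (rev_poly (\<Phi> n)) z) = 0"
proof -
  \<comment> \<open>On the circle this is z^(n-1) cnj q; the monomial bridges the gap between
    \<open>degree q\<close> and n - 1.\<close>
  define r where "r = monom 1 (n - Suc (degree q)) * rev_poly q"
  have dr: "degree r < n"
  proof -
    have "degree r \<le> (n - Suc (degree q)) + degree q"
      unfolding r_def using degree_rev_poly[of q]
      by (intro order_trans[OF degree_mult_le] add_mono) (auto simp: degree_monom_le)
    then show ?thesis using assms by linarith
  qed
  have "(LINT z|\<mu>. cnj (z * poly q z) * poly (rev_poly (\<Phi> n)) z)
      = (LINT z|\<mu>. cnj (cnj (poly r z) * poly (\<Phi> n) z))"
  proof (intro Bochner_Integration.integral_cong refl)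
    fix z assume "z \<in> space \<mu>"
    then have z: "z \<in> sphere 0 1" by simp
    have "poly r z = z ^ (n - Suc (degree q) + degree q) * cnj (poly q z)"
      by (simp add: r_def poly_monom poly_rev_poly[OF z] power_add)
    moreover have "n = Suc (n - Suc (degree q) + degree q)" using assms by simp
    then have "z ^ n = z * z ^ (n - Suc (degree q) + degree q)" by (metis power_Suc)
    ultimately have "cnj (z * poly q z) * poly (rev_poly (\<Phi> n)) z = (z * cnj z) * (poly r z * cnj (poly (\<Phi> n) z))"
      by (simp add: poly_rev_poly[OF z] mult_ac)
    then show "cnj (z * poly q z) * poly (rev_poly (\<Phi> n)) z = cnj (cnj (poly r z) * poly (\<Phi> n) z)"
      using mult_cnj_on_circle[OF z] by simp
  qed
  also have "\<dots> = cnj (LINT z|\<mu>. cnj (poly r z) * poly (\<Phi> n) z)" by (rule Bochner_Integration.integral_cnj)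
  finally show ?thesis using orthogonal_lower[OF dr] by simp
qed

text \<open>The defect E of the recurrence vanishes at 0, by the choice of the Verblunsky
  coefficient, and has degree at most n because the leading terms cancel. So E = z F with F of
  degree below n. Now \<Phi>_(n+1), z \<Phi>_n and the dual of \<Phi>_n are all orthogonal to such z
  F, hence E is orthogonal to itself.\<close>

lemma szego_recurrence:
  "\<Phi> (Suc n) = pCons 0 (\<Phi> n) - smult (cnj (verblunsky \<Phi> n)) (rev_poly (\<Phi> n))"
proof -
  define E where "E = \<Phi> (Suc n) - pCons 0 (\<Phi> n) + smult (cnj (verblunsky \<Phi> n)) (rev_poly (\<Phi> n))"
  have "poly E 0 = 0"
    by (simp add: E_def verblunsky_def poly_rev_poly_0 lead_coeff_Phi)
  then obtain F where F: "E = pCons 0 F"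
    by (cases E) auto
  have "degree E \<le> Suc n" "coeff E (Suc n) = 0"
    using degree_rev_poly[of "\<Phi> n"] lead_coeff_Phi[of n] lead_coeff_Phi[of "Suc n"]
    by (auto simp: E_def intro!: degree_add_le degree_diff_le coeff_eq_0 order_trans[OF degree_smult_le])
  then have "E = 0 \<or> degree E < Suc n" using eq_zero_or_degree_less by blast
  then have dF: "F = 0 \<or> degree F < n" unfolding F by (auto split: if_splits)
  have "E = 0"
  proof (rule ccontr)
    assume "E \<noteq> 0"
    then have "F \<noteq> 0" "degree F < n" using F dF by auto
    have "(LINT z|\<mu>. cnj (poly E z) * poly E z)
       = (LINT z|\<mu>. cnj (poly (pCons 0 F) z) * poly (\<Phi> (Suc n)) z - cnj (poly F z) * poly (\<Phi> n) z
          + cnj (verblunsky \<Phi> n) * (cnj (z * poly F z) * poly (rev_poly (\<Phi> n)) z))"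
    proof (intro Bochner_Integration.integral_cong refl)
      fix z assume "z \<in> space \<mu>"
      then have "z * cnj z = 1" using mult_cnj_on_circle by simp
      then have "cnj (poly F z) * poly (\<Phi> n) z = (z * cnj z) * (cnj (poly F z) * poly (\<Phi> n) z)" by simp
      then have "cnj (poly F z) * poly (\<Phi> n) z = cnj (z * poly F z) * (z * poly (\<Phi> n) z)"
        by (simp add: mult_ac)
      moreover have e: "poly E z = poly (\<Phi> (Suc n)) z - z * poly (\<Phi> n) z
          + cnj (verblunsky \<Phi> n) * poly (rev_poly (\<Phi> n)) z" by (simp add: E_def)
      have "cnj (poly E z) * poly E z = cnj (z * poly F z) * (poly (\<Phi> (Suc n)) z - z * poly (\<Phi> n) z
          + cnj (verblunsky \<Phi> n) * poly (rev_poly (\<Phi> n)) z)"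
        unfolding e[symmetric] by (simp add: F)
      then have "cnj (poly E z) * poly E z = cnj (z * poly F z) * poly (\<Phi> (Suc n)) z
          - cnj (z * poly F z) * (z * poly (\<Phi> n) z)
          + cnj (verblunsky \<Phi> n) * (cnj (z * poly F z) * poly (rev_poly (\<Phi> n)) z)"
        by (simp only: ring_distribs mult.left_commute)
      ultimately show "cnj (poly E z) * poly E z = cnj (poly (pCons 0 F) z) * poly (\<Phi> (Suc n)) z
          - cnj (poly F z) * poly (\<Phi> n) z
          + cnj (verblunsky \<Phi> n) * (cnj (z * poly F z) * poly (rev_poly (\<Phi> n)) z)"
        by simp
    qed
    also have "\<dots> = (LINT z|\<mu>. cnj (poly (pCons 0 F) z) * poly (\<Phi> (Suc n)) z)
        - (LINT z|\<mu>. cnj (poly F z) * poly (\<Phi> n) z)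
        + cnj (verblunsky \<Phi> n) * (LINT z|\<mu>. cnj (z * poly F z) * poly (rev_poly (\<Phi> n)) z)"
      by (simp add: integrable_mu continuous_intros)
    also have "\<dots> = 0"
      using orthogonal_rev[OF \<open>degree F < n\<close>] orthogonal_lower[OF \<open>degree F < n\<close>]
        orthogonal_lower[of "pCons 0 F" "Suc n"] \<open>degree F < n\<close> \<open>F \<noteq> 0\<close> by (simp del: complex_cnj_mult poly_pCons)
    finally have "(LINT z|\<mu>. of_real ((cmod (poly E z))\<^sup>2)) = (0::complex)"
      by (simp only: complex_norm_square mult.commute)
    then have "(LINT z|\<mu>. (cmod (poly E z))\<^sup>2) = 0"
      by (simp only: integral_complex_of_real of_real_eq_0_iff)
    then show False using norm_pos[OF \<open>E \<noteq> 0\<close>] by simp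
  qed
  then have "\<Phi> (Suc n) - pCons 0 (\<Phi> n) = - smult (cnj (verblunsky \<Phi> n)) (rev_poly (\<Phi> n))"
    unfolding E_def by (simp only: eq_neg_iff_add_eq_0)
  then have "\<Phi> (Suc n) = - smult (cnj (verblunsky \<Phi> n)) (rev_poly (\<Phi> n)) + pCons 0 (\<Phi> n)"
    by (simp only: diff_eq_eq)
  then show ?thesis by (simp only: uminus_add_conv_diff)
qed

lemma rev_poly_recurrence:
  "rev_poly (\<Phi> (Suc n)) = rev_poly (\<Phi> n) - smult (verblunsky \<Phi> n) (pCons 0 (\<Phi> n))"
proof (rule poly_eq_on_circle)
  fix z :: complex assume z: "z \<in> sphere 0 1"
  note zz = mult_cnj_on_circle[OF z]
  have p: "z ^ n * cnj z ^ n = 1" using zz by (simp flip: power_mult_distrib)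
  have "poly (rev_poly (\<Phi> (Suc n))) z
      = z ^ Suc n * cnj (z * poly (\<Phi> n) z - cnj (verblunsky \<Phi> n) * poly (rev_poly (\<Phi> n)) z)"
    unfolding poly_rev_poly[OF z] degree_Phi by (simp add: szego_recurrence poly_rev_poly[OF z])
  also have "\<dots> = (z * cnj z) * (z ^ n * cnj (poly (\<Phi> n) z))
      - verblunsky \<Phi> n * z * (z ^ n * cnj z ^ n) * poly (\<Phi> n) z"
    by (simp add: poly_rev_poly[OF z] ring_distribs mult_ac)
  finally show "poly (rev_poly (\<Phi> (Suc n))) z
      = poly (rev_poly (\<Phi> n) - smult (verblunsky \<Phi> n) (pCons 0 (\<Phi> n))) z"
    by (simp add: zz p poly_rev_poly[OF z] mult_ac)
qed

definition norm_sq :: "nat \<Rightarrow> real" where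
  "norm_sq n = (LINT z|\<mu>. (cmod (poly (\<Phi> n) z))\<^sup>2)"

lemma norm_sq_pos: "0 < norm_sq n"
proof -
  have "\<Phi> n \<noteq> 0" using lead_coeff_Phi[of n] by auto
  then show ?thesis unfolding norm_sq_def by (rule norm_pos)
qed

lemma norm_sq_0 [simp]: "norm_sq 0 = 1"
  by (simp add: norm_sq_def prob_space[simplified])

text \<open>Pythagoras for z \<Phi>_n = \<Phi>_(n+1) + cnj \<alpha>_n R with R the dual of \<Phi>_n:
  R has degree at most n, so the summands are orthogonal, and R has the modulus of \<Phi>_n on the
  circle.\<close>

lemma norm_sq_Suc: "norm_sq (Suc n) = (1 - (cmod (verblunsky \<Phi> n))\<^sup>2) * norm_sq n"
proof -
  define a where "a = verblunsky \<Phi> n"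
  define R where "R = rev_poly (\<Phi> n)"
  have orth: "(LINT z|\<mu>. cnj (poly R z) * poly (\<Phi> (Suc n)) z) = 0"
    using degree_rev_poly[of "\<Phi> n"] by (intro orthogonal_lower) (simp add: R_def)
  have pt: "(cmod (poly (\<Phi> n) z))\<^sup>2 = (cmod (poly (\<Phi> (Suc n)) z))\<^sup>2 + (cmod a)\<^sup>2 * (cmod (poly (\<Phi> n) z))\<^sup>2
      + 2 * Re (a * (cnj (poly R z) * poly (\<Phi> (Suc n)) z))" if "z \<in> space \<mu>" for z
  proof -
    have z: "z \<in> sphere 0 1" using that by simp
    have "cmod (poly (\<Phi> n) z) = cmod (poly (\<Phi> (Suc n)) z + cnj a * poly R z)"
      using z by (simp add: szego_recurrence a_def R_def norm_mult)
    moreover have "(cmod (u + cnj a * v))\<^sup>2 = (cmod u)\<^sup>2 + (cmod a)\<^sup>2 * (cmod v)\<^sup>2 + 2 * Re (a * (cnj v * u))"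
      for u v
      by (simp only: cmod_power2) (simp add: power2_eq_square algebra_simps)
    moreover have "cmod (poly R z) = cmod (poly (\<Phi> n) z)"
      using cmod_poly_rev_poly[OF z] by (simp only: R_def)
    ultimately show ?thesis by metis
  qed
  have i1: "integrable \<mu> (\<lambda>z. (cmod (poly (\<Phi> (Suc n)) z))\<^sup>2)"
    and i2: "integrable \<mu> (\<lambda>z. (cmod a)\<^sup>2 * (cmod (poly (\<Phi> n) z))\<^sup>2)"
    and i3: "integrable \<mu> (\<lambda>z. 2 * Re (a * (cnj (poly R z) * poly (\<Phi> (Suc n)) z)))"
    by (intro integrable_mu continuous_intros)+
  have "norm_sq n = (LINT z|\<mu>. (cmod (poly (\<Phi> (Suc n)) z))\<^sup>2 + (cmod a)\<^sup>2 * (cmod (poly (\<Phi> n) z))\<^sup>2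
      + 2 * Re (a * (cnj (poly R z) * poly (\<Phi> (Suc n)) z)))"
    unfolding norm_sq_def by (intro Bochner_Integration.integral_cong refl pt)
  also have "\<dots> = norm_sq (Suc n) + (cmod a)\<^sup>2 * norm_sq n
      + 2 * (LINT z|\<mu>. Re (a * (cnj (poly R z) * poly (\<Phi> (Suc n)) z)))"
    unfolding norm_sq_def
    by (simp only: Bochner_Integration.integral_add[OF Bochner_Integration.integrable_add[OF i1 i2] i3]
        Bochner_Integration.integral_add[OF i1 i2] integral_mult_right_zero)
  also have "(LINT z|\<mu>. Re (a * (cnj (poly R z) * poly (\<Phi> (Suc n)) z)))
      = Re (LINT z|\<mu>. a * (cnj (poly R z) * poly (\<Phi> (Suc n)) z))"
    by (rule integral_Re) (intro integrable_mu continuous_intros)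
  also have "\<dots> = 0" by (simp only: integral_mult_right_zero orth mult_zero_right zero_complex.simps)
  finally have "norm_sq n = norm_sq (Suc n) + (cmod a)\<^sup>2 * norm_sq n + 2 * 0" .
  then show ?thesis unfolding a_def left_diff_distrib by linarith
qed

lemma cmod_verblunsky_less_1: "cmod (verblunsky \<Phi> n) < 1"
proof -
  have "0 < (1 - (cmod (verblunsky \<Phi> n))\<^sup>2) * norm_sq n"
    using norm_sq_pos[of "Suc n"] by (simp add: norm_sq_Suc)
  then have "(cmod (verblunsky \<Phi> n))\<^sup>2 < 1" using norm_sq_pos[of n] by (simp add: zero_less_mult_iff)
  then show ?thesis by (simp add: power_less_one_iff)
qed

text \<open>Both claims pass through the recurrences together. |v| <= |u| and |a| < 1 exclude u = a
  v, and |u - a v|^2 - |v - cnj a u|^2 = (1 - |a|^2) (|u|^2 - |v|^2) preserves the inequality. The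
  absence of zeros in the closed disc is what makes the mean value property available for quotients
  by duals.\<close>

lemma disc_bound:
  assumes z: "z \<in> cball 0 1"
  shows "poly (rev_poly (\<Phi> n)) z \<noteq> 0 \<and> cmod (poly (\<Phi> n) z) \<le> cmod (poly (rev_poly (\<Phi> n)) z)"
proof (induction n)
  case 0
  show ?case by (simp add: rev_poly_def)
next
  case (Suc n)
  define u v a where "u = poly (rev_poly (\<Phi> n)) z" and "v = z * poly (\<Phi> n) z" and "a = verblunsky \<Phi> n"
  have a: "cmod a < 1" unfolding a_def by (rule cmod_verblunsky_less_1)
  have "cmod v \<le> 1 * cmod (poly (\<Phi> n) z)"
    unfolding v_def norm_mult using z by (intro mult_right_mono) auto
  then have v: "cmod v \<le> cmod u" and u: "0 < cmod u" using Suc by (auto simp: u_def)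
  have "cmod a * cmod v \<le> cmod a * cmod u" using v by (intro mult_left_mono) auto
  also have "\<dots> < cmod u" using a u by simp
  finally have "a * v \<noteq> u" by (metis norm_mult order_less_irrefl)
  moreover have "(cmod (u - a * v))\<^sup>2 - (cmod (v - cnj a * u))\<^sup>2 = (1 - (cmod a)\<^sup>2) * ((cmod u)\<^sup>2 - (cmod v)\<^sup>2)"
    by (simp only: cmod_power2) (simp add: power2_eq_square algebra_simps)
  moreover have "(1 - (cmod a)\<^sup>2) * ((cmod u)\<^sup>2 - (cmod v)\<^sup>2) \<ge> 0"
    using a v by (intro mult_nonneg_nonneg) (auto simp: power_le_one power_mono)
  ultimately have sq: "(cmod (v - cnj a * u))\<^sup>2 \<le> (cmod (u - a * v))\<^sup>2" and nz: "u - a * v \<noteq> 0"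
    by (linarith, simp)
  have "cmod (v - cnj a * u) \<le> cmod (u - a * v)"
    by (rule power2_le_imp_le[OF sq]) simp
  moreover have "poly (\<Phi> (Suc n)) z = v - cnj a * u"
    by (simp add: szego_recurrence u_def v_def a_def)
  moreover have "poly (rev_poly (\<Phi> (Suc n))) z = u - a * v"
    by (simp add: rev_poly_recurrence u_def v_def a_def)
  ultimately show ?case using nz by simp
qed

lemmas rev_poly_nonzero = disc_bound[THEN conjunct1]
lemmas Phi_le_rev_poly = disc_bound[THEN conjunct2]

definition bs_weight :: "nat \<Rightarrow> real \<Rightarrow> real" where
  "bs_weight n \<theta> = norm_sq n / (cmod (poly (\<Phi> n) (cis \<theta>)))\<^sup>2"

lemma Phi_nonzero_on_circle: "z \<in> sphere 0 1 \<Longrightarrow> poly (\<Phi> n) z \<noteq> 0"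
  using rev_poly_nonzero[of z n] cmod_poly_rev_poly[of z "\<Phi> n"] by (auto simp: mem_cball)

lemma bs_weight_pos: "0 < bs_weight n \<theta>"
  unfolding bs_weight_def using norm_sq_pos Phi_nonzero_on_circle[of "cis \<theta>" n] by simp

lemma integrable_bs_weight:
  fixes f :: "complex \<Rightarrow> 'a::{banach, second_countable_topology}"
  assumes "continuous_on (sphere 0 1) f"
  shows "integrable dtheta (\<lambda>\<theta>. bs_weight n \<theta> *\<^sub>R f (cis \<theta>))"
  unfolding bs_weight_def
  by (rule integrable_dtheta_cis[where f = "\<lambda>z. (norm_sq n / (cmod (poly (\<Phi> n) z))\<^sup>2) *\<^sub>R f z"])
    (use Phi_nonzero_on_circle in \<open>auto intro!: continuous_intros assms\<close>)

text \<open>The difference of consecutive weights is the real part of an analytic function with a zero of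
  order \<open>n + 1\<close> at \<open>0\<close>, so it does not affect the moments of order at most \<open>n\<close>.\<close>

lemma bs_weight_Suc:
  "bs_weight (Suc n) \<theta> = bs_weight n \<theta> + 2 * norm_sq n *
     Re (verblunsky \<Phi> n * cis \<theta> ^ Suc n / (poly (rev_poly (\<Phi> n)) (cis \<theta>) * poly (rev_poly (\<Phi> (Suc n))) (cis \<theta>)))"
proof -
  define z where "z = cis \<theta>"
  have z: "z \<in> sphere 0 1" by (simp add: z_def)
  define R S a where "R = poly (rev_poly (\<Phi> n)) z" and "S = poly (rev_poly (\<Phi> (Suc n))) z" and "a = verblunsky \<Phi> n"
  have nz: "R \<noteq> 0" "S \<noteq> 0" using z unfolding R_def S_def by (auto intro!: rev_poly_nonzero)
  have p: "z ^ n * cnj z ^ n = 1" using mult_cnj_on_circle[OF z] by (simp flip: power_mult_distrib)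
  then have P: "poly (\<Phi> n) z = z ^ n * cnj R"
    by (simp add: R_def poly_rev_poly[OF z] mult.assoc[symmetric])
  have S: "S = R - a * z ^ Suc n * cnj R"
    by (simp add: S_def rev_poly_recurrence R_def a_def P[unfolded R_def])
  define t where "t = a * z ^ Suc n"
  have ct: "cmod t = cmod a" using z by (simp add: t_def norm_mult norm_power)
  \<comment> \<open>Expanding |S|^2 for S = R - t cnj R gives this identity; divided by |R|^2 |S|^2
    it is the difference of the two weights.\<close>
  have K: "(1 - (cmod t)\<^sup>2) * (cmod R)\<^sup>2 = (cmod S)\<^sup>2 + 2 * Re (t * (cnj R * cnj S))"
    unfolding S t_def[symmetric]
    by (simp only: cmod_power2) (simp add: power2_eq_square algebra_simps)
  have fr: "e / y = 1 / x + 2 * (r / (x * y))" if "e * x = y + 2 * r" "x \<noteq> 0" "y \<noteq> 0" for e x y r :: real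
    using that by (simp add: field_simps)
  have "(1 - (cmod a)\<^sup>2) / (cmod S)\<^sup>2 = 1 / (cmod R)\<^sup>2 + 2 * (Re (t * (cnj R * cnj S)) / ((cmod R)\<^sup>2 * (cmod S)\<^sup>2))"
    by (rule fr[OF K[unfolded ct]]) (use nz in simp_all)
  moreover have "Re (t / (R * S)) = Re (t * (cnj R * cnj S)) / ((cmod R)\<^sup>2 * (cmod S)\<^sup>2)"
    by (subst complex_div_cnj) (simp add: norm_mult power_mult_distrib)
  ultimately have "(1 - (cmod a)\<^sup>2) / (cmod S)\<^sup>2 = 1 / (cmod R)\<^sup>2 + 2 * Re (t / (R * S))" by argo
  then have "norm_sq n * ((1 - (cmod a)\<^sup>2) / (cmod S)\<^sup>2) = norm_sq n * (1 / (cmod R)\<^sup>2 + 2 * Re (t / (R * S)))"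
    by (rule arg_cong)
  moreover have "bs_weight (Suc n) \<theta> = norm_sq n * ((1 - (cmod a)\<^sup>2) / (cmod S)\<^sup>2)"
    unfolding bs_weight_def norm_sq_Suc S_def a_def z_def[symmetric] cmod_poly_rev_poly[OF z] by simp
  moreover have "bs_weight n \<theta> = norm_sq n * (1 / (cmod R)\<^sup>2)"
    unfolding bs_weight_def R_def z_def[symmetric] cmod_poly_rev_poly[OF z] by simp
  ultimately show ?thesis
    unfolding z_def[symmetric] R_def[symmetric] S_def[symmetric] a_def[symmetric] t_def[symmetric]
    by (simp add: algebra_simps)
qed

end

section \<open>Bernstein--Szego approximation\<close>

context opuc
begin

text \<open>The correction is an analytic G plus its conjugate. Multiplication by z^k raises the
  order of vanishing of G and lowers that of the conjugate half to n + 1 - k, which is still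
  positive for k <= n; both halves integrate to 0.\<close>

lemma bs_moment_Suc:
  assumes "k \<le> n"
  shows "(LINT \<theta>|dtheta. bs_weight (Suc n) \<theta> *\<^sub>R cis \<theta> ^ k) = (LINT \<theta>|dtheta. bs_weight n \<theta> *\<^sub>R cis \<theta> ^ k)"
proof -
  define H where "H z = verblunsky \<Phi> n / (poly (rev_poly (\<Phi> n)) z * poly (rev_poly (\<Phi> (Suc n))) z)" for z
  have cH: "continuous_on (cball 0 1) H"
    unfolding H_def using rev_poly_nonzero by (auto intro!: continuous_intros)
  have hH: "H holomorphic_on ball 0 1"
    unfolding H_def using rev_poly_nonzero by (auto intro!: holomorphic_intros)
  have cHs: "continuous_on (sphere 0 1) H" by (rule continuous_on_subset[OF cH]) auto
  have zero: "(LINT \<theta>|dtheta. cis \<theta> ^ Suc m * H (cis \<theta>)) = 0" for m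
    by (subst mean_value_disc) (auto intro!: continuous_intros holomorphic_intros cH hH)
  define G where "G \<theta> = cis \<theta> ^ Suc n * H (cis \<theta>)" for \<theta>
  have iG: "integrable dtheta (\<lambda>\<theta>. cis \<theta> ^ k * G \<theta>)" "integrable dtheta (\<lambda>\<theta>. cis \<theta> ^ k * cnj (G \<theta>))"
    unfolding G_def
    by (rule integrable_dtheta_cis[where f = "\<lambda>z. z ^ k * (z ^ Suc n * H z)"]
          integrable_dtheta_cis[where f = "\<lambda>z. z ^ k * cnj (z ^ Suc n * H z)"];
        intro continuous_intros cHs)+
  have "(LINT \<theta>|dtheta. cis \<theta> ^ k * G \<theta>) = 0"
    using zero[of "k + n"] by (simp add: G_def power_add mult_ac)
  moreover have "(LINT \<theta>|dtheta. cis \<theta> ^ k * cnj (G \<theta>)) = 0"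
  proof -
    have "cis \<theta> ^ k * cnj (G \<theta>) = cnj (cis \<theta> ^ Suc (n - k) * H (cis \<theta>))" for \<theta>
    proof -
      have "cis \<theta> ^ Suc n = cis \<theta> ^ k * cis \<theta> ^ Suc (n - k)"
        using assms by (simp flip: power_add power_Suc)
      moreover have "cis \<theta> ^ k * cnj (cis \<theta>) ^ k = 1"
        using mult_cnj_on_circle[of "cis \<theta>"] by (simp flip: power_mult_distrib)
      ultimately show ?thesis unfolding G_def
        by (simp only: complex_cnj_mult complex_cnj_power mult.assoc[symmetric]) simp
    qed
    then show ?thesis using zero[of "n - k"] by (simp only: Bochner_Integration.integral_cnj) simp
  qed
  moreover have "bs_weight (Suc n) \<theta> *\<^sub>R cis \<theta> ^ k
      = bs_weight n \<theta> *\<^sub>R cis \<theta> ^ k + of_real (norm_sq n) * (cis \<theta> ^ k * G \<theta> + cis \<theta> ^ k * cnj (G \<theta>))" for \<theta>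
  proof -
    have G: "bs_weight (Suc n) \<theta> = bs_weight n \<theta> + 2 * norm_sq n * Re (G \<theta>)"
      unfolding bs_weight_Suc G_def H_def by (simp only: times_divide_eq_right mult.commute)
    have "cis \<theta> ^ k * G \<theta> + cis \<theta> ^ k * cnj (G \<theta>) = cis \<theta> ^ k * of_real (2 * Re (G \<theta>))"
      by (simp only: ring_distribs(1)[symmetric] complex_add_cnj)
    then show ?thesis unfolding G by (simp add: scaleR_conv_of_real algebra_simps)
  qed
  ultimately show ?thesis
    using iG integrable_bs_weight[where f = "\<lambda>z. z ^ k"] by (simp add: continuous_intros)
qed

lemma bs_moment_const:
  assumes "k \<le> m" "m \<le> n"
  shows "(LINT \<theta>|dtheta. bs_weight n \<theta> *\<^sub>R cis \<theta> ^ k) = (LINT \<theta>|dtheta. bs_weight m \<theta> *\<^sub>R cis \<theta> ^ k)"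
  using assms(2) by (induction rule: dec_induct) (use assms(1) bs_moment_Suc in auto)

text \<open>On the circle, weight times \<Phi>_n is \<open>norm_sq n\<close> times z^n divided by
  the dual of \<Phi>_n, which is analytic and vanishes at 0.\<close>

lemma bs_orthogonal_1:
  assumes "0 < n"
  shows "(LINT \<theta>|dtheta. bs_weight n \<theta> *\<^sub>R poly (\<Phi> n) (cis \<theta>)) = 0"
proof -
  have "bs_weight n \<theta> *\<^sub>R poly (\<Phi> n) (cis \<theta>)
      = (\<lambda>z. of_real (norm_sq n) * (z ^ n / poly (rev_poly (\<Phi> n)) z)) (cis \<theta>)" for \<theta>
  proof -
    have z: "cis \<theta> \<in> sphere 0 1" by simp
    have nz: "poly (\<Phi> n) (cis \<theta>) \<noteq> 0" by (rule Phi_nonzero_on_circle[OF z])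
    show ?thesis using nz unfolding bs_weight_def poly_rev_poly[OF z] degree_Phi scaleR_conv_of_real
      by (simp add: field_simps) (metis complex_norm_square of_real_power)
  qed
  then have "(LINT \<theta>|dtheta. bs_weight n \<theta> *\<^sub>R poly (\<Phi> n) (cis \<theta>))
     = (LINT \<theta>|dtheta. (\<lambda>z. of_real (norm_sq n) * (z ^ n / poly (rev_poly (\<Phi> n)) z)) (cis \<theta>))"
    by simp
  also have "\<dots> = of_real (norm_sq n) * (0 ^ n / poly (rev_poly (\<Phi> n)) 0)"
    by (rule mean_value_disc)
      (use rev_poly_nonzero in \<open>auto intro!: continuous_intros holomorphic_intros\<close>)
  finally show ?thesis using assms by simp
qed

lemma bs_integral_poly:
  "(LINT \<theta>|dtheta. bs_weight n \<theta> *\<^sub>R poly p (cis \<theta>))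
     = (\<Sum>i\<le>degree p. coeff p i * (LINT \<theta>|dtheta. bs_weight n \<theta> *\<^sub>R cis \<theta> ^ i))"
proof -
  have "integrable dtheta (\<lambda>\<theta>. coeff p i * (bs_weight n \<theta> *\<^sub>R cis \<theta> ^ i))" for i
    by (intro integrable_mult_right integrable_bs_weight[where f = "\<lambda>z. z ^ i"] continuous_intros)
  moreover have "bs_weight n \<theta> *\<^sub>R poly p (cis \<theta>) = (\<Sum>i\<le>degree p. coeff p i * (bs_weight n \<theta> *\<^sub>R cis \<theta> ^ i))" for \<theta>
    unfolding poly_altdef scaleR_right.sum by (simp add: scaleR_conv_of_real mult_ac)
  ultimately show ?thesis by (simp only: Bochner_Integration.integral_sum integral_mult_right_zero)
qed

lemma integral_poly:
  "(LINT z|\<mu>. poly p z) = (\<Sum>i\<le>degree p. coeff p i * (LINT z|\<mu>. z ^ i))"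
proof -
  have "integrable \<mu> (\<lambda>z. coeff p i * z ^ i)" for i
    by (intro integrable_mu continuous_intros)
  then show ?thesis
    unfolding poly_altdef by (simp only: Bochner_Integration.integral_sum integral_mult_right_zero)
qed

text \<open>A monic polynomial of degree k with integral 0 expresses the moment k through lower
  ones. \<Phi>_k has integral 0 both for \<mu> and for the k-th weight, and the n-th weight has the
  same moments up to k as the k-th.\<close>

lemma bs_moment:
  assumes "k \<le> n"
  shows "(LINT \<theta>|dtheta. bs_weight n \<theta> *\<^sub>R cis \<theta> ^ k) = (LINT z|\<mu>. z ^ k)"
  using assms
proof (induction k rule: less_induct)
  case (less k)
  show ?case
  proof (cases "k = 0")
    case True
    have "bs_weight 0 \<theta> = 1" for \<theta> by (simp add: bs_weight_def)
    then have "(LINT \<theta>|dtheta. bs_weight 0 \<theta> *\<^sub>R cis \<theta> ^ 0) = 1"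
      using dtheta.prob_space by simp
    moreover have "(LINT z|\<mu>. z ^ 0) = (1::complex)" using prob_space by simp
    ultimately show ?thesis using bs_moment_const[of 0 0 n] True by simp
  next
    case False
    have split: "(\<Sum>i\<le>degree (\<Phi> k). coeff (\<Phi> k) i * f i) = (\<Sum>i<k. coeff (\<Phi> k) i * f i) + f k" for f
      by (simp add: lead_coeff_Phi lessThan_Suc_atMost[symmetric])
    have "(LINT \<theta>|dtheta. bs_weight n \<theta> *\<^sub>R poly (\<Phi> k) (cis \<theta>))
        = (LINT \<theta>|dtheta. bs_weight k \<theta> *\<^sub>R poly (\<Phi> k) (cis \<theta>))"
      unfolding bs_integral_poly using less.prems by (intro sum.cong refl) (simp add: bs_moment_const[of _ k n])
    then have "(LINT \<theta>|dtheta. bs_weight n \<theta> *\<^sub>R poly (\<Phi> k) (cis \<theta>)) = 0"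
      using bs_orthogonal_1 False by simp
    moreover have "(LINT z|\<mu>. poly (\<Phi> k) z) = 0"
      using orthogonal_lower[of 1 k] False by simp
    moreover have "(\<Sum>i<k. coeff (\<Phi> k) i * (LINT \<theta>|dtheta. bs_weight n \<theta> *\<^sub>R cis \<theta> ^ i))
        = (\<Sum>i<k. coeff (\<Phi> k) i * (LINT z|\<mu>. z ^ i))"
      using less by (intro sum.cong refl) simp
    ultimately show ?thesis
      unfolding bs_integral_poly integral_poly split by (metis add_left_cancel)
  qed
qed

lemma bs_moment_cnj:
  assumes "i \<le> n" "N \<le> n"
  shows "(LINT \<theta>|dtheta. bs_weight n \<theta> *\<^sub>R (cnj (cis \<theta>) ^ N * cis \<theta> ^ i)) = (LINT z|\<mu>. cnj z ^ N * z ^ i)"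
proof (cases "N \<le> i")
  case True
  have "cnj z ^ N * z ^ i = z ^ (i - N)" if "z \<in> sphere 0 1" for z
  proof -
    have "z ^ i = z ^ N * z ^ (i - N)" using True by (simp flip: power_add)
    moreover have "cnj z ^ N * z ^ N = 1"
      using mult_cnj_on_circle[OF that] by (simp add: mult.commute flip: power_mult_distrib)
    ultimately show ?thesis by (simp add: mult.assoc[symmetric])
  qed
  note eq = this
  have "(LINT \<theta>|dtheta. bs_weight n \<theta> *\<^sub>R (cnj (cis \<theta>) ^ N * cis \<theta> ^ i))
      = (LINT \<theta>|dtheta. bs_weight n \<theta> *\<^sub>R cis \<theta> ^ (i - N))"
    by (intro Bochner_Integration.integral_cong refl arg_cong2[where f = scaleR] eq) simp
  also have "\<dots> = (LINT z|\<mu>. z ^ (i - N))" using assms by (intro bs_moment) simp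
  also have "\<dots> = (LINT z|\<mu>. cnj z ^ N * z ^ i)"
    by (intro Bochner_Integration.integral_cong refl eq[symmetric]) simp
  finally show ?thesis .
next
  case False
  have eq: "cnj z ^ N * z ^ i = cnj (z ^ (N - i))" if "z \<in> sphere 0 1" for z
  proof -
    have "cnj z ^ N = cnj z ^ (N - i) * cnj z ^ i" using False by (simp flip: power_add)
    moreover have "cnj z ^ i * z ^ i = 1"
      using mult_cnj_on_circle[OF that] by (simp add: mult.commute flip: power_mult_distrib)
    ultimately show ?thesis by (simp add: mult.assoc)
  qed
  have "(LINT \<theta>|dtheta. bs_weight n \<theta> *\<^sub>R (cnj (cis \<theta>) ^ N * cis \<theta> ^ i))
      = (LINT \<theta>|dtheta. cnj (bs_weight n \<theta> *\<^sub>R cis \<theta> ^ (N - i)))"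
    unfolding complex_cnj_scaleR
    by (intro Bochner_Integration.integral_cong refl arg_cong2[where f = scaleR] eq) simp
  also have "\<dots> = cnj (LINT z|\<mu>. z ^ (N - i))"
    unfolding Bochner_Integration.integral_cnj using assms by (intro arg_cong[where f = cnj] bs_moment) simp
  also have "\<dots> = (LINT z|\<mu>. cnj z ^ N * z ^ i)"
    unfolding Bochner_Integration.integral_cnj[symmetric]
    by (intro Bochner_Integration.integral_cong refl eq[symmetric]) simp
  finally show ?thesis .
qed

lemma bs_laurent:
  assumes "degree p \<le> n" "N \<le> n"
  shows "(LINT \<theta>|dtheta. bs_weight n \<theta> *\<^sub>R (cnj (cis \<theta>) ^ N * poly p (cis \<theta>))) = (LINT z|\<mu>. cnj z ^ N * poly p z)"
proof -
  have i1: "integrable dtheta (\<lambda>\<theta>. coeff p i * (bs_weight n \<theta> *\<^sub>R (cnj (cis \<theta>) ^ N * cis \<theta> ^ i)))" for i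
    by (intro integrable_mult_right integrable_bs_weight[where f = "\<lambda>z. cnj z ^ N * z ^ i"] continuous_intros)
  have i2: "integrable \<mu> (\<lambda>z. coeff p i * (cnj z ^ N * z ^ i))" for i
    by (intro integrable_mu continuous_intros)
  have "(LINT \<theta>|dtheta. bs_weight n \<theta> *\<^sub>R (cnj (cis \<theta>) ^ N * poly p (cis \<theta>)))
      = (LINT \<theta>|dtheta. (\<Sum>i\<le>degree p. coeff p i * (bs_weight n \<theta> *\<^sub>R (cnj (cis \<theta>) ^ N * cis \<theta> ^ i))))"
    unfolding poly_altdef sum_distrib_left scaleR_right.sum by (simp add: scaleR_conv_of_real mult_ac)
  also have "\<dots> = (\<Sum>i\<le>degree p. coeff p i * (LINT z|\<mu>. cnj z ^ N * z ^ i))"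
    using assms by (simp only: Bochner_Integration.integral_sum[OF i1] integral_mult_right_zero)
      (intro sum.cong refl arg_cong2[where f = times] bs_moment_cnj, auto)
  also have "\<dots> = (LINT z|\<mu>. (\<Sum>i\<le>degree p. coeff p i * (cnj z ^ N * z ^ i)))"
    by (simp only: Bochner_Integration.integral_sum[OF i2] integral_mult_right_zero)
  also have "\<dots> = (LINT z|\<mu>. cnj z ^ N * poly p z)"
    unfolding poly_altdef sum_distrib_left by (simp add: mult_ac)
  finally show ?thesis .
qed

end

text \<open>Stone-Weierstrass supplies real polynomials in Re z and Im z. On the circle they are
  Laurent polynomials, and writing the negative powers as one factor \<open>cnj z ^ N\<close> fits
  the exact moment identity \<open>bs_laurent\<close>.\<close>

lemma real_polynomial_laurent:
  fixes f :: "complex \<Rightarrow> real"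
  assumes "real_polynomial_function f"
  shows "\<exists>N p. \<forall>z\<in>sphere 0 1. complex_of_real (f z) = cnj z ^ N * poly p z"
  using assms
proof induction
  case (linear f)
  then interpret bounded_linear f .
  define c where "c = Complex (f 1) (- f \<i>)"
  have fz: "f z = Re (c * z)" for z
  proof -
    have "f z = f (Re z *\<^sub>R 1 + Im z *\<^sub>R \<i>)"
      by (rule arg_cong[where f = f]) (simp add: complex_eq_iff)
    also have "\<dots> = Re z * f 1 + Im z * f \<i>" by (simp only: add scaleR real_scaleR_def)
    finally show ?thesis by (simp add: c_def)
  qed
  have "complex_of_real (f z) = cnj z ^ 1 * poly [:cnj c / 2, 0, c / 2:] z" if "z \<in> sphere 0 1" for z
  proof -
    have "complex_of_real (f z) = (c * z + cnj (c * z)) / 2"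
      unfolding fz complex_add_cnj by (simp del: times_complex.simps)
    moreover have "cnj z ^ 1 * poly [:cnj c / 2, 0, c / 2:] z = (cnj (c * z) + (z * cnj z) * (c * z)) / 2"
      by (simp add: field_simps)
    ultimately show ?thesis by (simp only: mult_cnj_on_circle[OF that] mult_1_left add.commute)
  qed
  then show ?case by blast
next
  case (const c)
  show ?case by (intro exI[of _ 0] exI[of _ "[:of_real c:]"]) simp
next
  case (add f g)
  then obtain N p M q where p: "\<And>z. z \<in> sphere 0 1 \<Longrightarrow> complex_of_real (f z) = cnj z ^ N * poly p z"
    and q: "\<And>z. z \<in> sphere 0 1 \<Longrightarrow> complex_of_real (g z) = cnj z ^ M * poly q z" by blast
  have "complex_of_real (f z + g z) = cnj z ^ (N + M) * poly (monom 1 M * p + monom 1 N * q) z"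
    if "z \<in> sphere 0 1" for z
  proof -
    have "cnj z ^ k * z ^ k = 1" for k
      using mult_cnj_on_circle[OF that] by (simp add: mult.commute flip: power_mult_distrib)
    then have "cnj z ^ (N + M) * poly (monom 1 M * p + monom 1 N * q) z = cnj z ^ N * poly p z + cnj z ^ M * poly q z"
      by (simp add: poly_monom power_add ring_distribs)
        (metis (no_types, lifting) mult.assoc mult.left_commute mult.right_neutral)
    then show ?thesis by (simp add: p[OF that] q[OF that])
  qed
  then show ?case by blast
next
  case (mult f g)
  then obtain N p M q where p: "\<And>z. z \<in> sphere 0 1 \<Longrightarrow> complex_of_real (f z) = cnj z ^ N * poly p z"
    and q: "\<And>z. z \<in> sphere 0 1 \<Longrightarrow> complex_of_real (g z) = cnj z ^ M * poly q z" by blast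
  have "complex_of_real (f z * g z) = cnj z ^ (N + M) * poly (p * q) z" if "z \<in> sphere 0 1" for z
    by (simp add: p[OF that] q[OF that] power_add mult_ac)
  then show ?case by blast
qed

context opuc
begin

lemma bs_integral_1: "(LINT \<theta>|dtheta. bs_weight n \<theta>) = 1"
proof -
  have "complex_of_real (LINT \<theta>|dtheta. bs_weight n \<theta>) = (LINT \<theta>|dtheta. bs_weight n \<theta> *\<^sub>R cis \<theta> ^ 0)"
    by (simp add: scaleR_conv_of_real flip: integral_complex_of_real)
  also have "\<dots> = (LINT z|\<mu>. z ^ 0)" by (rule bs_moment) simp
  also have "\<dots> = 1" using prob_space by simp
  finally show ?thesis by simp
qed

text \<open>For a Laurent polynomial the two integrals agree exactly once n exceeds its degrees.
  Both measures have total mass 1, so uniform approximation within e / 3 carries this over to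
  continuous g.\<close>

lemma bs_weak_convergence:
  fixes g :: "complex \<Rightarrow> real"
  assumes g: "continuous_on (sphere 0 1) g"
  shows "(\<lambda>n. LINT \<theta>|dtheta. bs_weight n \<theta> * g (cis \<theta>)) \<longlonglongrightarrow> (LINT z|\<mu>. g z)"
proof (rule metric_LIMSEQ_I)
  fix e :: real assume e: "0 < e"
  have "compact (sphere 0 1 :: complex set)" by simp
  from Stone_Weierstrass_real_polynomial_function[OF this g, of "e / 3"] e
  obtain f where f: "real_polynomial_function f" "\<And>z. z \<in> sphere 0 1 \<Longrightarrow> \<bar>g z - f z\<bar> < e / 3"
    by auto
  have cf: "continuous_on (sphere 0 1) f"
    using f(1) real_polynomial_function_eq continuous_on_polymonial_function by blast
  obtain N p where p: "\<And>z. z \<in> sphere 0 1 \<Longrightarrow> complex_of_real (f z) = cnj z ^ N * poly p z"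
    using real_polynomial_laurent[OF f(1)] by blast
  show "\<exists>no. \<forall>n\<ge>no. dist (LINT \<theta>|dtheta. bs_weight n \<theta> * g (cis \<theta>)) (LINT z|\<mu>. g z) < e"
  proof (intro exI allI impI)
    fix n assume n: "max N (degree p) \<le> n"
    have "complex_of_real (LINT \<theta>|dtheta. bs_weight n \<theta> * f (cis \<theta>))
        = (LINT \<theta>|dtheta. bs_weight n \<theta> *\<^sub>R (cnj (cis \<theta>) ^ N * poly p (cis \<theta>)))"
      using p[of "cis \<theta>" for \<theta>] by (simp add: scaleR_conv_of_real flip: integral_complex_of_real)
    also have "\<dots> = (LINT z|\<mu>. cnj z ^ N * poly p z)" using n by (intro bs_laurent) auto
    also have "\<dots> = (LINT z|\<mu>. complex_of_real (f z))"
      by (intro Bochner_Integration.integral_cong refl) (simp add: p)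
    finally have eq: "(LINT \<theta>|dtheta. bs_weight n \<theta> * f (cis \<theta>)) = (LINT z|\<mu>. f z)"
      by (simp only: integral_complex_of_real of_real_eq_iff)
    have ig: "integrable dtheta (\<lambda>\<theta>. bs_weight n \<theta> * g (cis \<theta>))"
      and if': "integrable dtheta (\<lambda>\<theta>. bs_weight n \<theta> * f (cis \<theta>))"
      and ib: "integrable dtheta (\<lambda>\<theta>. bs_weight n \<theta>)"
      using integrable_bs_weight[OF g] integrable_bs_weight[OF cf] integrable_bs_weight[of "\<lambda>_. 1::real"] by auto
    have "\<bar>(LINT \<theta>|dtheta. bs_weight n \<theta> * g (cis \<theta>)) - (LINT \<theta>|dtheta. bs_weight n \<theta> * f (cis \<theta>))\<bar>
        = \<bar>LINT \<theta>|dtheta. bs_weight n \<theta> * g (cis \<theta>) - bs_weight n \<theta> * f (cis \<theta>)\<bar>"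
      by (simp only: Bochner_Integration.integral_diff[OF ig if'])
    also have "\<dots> \<le> (LINT \<theta>|dtheta. bs_weight n \<theta> * (e / 3))"
    proof (rule integral_abs_bound_integral)
      fix \<theta>
      have "\<bar>bs_weight n \<theta> * g (cis \<theta>) - bs_weight n \<theta> * f (cis \<theta>)\<bar> = bs_weight n \<theta> * \<bar>g (cis \<theta>) - f (cis \<theta>)\<bar>"
        using bs_weight_pos[of n \<theta>] by (simp add: abs_mult flip: right_diff_distrib)
      also have "\<dots> \<le> bs_weight n \<theta> * (e / 3)"
        using bs_weight_pos[of n \<theta>] f(2)[of "cis \<theta>"] by (intro mult_left_mono) auto
      finally show "\<bar>bs_weight n \<theta> * g (cis \<theta>) - bs_weight n \<theta> * f (cis \<theta>)\<bar> \<le> bs_weight n \<theta> * (e / 3)" .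
    qed (intro Bochner_Integration.integrable_diff ig if' integrable_mult_left ib)+
    also have "\<dots> = e / 3" by (simp only: integral_mult_left_zero bs_integral_1)
    finally have b1: "\<bar>(LINT \<theta>|dtheta. bs_weight n \<theta> * g (cis \<theta>)) - (LINT z|\<mu>. f z)\<bar> \<le> e / 3"
      unfolding eq .
    have jg: "integrable \<mu> g" and jf: "integrable \<mu> f" using g cf by (auto intro: integrable_mu)
    have "\<bar>(LINT z|\<mu>. g z) - (LINT z|\<mu>. f z)\<bar> = \<bar>LINT z|\<mu>. g z - f z\<bar>"
      by (simp only: Bochner_Integration.integral_diff[OF jg jf])
    also have "\<dots> \<le> (LINT z|\<mu>. e / 3)"
      by (rule integral_abs_bound_integral)
        (use f(2) in \<open>auto intro!: Bochner_Integration.integrable_diff jg jf less_imp_le\<close>)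
    also have "\<dots> = e / 3" using prob_space by simp
    finally show "dist (LINT \<theta>|dtheta. bs_weight n \<theta> * g (cis \<theta>)) (LINT z|\<mu>. g z) < e"
      using b1 e unfolding dist_real_def by argo
  qed
qed

end

section \<open>The sum rule\<close>

text \<open>The remainder is z^4 h with h continuous on the closed disc, because the expansions are
  integrated over the circle. V has degree 3, so the remainder contributes nothing there.\<close>

definition taylor_disc :: "(complex \<Rightarrow> complex) \<Rightarrow> complex \<Rightarrow> complex \<Rightarrow> complex \<Rightarrow> complex \<Rightarrow> bool" where
  "taylor_disc f c0 c1 c2 c3 \<longleftrightarrow> (\<exists>h. continuous_on (cball 0 1) h \<and> h holomorphic_on ball 0 1 \<and>
     (\<forall>z\<in>cball 0 1. f z = c0 + c1 * z + c2 * z\<^sup>2 + c3 * z ^ 3 + z ^ 4 * h z))"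

lemma taylor_discI:
  assumes "continuous_on (cball 0 1) h" "h holomorphic_on ball 0 1"
    "\<And>z. z \<in> cball 0 1 \<Longrightarrow> f z = c0 + c1 * z + c2 * z\<^sup>2 + c3 * z ^ 3 + z ^ 4 * h z"
  shows "taylor_disc f c0 c1 c2 c3"
  using assms unfolding taylor_disc_def by blast

lemma taylor_disc_cong:
  assumes "taylor_disc f c0 c1 c2 c3" "\<And>z. z \<in> cball 0 1 \<Longrightarrow> f z = g z"
    "c0 = d0" "c1 = d1" "c2 = d2" "c3 = d3"
  shows "taylor_disc g d0 d1 d2 d3"
  using assms unfolding taylor_disc_def by auto

lemma taylor_disc_add:
  assumes "taylor_disc f a0 a1 a2 a3" "taylor_disc g b0 b1 b2 b3"
  shows "taylor_disc (\<lambda>z. f z + g z) (a0 + b0) (a1 + b1) (a2 + b2) (a3 + b3)"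
proof -
  obtain h k where h: "continuous_on (cball 0 1) h" "h holomorphic_on ball 0 1"
      "\<And>z. z \<in> cball 0 1 \<Longrightarrow> f z = a0 + a1 * z + a2 * z\<^sup>2 + a3 * z ^ 3 + z ^ 4 * h z"
    and k: "continuous_on (cball 0 1) k" "k holomorphic_on ball 0 1"
      "\<And>z. z \<in> cball 0 1 \<Longrightarrow> g z = b0 + b1 * z + b2 * z\<^sup>2 + b3 * z ^ 3 + z ^ 4 * k z"
    using assms unfolding taylor_disc_def by blast
  show ?thesis
    by (rule taylor_discI[where h = "\<lambda>z. h z + k z"])
      (auto intro!: continuous_intros holomorphic_intros h k simp: h(3) k(3) algebra_simps)
qed

lemma taylor_disc_cmult:
  assumes "taylor_disc f a0 a1 a2 a3"
  shows "taylor_disc (\<lambda>z. c * f z) (c * a0) (c * a1) (c * a2) (c * a3)"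
proof -
  obtain h where h: "continuous_on (cball 0 1) h" "h holomorphic_on ball 0 1"
      "\<And>z. z \<in> cball 0 1 \<Longrightarrow> f z = a0 + a1 * z + a2 * z\<^sup>2 + a3 * z ^ 3 + z ^ 4 * h z"
    using assms unfolding taylor_disc_def by blast
  show ?thesis
    by (rule taylor_discI[where h = "\<lambda>z. c * h z"])
      (auto intro!: continuous_intros holomorphic_intros h simp: h(3) algebra_simps)
qed

lemma taylor_disc_mult:
  assumes "taylor_disc f a0 a1 a2 a3" "taylor_disc g b0 b1 b2 b3"
  shows "taylor_disc (\<lambda>z. f z * g z) (a0 * b0) (a0 * b1 + a1 * b0) (a0 * b2 + a1 * b1 + a2 * b0)
    (a0 * b3 + a1 * b2 + a2 * b1 + a3 * b0)"
proof -
  obtain h k where h: "continuous_on (cball 0 1) h" "h holomorphic_on ball 0 1"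
      "\<And>z. z \<in> cball 0 1 \<Longrightarrow> f z = a0 + a1 * z + a2 * z\<^sup>2 + a3 * z ^ 3 + z ^ 4 * h z"
    and k: "continuous_on (cball 0 1) k" "k holomorphic_on ball 0 1"
      "\<And>z. z \<in> cball 0 1 \<Longrightarrow> g z = b0 + b1 * z + b2 * z\<^sup>2 + b3 * z ^ 3 + z ^ 4 * k z"
    using assms unfolding taylor_disc_def by blast
  define r where "r z = a1 * b3 + a2 * b2 + a3 * b1 + (a2 * b3 + a3 * b2) * z + a3 * b3 * z\<^sup>2
      + h z * (b0 + b1 * z + b2 * z\<^sup>2 + b3 * z ^ 3 + z ^ 4 * k z) + k z * (a0 + a1 * z + a2 * z\<^sup>2 + a3 * z ^ 3)" for z
  show ?thesis
  proof (rule taylor_discI)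
    show "continuous_on (cball 0 1) r" unfolding r_def by (intro continuous_intros h k)
    show "r holomorphic_on ball 0 1" unfolding r_def by (intro holomorphic_intros h k)
    fix z :: complex assume z: "z \<in> cball 0 1"
    show "f z * g z = a0 * b0 + (a0 * b1 + a1 * b0) * z + (a0 * b2 + a1 * b1 + a2 * b0) * z\<^sup>2
      + (a0 * b3 + a1 * b2 + a2 * b1 + a3 * b0) * z ^ 3 + z ^ 4 * r z"
      unfolding h(3)[OF z] k(3)[OF z] r_def by algebra
  qed
qed

lemma taylor_disc_const: "taylor_disc (\<lambda>z. c) c 0 0 0"
  by (rule taylor_discI[where h = "\<lambda>_. 0"]) auto

lemma taylor_disc_shift:
  assumes "taylor_disc f a0 a1 a2 a3"
  shows "taylor_disc (\<lambda>z. z * f z) 0 a0 a1 a2"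
proof -
  obtain h where h: "continuous_on (cball 0 1) h" "h holomorphic_on ball 0 1"
      "\<And>z. z \<in> cball 0 1 \<Longrightarrow> f z = a0 + a1 * z + a2 * z\<^sup>2 + a3 * z ^ 3 + z ^ 4 * h z"
    using assms unfolding taylor_disc_def by blast
  show ?thesis
    by (rule taylor_discI[where h = "\<lambda>z. a3 + z * h z"])
      (auto intro!: continuous_intros holomorphic_intros h simp: h(3) algebra_simps power2_eq_square
        power3_eq_cube power4_eq_xxxx)
qed

text \<open>With w = u z, the exact form 1 + w + w^2 + w^3 + w^4 / (1 - w) of the geometric series
  is used. Since u = z v, the last term is z^4 times an admissible remainder.\<close>

lemma taylor_disc_inverse:
  assumes u: "taylor_disc u 0 u1 u2 u3"
    and lt: "\<And>z. z \<in> cball 0 1 \<Longrightarrow> cmod (u z) < 1"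
  shows "taylor_disc (\<lambda>z. 1 / (1 - u z)) 1 u1 (u2 + u1\<^sup>2) (u3 + 2 * u1 * u2 + u1 ^ 3)"
proof -
  obtain h where h: "continuous_on (cball 0 1) h" "h holomorphic_on ball 0 1"
      "\<And>z. z \<in> cball 0 1 \<Longrightarrow> u z = 0 + u1 * z + u2 * z\<^sup>2 + u3 * z ^ 3 + z ^ 4 * h z"
    using u unfolding taylor_disc_def by blast
  define v where "v z = u1 + u2 * z + u3 * z\<^sup>2 + z ^ 3 * h z" for z
  have uv: "u z = z * v z" if "z \<in> cball 0 1" for z
    unfolding h(3)[OF that] v_def by algebra
  have cv: "continuous_on (cball 0 1) v" and hv: "v holomorphic_on ball 0 1"
    unfolding v_def by (intro continuous_intros holomorphic_intros h)+
  have ne: "1 - z * v z \<noteq> 0" if "z \<in> cball 0 1" for z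
    using lt[OF that] uv[OF that] by force
  have t4: "taylor_disc (\<lambda>z. z ^ 4 * (v z ^ 4 / (1 - z * v z))) 0 0 0 0"
    by (rule taylor_discI[where h = "\<lambda>z. v z ^ 4 / (1 - z * v z)"])
      (use ne in \<open>auto intro!: continuous_intros holomorphic_intros cv hv\<close>)
  have "taylor_disc (\<lambda>z. 1 + u z + u z * u z + u z * (u z * u z) + z ^ 4 * (v z ^ 4 / (1 - z * v z)))
     (1 + 0 + 0 * 0 + 0 * (0 * 0) + 0) (0 + u1 + (0 * u1 + u1 * 0) + (0 * (0 * u1 + u1 * 0) + u1 * (0 * 0)) + 0)
     (0 + u2 + (0 * u2 + u1 * u1 + u2 * 0) + (0 * (0 * u2 + u1 * u1 + u2 * 0) + u1 * (0 * u1 + u1 * 0) + u2 * (0 * 0)) + 0)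
     (0 + u3 + (0 * u3 + u1 * u2 + u2 * u1 + u3 * 0) + (0 * (0 * u3 + u1 * u2 + u2 * u1 + u3 * 0)
        + u1 * (0 * u2 + u1 * u1 + u2 * 0) + u2 * (0 * u1 + u1 * 0) + u3 * (0 * 0)) + 0)"
    by (intro taylor_disc_add taylor_disc_mult taylor_disc_const u t4)
  then show ?thesis
  proof (rule taylor_disc_cong)
    fix z :: complex assume z: "z \<in> cball 0 1"
    have "1 + w + w * w + w * (w * w) + w ^ 4 / (1 - w) = 1 / (1 - w)" if "1 - w \<noteq> 0" for w :: complex
      using that by (simp add: divide_simps) algebra
    from this[OF ne[OF z]] show "1 + u z + u z * u z + u z * (u z * u z) + z ^ 4 * (v z ^ 4 / (1 - z * v z)) = 1 / (1 - u z)"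
      unfolding uv[OF z] by (simp add: power_mult_distrib)
  qed (simp_all add: power2_eq_square power3_eq_cube)
qed

lemma Ln_one_minus_remainder:
  obtains k where "k holomorphic_on ball 0 1"
    "\<And>w. w \<in> ball 0 1 \<Longrightarrow> Ln (1 - w) = - w - w\<^sup>2 / 2 - w ^ 3 / 3 + w ^ 4 * k w"
proof -
  define a :: "nat \<Rightarrow> complex" where "a n = - 1 / of_nat n" for n
  have S: "(\<lambda>n. a n * w ^ n) sums Ln (1 - w)" if "w \<in> ball 0 1" for w
  proof -
    have "(\<lambda>n. (- 1) ^ Suc n / of_nat n * (- w) ^ n) sums Ln (1 + (- w))"
      using that by (intro Ln_series) (simp add: dist_norm)
    moreover have "(- 1) ^ Suc n / of_nat n * (- w) ^ n = a n * w ^ n" for n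
      unfolding a_def power_minus[of w] by (simp flip: power_mult_distrib)
    ultimately show ?thesis by simp
  qed
  \<comment> \<open>The tail of the series divided by w^4 is again a power series, so filling in its
    value at 0 gives a holomorphic function.\<close>
  define k where "k w = (if w = 0 then a 4 else (Ln (1 - w) - (\<Sum>n<4. a n * w ^ n)) / w ^ 4)" for w
  have "(\<lambda>n. a (n + 4) * (w - 0) ^ n) sums k w" if "w \<in> ball 0 1" for w
  proof (cases "w = 0")
    case True
    then show ?thesis using powser_sums_zero[of "\<lambda>n. a (n + 4)"] by (simp add: k_def)
  next
    case False
    have "(\<lambda>n. a (n + 4) * w ^ (n + 4) / w ^ 4) sums k w"
      unfolding k_def using False sums_divide[OF sums_split_initial_segment[OF S[OF that], of 4], of "w ^ 4"]
      by simp
    then show ?thesis using False by (simp add: power_add)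
  qed
  then have "k holomorphic_on ball 0 1" by (rule power_series_holomorphic)
  moreover have "Ln (1 - w) = - w - w\<^sup>2 / 2 - w ^ 3 / 3 + w ^ 4 * k w" for w
    by (simp add: k_def a_def eval_nat_numeral)
  ultimately show ?thesis using that by blast
qed

text \<open>The strict bound on the closed disc keeps z v z inside the open disc where the remainder
  k of the logarithm lives, so the composed remainder is continuous up to the circle.\<close>

lemma taylor_disc_Ln:
  assumes u: "taylor_disc u 0 u1 u2 u3"
    and lt: "\<And>z. z \<in> cball 0 1 \<Longrightarrow> cmod (u z) < 1"
  shows "taylor_disc (\<lambda>z. Ln (1 - u z)) 0 (- u1) (- u2 - u1\<^sup>2 / 2) (- u3 - u1 * u2 - u1 ^ 3 / 3)"
proof -
  obtain h where h: "continuous_on (cball 0 1) h" "h holomorphic_on ball 0 1"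
      "\<And>z. z \<in> cball 0 1 \<Longrightarrow> u z = 0 + u1 * z + u2 * z\<^sup>2 + u3 * z ^ 3 + z ^ 4 * h z"
    using u unfolding taylor_disc_def by blast
  define v where "v z = u1 + u2 * z + u3 * z\<^sup>2 + z ^ 3 * h z" for z
  have uv: "u z = z * v z" if "z \<in> cball 0 1" for z
    unfolding h(3)[OF that] v_def by algebra
  have cv: "continuous_on (cball 0 1) v" and hv: "v holomorphic_on ball 0 1"
    unfolding v_def by (intro continuous_intros holomorphic_intros h)+
  have im: "z * v z \<in> ball 0 1" if "z \<in> cball 0 1" for z
    using lt[OF that] uv[OF that] by simp
  obtain k where k: "k holomorphic_on ball 0 1"
    "\<And>w. w \<in> ball 0 1 \<Longrightarrow> Ln (1 - w) = - w - w\<^sup>2 / 2 - w ^ 3 / 3 + w ^ 4 * k w"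
    using Ln_one_minus_remainder by blast
  have ck: "continuous_on (cball 0 1) (\<lambda>z. k (z * v z))"
    by (rule continuous_on_compose2[OF holomorphic_on_imp_continuous_on[OF k(1)]])
      (use im in \<open>auto intro!: continuous_intros cv\<close>)
  have hk: "(\<lambda>z. k (z * v z)) holomorphic_on ball 0 1"
    by (rule holomorphic_on_compose_gen[OF _ k(1), unfolded o_def])
      (use im in \<open>auto intro!: holomorphic_intros hv\<close>)
  have t4: "taylor_disc (\<lambda>z. z ^ 4 * (v z ^ 4 * k (z * v z))) 0 0 0 0"
    by (rule taylor_discI[where h = "\<lambda>z. v z ^ 4 * k (z * v z)"])
      (auto intro!: continuous_intros holomorphic_intros cv hv ck hk)
  have "taylor_disc (\<lambda>z. (- 1) * u z + ((- 1 / 2) * (u z * u z)) + ((- 1 / 3) * (u z * (u z * u z)))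
       + z ^ 4 * (v z ^ 4 * k (z * v z)))
     ((- 1) * 0 + ((- 1 / 2) * (0 * 0)) + ((- 1 / 3) * (0 * (0 * 0))) + 0)
     ((- 1) * u1 + ((- 1 / 2) * (0 * u1 + u1 * 0)) + ((- 1 / 3) * (0 * (0 * u1 + u1 * 0) + u1 * (0 * 0))) + 0)
     ((- 1) * u2 + ((- 1 / 2) * (0 * u2 + u1 * u1 + u2 * 0))
       + ((- 1 / 3) * (0 * (0 * u2 + u1 * u1 + u2 * 0) + u1 * (0 * u1 + u1 * 0) + u2 * (0 * 0))) + 0)
     ((- 1) * u3 + ((- 1 / 2) * (0 * u3 + u1 * u2 + u2 * u1 + u3 * 0))
       + ((- 1 / 3) * (0 * (0 * u3 + u1 * u2 + u2 * u1 + u3 * 0)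
        + u1 * (0 * u2 + u1 * u1 + u2 * 0) + u2 * (0 * u1 + u1 * 0) + u3 * (0 * 0))) + 0)"
    by (intro taylor_disc_add taylor_disc_mult taylor_disc_cmult u t4)
  then show ?thesis
  proof (rule taylor_disc_cong)
    fix z :: complex assume z: "z \<in> cball 0 1"
    show "(- 1) * u z + ((- 1 / 2) * (u z * u z)) + ((- 1 / 3) * (u z * (u z * u z)))
       + z ^ 4 * (v z ^ 4 * k (z * v z)) = Ln (1 - u z)"
      unfolding uv[OF z] k(2)[OF im[OF z]] by (simp add: power_mult_distrib power2_eq_square power3_eq_cube)
  qed (simp_all add: power2_eq_square power3_eq_cube)
qed

section \<open>The weight V in the variable on the circle\<close>

definition szego_weight :: "complex \<Rightarrow> real" where
  "szego_weight z = (1 - Re z)\<^sup>2 * (1 + Re z)"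

lemma szego_weight_laurent:
  assumes "z \<in> sphere 0 1"
  shows "complex_of_real (szego_weight z) =
    1 / 2 - (z + cnj z) / 8 - (z\<^sup>2 + cnj z ^ 2) / 4 + (z ^ 3 + cnj z ^ 3) / 8"
proof -
  have "complex_of_real (Re z) = (z + cnj z) / 2" unfolding complex_add_cnj by simp
  then have "complex_of_real (szego_weight z) = (1 - (z + cnj z) / 2)\<^sup>2 * (1 + (z + cnj z) / 2)"
    unfolding szego_weight_def by (simp only: of_real_mult of_real_power of_real_diff of_real_add of_real_1)
  moreover have zz: "z * cnj z = 1" by (rule mult_cnj_on_circle[OF assms])
  have "(1 - (z + w) / 2)\<^sup>2 * (1 + (z + w) / 2) = 1 / 2 - (z + w) / 8 - (z\<^sup>2 + w ^ 2) / 4 + (z ^ 3 + w ^ 3) / 8"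
    if "z * w = 1" for w
  proof -
    have "8 * ((1 - (z + w) / 2)\<^sup>2 * (1 + (z + w) / 2)) = (2 - (z + w))\<^sup>2 * (2 + (z + w))"
      by (simp add: power2_eq_square field_simps)
    also have "\<dots> = 8 * (1 / 2 - (z + w) / 8 - (z\<^sup>2 + w ^ 2) / 4 + (z ^ 3 + w ^ 3) / 8)"
      using that by (simp add: field_simps) algebra
    finally have "8 * ((1 - (z + w) / 2)\<^sup>2 * (1 + (z + w) / 2))
      = 8 * (1 / 2 - (z + w) / 8 - (z\<^sup>2 + w ^ 2) / 4 + (z ^ 3 + w ^ 3) / 8)" .
    then show ?thesis unfolding mult_cancel_left by simp
  qed
  ultimately show ?thesis using zz by metis
qed

lemma continuous_szego_weight [continuous_intros]:
  "continuous_on S f \<Longrightarrow> continuous_on S (\<lambda>x. szego_weight (f x))"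
  unfolding szego_weight_def by (intro continuous_intros)

text \<open>On the circle the product splits into an analytic A and the conjugate of a polynomial B.
  B comes from factors \<open>cnj z ^ k\<close> of V meeting z^j with j < k, and B 0 = 0. The
  matches j = k give A 0, and z^4 h stays analytic with a zero at 0 even after the factor
  \<open>cnj z ^ 3\<close>.\<close>

lemma integral_szego_weight_Re:
  assumes "taylor_disc f 0 c1 c2 c3"
  shows "(LINT \<theta>|dtheta. szego_weight (cis \<theta>) * Re (f (cis \<theta>))) = Re (- c1 / 8 - c2 / 4 + c3 / 8)"
proof -
  obtain h where h: "continuous_on (cball 0 1) h" "h holomorphic_on ball 0 1"
      "\<And>z. z \<in> cball 0 1 \<Longrightarrow> f z = 0 + c1 * z + c2 * z\<^sup>2 + c3 * z ^ 3 + z ^ 4 * h z"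
    using assms unfolding taylor_disc_def by blast
  define F where "F z = c1 * z + c2 * z\<^sup>2 + c3 * z ^ 3 + z ^ 4 * h z" for z
  define A where "A z = ((4 - z - 2 * z\<^sup>2 + z ^ 3) * F z - (c1 + c2 * z + c3 * z\<^sup>2 + z ^ 3 * h z)
     - 2 * (c2 + c3 * z + z\<^sup>2 * h z) + (c3 + z * h z)) / 8" for z
  define B where "B z = (cnj c1 * z\<^sup>2 + cnj c2 * z - 2 * cnj c1 * z) / 8" for z
  have split: "complex_of_real (szego_weight z) * f z = A z + cnj (B z)" if z: "z \<in> sphere 0 1" for z
  proof -
    define w where "w = cnj z"
    have zw: "z * w = 1" unfolding w_def by (rule mult_cnj_on_circle[OF z])
    have fF: "f z = F z" using z h(3)[of z] by (simp add: F_def)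
    have e1: "(4 - (z + w) - 2 * (z\<^sup>2 + w\<^sup>2) + (z ^ 3 + w ^ 3)) * F z
       = (4 - z - 2 * z\<^sup>2 + z ^ 3) * F z - (c1 + c2 * z + c3 * z\<^sup>2 + z ^ 3 * h z)
         - 2 * (c2 + c3 * z + z\<^sup>2 * h z) + (c3 + z * h z) + (c1 * w\<^sup>2 + c2 * w - 2 * c1 * w)"
      unfolding F_def using zw by algebra
    have e2: "complex_of_real (szego_weight z) = (4 - (z + w) - 2 * (z\<^sup>2 + w\<^sup>2) + (z ^ 3 + w ^ 3)) / 8"
      unfolding szego_weight_laurent[OF z] w_def by (simp add: field_simps)
    have e3: "A z + cnj (B z) = ((4 - z - 2 * z\<^sup>2 + z ^ 3) * F z - (c1 + c2 * z + c3 * z\<^sup>2 + z ^ 3 * h z)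
         - 2 * (c2 + c3 * z + z\<^sup>2 * h z) + (c3 + z * h z) + (c1 * w\<^sup>2 + c2 * w - 2 * c1 * w)) / 8"
      unfolding A_def B_def w_def by (simp flip: add_divide_distrib)
    show ?thesis unfolding fF e2 e3 e1[symmetric] by simp
  qed
  have cA: "continuous_on (cball 0 1) A" unfolding A_def F_def by (intro continuous_intros h) auto
  have hA: "A holomorphic_on ball 0 1" unfolding A_def F_def by (intro holomorphic_intros h) auto
  have cB: "continuous_on (cball 0 1) B" unfolding B_def by (intro continuous_intros) auto
  have hB: "B holomorphic_on ball 0 1" unfolding B_def by (intro holomorphic_intros) auto
  have sub: "sphere 0 1 \<subseteq> cball (0::complex) 1" by auto
  have iA: "integrable dtheta (\<lambda>\<theta>. A (cis \<theta>))" and iB: "integrable dtheta (\<lambda>\<theta>. B (cis \<theta>))"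
    by (intro integrable_dtheta_cis continuous_on_subset[OF cA sub] continuous_on_subset[OF cB sub])+
  have iC: "integrable dtheta (\<lambda>\<theta>. cnj (B (cis \<theta>)))" using iB by simp
  have "szego_weight (cis \<theta>) * Re (f (cis \<theta>)) = Re (A (cis \<theta>) + cnj (B (cis \<theta>)))" for \<theta>
    using arg_cong[OF split[of "cis \<theta>"], of Re] by simp
  then have "(LINT \<theta>|dtheta. szego_weight (cis \<theta>) * Re (f (cis \<theta>)))
      = (LINT \<theta>|dtheta. Re (A (cis \<theta>) + cnj (B (cis \<theta>))))" by simp
  also have "\<dots> = Re (LINT \<theta>|dtheta. A (cis \<theta>) + cnj (B (cis \<theta>)))"
    by (rule integral_Re) (intro Bochner_Integration.integrable_add iA iC)
  also have "\<dots> = Re (A 0 + cnj (B 0))"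
    by (simp only: Bochner_Integration.integral_add[OF iA iC] Bochner_Integration.integral_cnj
        mean_value_disc[OF cA hA] mean_value_disc[OF cB hB])
  also have "A 0 + cnj (B 0) = - c1 / 8 - c2 / 4 + c3 / 8" by (simp add: A_def B_def F_def field_simps)
  finally show ?thesis .
qed

lemma integral_szego_weight: "(LINT \<theta>|dtheta. szego_weight (cis \<theta>)) = 1 / 2"
proof -
  define A where "A z = 1 / 2 - z / 4 - z\<^sup>2 / 2 + z ^ 3 / 4" for z :: complex
  have i: "integrable dtheta (\<lambda>\<theta>. A (cis \<theta>))"
    unfolding A_def by (intro integrable_dtheta_cis continuous_intros) auto
  have "szego_weight (cis \<theta>) = Re (A (cis \<theta>))" for \<theta>
  proof -
    have "Re (complex_of_real (szego_weight (cis \<theta>))) = Re (A (cis \<theta>))"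
      by (subst szego_weight_laurent) (simp_all add: A_def flip: complex_cnj_power)
    then show ?thesis by simp
  qed
  then have "(LINT \<theta>|dtheta. szego_weight (cis \<theta>)) = Re (LINT \<theta>|dtheta. A (cis \<theta>))"
    using integral_Re[OF i] by simp
  also have "(LINT \<theta>|dtheta. A (cis \<theta>)) = A 0"
    by (rule mean_value_disc) (auto simp: A_def intro!: continuous_intros holomorphic_intros)
  finally show ?thesis by (simp add: A_def)
qed

lemma szego_weight_nonneg: "z \<in> sphere 0 1 \<Longrightarrow> 0 \<le> szego_weight z"
  using abs_Re_le_cmod[of z] unfolding szego_weight_def by (intro mult_nonneg_nonneg) auto

lemma szego_weight_le: "z \<in> sphere 0 1 \<Longrightarrow> szego_weight z \<le> 8"
proof -
  assume "z \<in> sphere 0 1"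
  then have "\<bar>Re z\<bar> \<le> 1" using abs_Re_le_cmod[of z] by simp
  then have "(1 - Re z)\<^sup>2 * (1 + Re z) \<le> 2\<^sup>2 * 2" by (intro mult_mono power_mono) auto
  then show ?thesis by (simp add: szego_weight_def)
qed

section \<open>Increments of the entropies\<close>

context opuc
begin

definition blaschke :: "nat \<Rightarrow> complex \<Rightarrow> complex" where
  "blaschke n z = poly (\<Phi> n) z / poly (rev_poly (\<Phi> n)) z"

lemma norm_blaschke: "z \<in> cball 0 1 \<Longrightarrow> cmod (blaschke n z) \<le> 1"
  using rev_poly_nonzero[of z n] Phi_le_rev_poly[of z n]
  by (simp add: blaschke_def norm_divide)

lemma norm_verblunsky_blaschke:
  assumes z: "z \<in> cball 0 1"
  shows "cmod (verblunsky \<Phi> n * (z * blaschke n z)) < 1"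
proof -
  have "cmod (verblunsky \<Phi> n) * (cmod z * cmod (blaschke n z)) \<le> cmod (verblunsky \<Phi> n) * (1 * 1)"
    using z norm_blaschke[OF z] by (intro mult_left_mono mult_mono) auto
  also have "\<dots> < 1" using cmod_verblunsky_less_1 by simp
  finally show ?thesis by (simp add: norm_mult)
qed

lemma rev_poly_Suc_factor:
  assumes z: "z \<in> cball 0 1"
  shows "poly (rev_poly (\<Phi> (Suc n))) z
     = poly (rev_poly (\<Phi> n)) z * (1 - verblunsky \<Phi> n * (z * blaschke n z))"
  using rev_poly_nonzero[OF z, of n]
  by (simp add: rev_poly_recurrence blaschke_def right_diff_distrib)

text \<open>A step of the Schur algorithm, (z b - cnj a) / (1 - a z b), obtained as the quotient of
  the two recurrences. The value at 0 is split off so that the Taylor rules for sums, products and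
  inverses apply.\<close>

lemma blaschke_Suc:
  assumes z: "z \<in> cball 0 1"
  shows "blaschke (Suc n) z = - cnj (verblunsky \<Phi> n)
     + (1 - verblunsky \<Phi> n * cnj (verblunsky \<Phi> n))
       * (z * blaschke n z * (1 / (1 - verblunsky \<Phi> n * (z * blaschke n z))))"
proof -
  define R a b where "R = poly (rev_poly (\<Phi> n)) z" and "a = verblunsky \<Phi> n" and "b = blaschke n z"
  have R: "R \<noteq> 0" unfolding R_def by (rule rev_poly_nonzero[OF z])
  have nz: "1 - a * (z * b) \<noteq> 0"
    using norm_verblunsky_blaschke[OF z, of n] unfolding a_def b_def by force
  have "poly (\<Phi> n) z = R * b" using R by (simp add: b_def R_def blaschke_def)
  then have "poly (\<Phi> (Suc n)) z = R * (z * b - cnj a)"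
    by (simp add: szego_recurrence R_def a_def algebra_simps)
  then have "blaschke (Suc n) z = R * (z * b - cnj a) / (R * (1 - a * (z * b)))"
    unfolding blaschke_def[of "Suc n"] rev_poly_Suc_factor[OF z] R_def a_def b_def by simp
  then have "blaschke (Suc n) z = (z * b - cnj a) / (1 - a * (z * b))" using R by simp
  also have "\<dots> = - cnj a + (1 - a * cnj a) * (z * b * (1 / (1 - a * (z * b))))"
    using nz by (simp add: divide_simps) algebra
  finally show ?thesis unfolding a_def b_def .
qed

text \<open>A step inserts -cnj \<alpha>_n as constant coefficient and pushes older data one order
  up. The third coefficient stays unspecified: the logarithm contains z b_n, so through order 3 it
  sees only three coefficients of b_n.\<close>

lemma taylor_blaschke_Suc:
  fixes n
  defines "a \<equiv> verblunsky \<Phi> n"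
  assumes "taylor_disc (blaschke n) c0 c1 c2 c3"
  shows "\<exists>d3. taylor_disc (blaschke (Suc n)) (- cnj a) ((1 - a * cnj a) * c0)
    ((1 - a * cnj a) * (c1 + a * c0\<^sup>2)) d3"
proof -
  have s: "taylor_disc (\<lambda>z. z * blaschke n z) 0 c0 c1 c2"
    using assms(2) by (rule taylor_disc_shift)
  have u: "taylor_disc (\<lambda>z. a * (z * blaschke n z)) 0 (a * c0) (a * c1) (a * c2)"
    using taylor_disc_cmult[OF s, of a] by simp
  note i = taylor_disc_inverse[OF u norm_verblunsky_blaschke[of _ n, folded a_def]]
  note t = taylor_disc_add[OF taylor_disc_const[of "- cnj a"]
      taylor_disc_cmult[OF taylor_disc_mult[OF s i], of "1 - a * cnj a"]]
  show ?thesis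
    by (rule exI, rule taylor_disc_cong[OF t _ _ _ _ refl])
      (simp_all add: blaschke_Suc a_def algebra_simps power2_eq_square)
qed

lemma taylor_blaschke_exists: "\<exists>c0 c1 c2 c3. taylor_disc (blaschke n) c0 c1 c2 c3"
proof (induction n)
  case 0
  have "taylor_disc (blaschke 0) 1 0 0 0"
    by (rule taylor_disc_cong[OF taylor_disc_const[of 1]]) (auto simp: blaschke_def rev_poly_def)
  then show ?case by blast
qed (use taylor_blaschke_Suc in blast)

text \<open>Three steps push the unknown coefficients of b_n beyond order 2. Together with the
  factor \<alpha>_(n+3) in the logarithm this explains the four arguments of
  \<open>sum_rule_term\<close>.\<close>

lemma taylor_blaschke_add_3:
  fixes n
  defines "a \<equiv> verblunsky \<Phi> n" and "b \<equiv> verblunsky \<Phi> (n + 1)" and "c \<equiv> verblunsky \<Phi> (n + 2)"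
  shows "\<exists>c3. taylor_disc (blaschke (n + 3)) (- cnj c) ((1 - c * cnj c) * - cnj b)
      ((1 - c * cnj c) * ((1 - b * cnj b) * - cnj a + c * (- cnj b)\<^sup>2)) c3"
proof -
  obtain p q r where "taylor_disc (blaschke (n + 1)) (- cnj a) p q r"
    using taylor_blaschke_exists[of n] taylor_blaschke_Suc unfolding a_def by (metis Suc_eq_plus1)
  from taylor_blaschke_Suc[OF this] obtain q r where
    "taylor_disc (blaschke (n + 2)) (- cnj b) ((1 - b * cnj b) * - cnj a) q r"
    unfolding b_def by (auto simp: numeral_2_eq_2)
  from taylor_blaschke_Suc[OF this] obtain r where
    "taylor_disc (blaschke (n + 3)) (- cnj c) ((1 - c * cnj c) * - cnj b)
      ((1 - c * cnj c) * ((1 - b * cnj b) * - cnj a + c * (- cnj b)\<^sup>2)) r"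
    unfolding c_def by (auto simp: numeral_3_eq_3 numeral_2_eq_2)
  then show ?thesis by blast
qed

definition bs_entropy :: "nat \<Rightarrow> real" where
  "bs_entropy n = (LINT \<theta>|dtheta. szego_weight (cis \<theta>) * ln (bs_weight n \<theta>))"

text \<open>On the circle \<Phi> and its dual have equal modulus, and the dual gains the factor 1 -
  \<alpha>_n z b_n; the real part of \<open>Ln\<close> is the logarithm of the modulus.\<close>

lemma ln_bs_weight_Suc:
  "ln (bs_weight (Suc n) \<theta>) = ln (bs_weight n \<theta>) + ln (1 - (cmod (verblunsky \<Phi> n))\<^sup>2)
     - 2 * Re (Ln (1 - verblunsky \<Phi> n * (cis \<theta> * blaschke n (cis \<theta>))))"
proof -
  define t where "t = 1 - verblunsky \<Phi> n * (cis \<theta> * blaschke n (cis \<theta>))"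
  have z: "cis \<theta> \<in> sphere 0 1" "cis \<theta> \<in> cball 0 1" by auto
  have t: "t \<noteq> 0" using norm_verblunsky_blaschke[OF z(2), of n] unfolding t_def by force
  have "cmod (poly (\<Phi> (Suc n)) (cis \<theta>)) = cmod (poly (\<Phi> n) (cis \<theta>)) * cmod t"
    using rev_poly_Suc_factor[OF z(2), of n] cmod_poly_rev_poly[OF z(1)]
    by (metis norm_mult t_def)
  then have "bs_weight (Suc n) \<theta> = bs_weight n \<theta> * ((1 - (cmod (verblunsky \<Phi> n))\<^sup>2) / (cmod t)\<^sup>2)"
    by (simp add: bs_weight_def norm_sq_Suc power_mult_distrib)
  moreover have "0 < 1 - (cmod (verblunsky \<Phi> n))\<^sup>2"
    using cmod_verblunsky_less_1[of n] by (simp add: power_less_one_iff)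
  ultimately have "ln (bs_weight (Suc n) \<theta>) = ln (bs_weight n \<theta>) + ln (1 - (cmod (verblunsky \<Phi> n))\<^sup>2) - 2 * ln (cmod t)"
    using bs_weight_pos[of n \<theta>] t by (simp add: ln_mult ln_div ln_realpow)
  then show ?thesis using t by (simp add: t_def)
qed

lemma integrable_szego_ln_bs: "integrable dtheta (\<lambda>\<theta>. szego_weight (cis \<theta>) * ln (bs_weight n \<theta>))"
  unfolding bs_weight_def
  by (rule integrable_dtheta_cis[where f = "\<lambda>z. szego_weight z * ln (norm_sq n / (cmod (poly (\<Phi> n) z))\<^sup>2)"])
    (use Phi_nonzero_on_circle norm_sq_pos[of n] in \<open>auto intro!: continuous_intros\<close>)

lemma bs_entropy_step:
  "bs_entropy (n + 4) - bs_entropy (n + 3)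
     = sum_rule_term (verblunsky \<Phi> n) (verblunsky \<Phi> (n + 1)) (verblunsky \<Phi> (n + 2)) (verblunsky \<Phi> (n + 3))"
proof -
  define a b c d where "a = verblunsky \<Phi> n" and "b = verblunsky \<Phi> (n + 1)" and "c = verblunsky \<Phi> (n + 2)"
    and "d = verblunsky \<Phi> (n + 3)"
  define u where "u z = d * (z * blaschke (n + 3) z)" for z
  obtain c3 where "taylor_disc (blaschke (n + 3)) (- cnj c) ((1 - c * cnj c) * - cnj b)
      ((1 - c * cnj c) * ((1 - b * cnj b) * - cnj a + c * (- cnj b)\<^sup>2)) c3"
    using taylor_blaschke_add_3[of n] unfolding a_def b_def c_def by blast
  from taylor_disc_cmult[OF taylor_disc_shift[OF this], of d]
  have "taylor_disc u 0 (d * - cnj c) (d * ((1 - c * cnj c) * - cnj b))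
     (d * ((1 - c * cnj c) * ((1 - b * cnj b) * - cnj a + c * (- cnj b)\<^sup>2)))"
    unfolding u_def mult_zero_right .
  from taylor_disc_Ln[OF this] have "taylor_disc (\<lambda>z. Ln (1 - u z)) 0 (taylor1 c d) (taylor2 b c d) (taylor3 a b c d)"
    by (rule taylor_disc_cong)
      (use norm_verblunsky_blaschke[of _ "n + 3"] in
        \<open>auto simp: u_def d_def taylor1_def taylor2_def taylor3_def algebra_simps power2_eq_square power3_eq_cube\<close>)
  note T = this
  have L: "(LINT \<theta>|dtheta. szego_weight (cis \<theta>) * Re (Ln (1 - u (cis \<theta>))))
      = Re (- taylor1 c d / 8 - taylor2 b c d / 4 + taylor3 a b c d / 8)"
    by (rule integral_szego_weight_Re[OF T])
  have eq: "szego_weight (cis \<theta>) * ln (bs_weight (n + 4) \<theta>)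
     = szego_weight (cis \<theta>) * ln (bs_weight (n + 3) \<theta>) + szego_weight (cis \<theta>) * ln (1 - (cmod d)\<^sup>2)
       - 2 * (szego_weight (cis \<theta>) * Re (Ln (1 - u (cis \<theta>))))" for \<theta>
  proof -
    have s: "Suc (n + 3) = n + 4" by simp
    have "ln (bs_weight (n + 4) \<theta>) = ln (bs_weight (n + 3) \<theta>) + ln (1 - (cmod d)\<^sup>2)
        - 2 * Re (Ln (1 - u (cis \<theta>)))"
      using ln_bs_weight_Suc[of "n + 3" \<theta>] unfolding s u_def d_def .
    then show ?thesis by (simp only: ring_distribs mult.left_commute)
  qed
  have i1: "integrable dtheta (\<lambda>\<theta>. szego_weight (cis \<theta>) * ln (1 - (cmod d)\<^sup>2))"
    by (intro integrable_mult_left integrable_dtheta_cis[where f = szego_weight] continuous_intros)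
  \<comment> \<open>Integrability is read off from \<open>eq\<close>, where all other terms are
    integrable.\<close>
  have i2: "integrable dtheta (\<lambda>\<theta>. 2 * (szego_weight (cis \<theta>) * Re (Ln (1 - u (cis \<theta>)))))"
  proof -
    have "2 * (szego_weight (cis \<theta>) * Re (Ln (1 - u (cis \<theta>)))) = szego_weight (cis \<theta>) * ln (bs_weight (n + 3) \<theta>)
       + szego_weight (cis \<theta>) * ln (1 - (cmod d)\<^sup>2) - szego_weight (cis \<theta>) * ln (bs_weight (n + 4) \<theta>)" for \<theta>
      using eq[of \<theta>] by simp
    then show ?thesis
      by (simp only:) (intro Bochner_Integration.integrable_add Bochner_Integration.integrable_diff
          integrable_szego_ln_bs i1)
  qed
  have "bs_entropy (n + 4) = bs_entropy (n + 3) + 1 / 2 * ln (1 - (cmod d)\<^sup>2)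
      - 2 * Re (- taylor1 c d / 8 - taylor2 b c d / 4 + taylor3 a b c d / 8)"
    unfolding bs_entropy_def eq
      Bochner_Integration.integral_diff[OF Bochner_Integration.integrable_add[OF integrable_szego_ln_bs i1] i2]
      Bochner_Integration.integral_add[OF integrable_szego_ln_bs i1] integral_mult_right_zero
      integral_mult_left_zero integral_szego_weight L ..
  then show ?thesis
    unfolding sum_rule_term_def a_def b_def c_def d_def
    by (simp add: Re_divide_numeral field_simps)
qed

end

section \<open>Lower semicontinuity of the entropy\<close>

text \<open>One h has to serve \<mu> and \<open>dtheta\<close> at once, and these may be mutually
  singular. For an indicator, the inner compact sets of the finitely many measures are united and
  the outer open sets intersected; a Urysohn function between them is close for every measure. The
  other cases follow the usual induction over nonnegative functions.\<close>

lemma L1_dense_continuous: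
  fixes M :: "'i \<Rightarrow> 'a::euclidean_space measure"
  assumes I: "finite I"
    and fin: "\<And>i. i \<in> I \<Longrightarrow> finite_measure (M i)"
    and sets: "\<And>i. i \<in> I \<Longrightarrow> sets (M i) = sets borel"
    and u: "u \<in> borel_measurable borel" "\<And>x. 0 \<le> (u x :: real)"
    and int: "\<And>i. i \<in> I \<Longrightarrow> integrable (M i) u"
    and e: "0 < e"
  shows "\<exists>h. continuous_on UNIV h \<and> (\<forall>i\<in>I. integrable (M i) h \<and> (LINT x|M i. \<bar>u x - h x\<bar>) < e)"
proof -
  have meas: "f \<in> borel_measurable (M i) \<longleftrightarrow> f \<in> borel_measurable borel" if "i \<in> I"
    for i and f :: "'a \<Rightarrow> real"
    by (simp add: measurable_cong_sets[OF sets[OF that] refl])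
  \<comment> \<open>Integrability is a premise inside the induction predicate, because each case has
    to recover it for its pieces.\<close>
  have "(\<forall>i\<in>I. integrable (M i) u) \<longrightarrow> (\<forall>e>0. \<exists>h. continuous_on UNIV h
     \<and> (\<forall>i\<in>I. integrable (M i) h \<and> (LINT x|M i. \<bar>u x - h x\<bar>) < e))" (is "?P u")
    using u
  proof (induction rule: borel_measurable_induct_real)
    case (set A)
    show ?case
    proof (intro impI allI)
      fix e :: real assume e: "0 < e"
      have "\<exists>K U. compact K \<and> K \<subseteq> A \<and> open U \<and> A \<subseteq> U \<and> measure (M i) (U - K) < e" if i: "i \<in> I" for i
      proof -
        interpret finite_measure "M i" by (rule fin[OF i])
        have sp: "emeasure (M i) (space (M i)) \<noteq> \<infinity>" by simp
        have e2: "0 < e / 2" using e by simp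
        have "\<exists>K\<in>{K. K \<subseteq> A \<and> compact K}. emeasure (M i) A < emeasure (M i) K + ennreal (e / 2)"
          by (rule SUP_approx_ennreal[OF e2 _ inner_regular[OF sets[OF i] sp set]]) auto
        then obtain K where K: "K \<subseteq> A" "compact K" "emeasure (M i) A < emeasure (M i) K + ennreal (e / 2)" by blast
        have "\<exists>U\<in>{U. A \<subseteq> U \<and> open U}. emeasure (M i) U < emeasure (M i) A + ennreal (e / 2)"
          by (rule INF_approx_ennreal[OF e2 outer_regular[OF sets[OF i] sp set]]) auto
        then obtain U where U: "A \<subseteq> U" "open U" "emeasure (M i) U < emeasure (M i) A + ennreal (e / 2)" by blast
        have ms: "K \<in> sets (M i)" "U \<in> sets (M i)" using K U sets[OF i] by (auto simp: borel_compact)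
        have "measure (M i) A < measure (M i) K + e / 2" "measure (M i) U < measure (M i) A + e / 2"
          using K(3) U(3) e by (simp_all add: emeasure_eq_measure ennreal_less_iff flip: ennreal_plus)
        moreover have "measure (M i) (U - K) = measure (M i) U - measure (M i) K"
          using ms K(1) U(1) by (intro finite_measure_Diff) auto
        ultimately show ?thesis using K U by (intro exI[of _ K] exI[of _ U]) auto
      qed
      then obtain K U where KU: "\<And>i. i \<in> I \<Longrightarrow> compact (K i) \<and> K i \<subseteq> A \<and> open (U i) \<and> A \<subseteq> U i
          \<and> measure (M i) (U i - K i) < e" by metis
      define K' U' where "K' = (\<Union>i\<in>I. K i)" and "U' = (\<Inter>i\<in>I. U i)"
      have K': "closed K'" "K' \<subseteq> A" and U': "open U'" "A \<subseteq> U'"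
        unfolding K'_def U'_def using I KU by (auto intro!: compact_imp_closed compact_UN open_INT)
      obtain h :: "'a \<Rightarrow> real" where h: "continuous_on UNIV h" "\<And>x. h x \<in> closed_segment 1 0"
        "\<And>x. x \<in> K' \<Longrightarrow> h x = 1" "\<And>x. x \<in> - U' \<Longrightarrow> h x = 0"
        using Urysohn_local[where U = UNIV and S = K' and T = "- U'" and a = "1::real" and b = 0] K' U' by auto
      have h01: "0 \<le> h x" "h x \<le> 1" for x using h(2)[of x] by (auto simp: closed_segment_eq_real_ivl)
      have hm: "h \<in> borel_measurable borel" by (rule borel_measurable_continuous_onI[OF h(1)])
      have "integrable (M i) h \<and> (LINT x|M i. \<bar>indicator A x - h x\<bar>) < e" if i: "i \<in> I" for i
      proof
        interpret finite_measure "M i" by (rule fin[OF i])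
        show ih: "integrable (M i) h"
          using meas[OF i] hm h01 by (intro integrable_const_bound[where B = 1]) auto
        have iA: "integrable (M i) (indicator A :: 'a \<Rightarrow> real)" using set sets[OF i] by (simp add: emeasure_eq_measure)
        have ms: "U i - K i \<in> sets (M i)" using KU[OF i] sets[OF i] by (auto simp: borel_compact)
        have "(LINT x|M i. \<bar>indicator A x - h x\<bar>) \<le> (LINT x|M i. indicator (U i - K i) x)"
        proof (rule integral_mono)
          fix x
          have "x \<in> K i \<Longrightarrow> x \<in> K'" "x \<notin> U i \<Longrightarrow> x \<in> - U'" using i by (auto simp: K'_def U'_def)
          then show "\<bar>indicator A x - h x\<bar> \<le> indicator (U i - K i) x"
            using h01[of x] h(3)[of x] h(4)[of x] KU[OF i] by (auto simp: indicator_def)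
        qed (use iA ih ms in \<open>auto simp: emeasure_eq_measure\<close>)
        also have "\<dots> = measure (M i) (U i - K i)" using ms sets.sets_into_space[OF ms] by (simp add: Int_absorb1)
        finally show "(LINT x|M i. \<bar>indicator A x - h x\<bar>) < e" using KU[OF i] by auto
      qed
      then show "\<exists>h. continuous_on UNIV h \<and> (\<forall>i\<in>I. integrable (M i) h \<and> (LINT x|M i. \<bar>indicator A x - h x\<bar>) < e)"
        using h(1) by blast
    qed
  next
    case (mult u c)
    show ?case
    proof (cases "c = 0")
      case True
      then show ?thesis by (auto intro!: exI[of _ "\<lambda>_. 0"])
    next
      case False
      then have c: "0 < c" using mult by simp
      show ?thesis
      proof (intro impI allI)
        fix e :: real assume e: "0 < e" and i: "\<forall>i\<in>I. integrable (M i) (\<lambda>x. c * u x)"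
        then have "\<forall>i\<in>I. integrable (M i) u" using False by simp
        then obtain h where h: "continuous_on UNIV h" "\<And>i. i \<in> I \<Longrightarrow> integrable (M i) h"
          "\<And>i. i \<in> I \<Longrightarrow> (LINT x|M i. \<bar>u x - h x\<bar>) < e / c"
          using mult e c by (metis divide_pos_pos)
        have "(LINT x|M i. \<bar>c * u x - c * h x\<bar>) < e" if "i \<in> I" for i
        proof -
          have "\<bar>c * u x - c * h x\<bar> = c * \<bar>u x - h x\<bar>" for x
            using c by (simp add: abs_mult flip: right_diff_distrib)
          then show ?thesis using h(3)[OF that] c by (simp add: field_simps)
        qed
        then show "\<exists>h. continuous_on UNIV h \<and> (\<forall>i\<in>I. integrable (M i) h \<and> (LINT x|M i. \<bar>c * u x - h x\<bar>) < e)"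
          using h by (intro exI[of _ "\<lambda>x. c * h x"]) (auto intro!: continuous_intros)
      qed
    qed
  next
    case (add u v)
    show ?case
    proof (intro impI allI)
      fix e :: real assume e: "0 < e" and i: "\<forall>i\<in>I. integrable (M i) (\<lambda>x. v x + u x)"
      have iu: "integrable (M i) u" and iv: "integrable (M i) v" if "i \<in> I" for i
      proof -
        have "integrable (M i) (\<lambda>x. v x + u x)" using i that by blast
        then show "integrable (M i) u" "integrable (M i) v"
          using add meas[OF that] by (auto intro: Bochner_Integration.integrable_bound)
      qed
      have e2: "0 < e / 2" using e by simp
      obtain h where h: "continuous_on UNIV h" "\<And>i. i \<in> I \<Longrightarrow> integrable (M i) h"
          "\<And>i. i \<in> I \<Longrightarrow> (LINT x|M i. \<bar>u x - h x\<bar>) < e / 2"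
        using add.IH(1) iu e2 by metis
      obtain k where k: "continuous_on UNIV k" "\<And>i. i \<in> I \<Longrightarrow> integrable (M i) k"
          "\<And>i. i \<in> I \<Longrightarrow> (LINT x|M i. \<bar>v x - k x\<bar>) < e / 2"
        using add.IH(2) iv e2 by metis
      have "(LINT x|M i. \<bar>v x + u x - (k x + h x)\<bar>) < e" if "i \<in> I" for i
      proof -
        have "(LINT x|M i. \<bar>v x + u x - (k x + h x)\<bar>) \<le> (LINT x|M i. \<bar>v x - k x\<bar> + \<bar>u x - h x\<bar>)"
          by (intro integral_mono) (use iu[OF that] iv[OF that] h(2)[OF that] k(2)[OF that] in auto)
        also have "\<dots> = (LINT x|M i. \<bar>v x - k x\<bar>) + (LINT x|M i. \<bar>u x - h x\<bar>)"
          by (intro Bochner_Integration.integral_add) (use iu[OF that] iv[OF that] h(2)[OF that] k(2)[OF that] in auto)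
        also have "\<dots> < e" using h(3)[OF that] k(3)[OF that] by simp
        finally show ?thesis .
      qed
      then show "\<exists>h. continuous_on UNIV h \<and> (\<forall>i\<in>I. integrable (M i) h \<and> (LINT x|M i. \<bar>v x + u x - h x\<bar>) < e)"
        using h k by (intro exI[of _ "\<lambda>x. k x + h x"]) (auto intro!: continuous_intros)
    qed
  next
    case (seq U)
    show ?case
    proof (intro impI allI)
      fix e :: real assume e: "0 < e" and iu: "\<forall>i\<in>I. integrable (M i) u"
      have Uu: "U j x \<le> u x" for j x
        by (rule incseq_le) (use seq in \<open>auto simp: incseq_def le_fun_def\<close>)
      have U0: "0 \<le> U j x" for j x using seq by auto
      have iU: "integrable (M i) (U j)" if "i \<in> I" for i j
        by (rule Bochner_Integration.integrable_bound[of _ u]) (use iu that seq meas[OF that] Uu u in auto)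
      have lim: "(\<lambda>j. LINT x|M i. \<bar>u x - U j x\<bar>) \<longlonglongrightarrow> (LINT x|M i. 0)" if "i \<in> I" for i
      proof (rule integral_dominated_convergence[where w = u])
        show "AE x in M i. (\<lambda>j. \<bar>u x - U j x\<bar>) \<longlonglongrightarrow> 0"
        proof (rule AE_I2)
          fix x
          have "(\<lambda>j. U j x) \<longlonglongrightarrow> u x" using seq by auto
          then have "(\<lambda>j. \<bar>u x - U j x\<bar>) \<longlonglongrightarrow> \<bar>u x - u x\<bar>" by (intro tendsto_intros)
          then show "(\<lambda>j. \<bar>u x - U j x\<bar>) \<longlonglongrightarrow> 0" by simp
        qed
        show "AE x in M i. norm \<bar>u x - U j x\<bar> \<le> u x" for j
          using Uu U0 by (intro AE_I2) simp
      qed (use iu that seq meas[OF that] u in auto)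
      have "\<forall>\<^sub>F j in sequentially. \<forall>i\<in>I. (LINT x|M i. \<bar>u x - U j x\<bar>) < e / 2"
        using I lim e by (intro eventually_ball_finite) (auto intro!: order_tendstoD)
      then obtain j where j: "\<And>i. i \<in> I \<Longrightarrow> (LINT x|M i. \<bar>u x - U j x\<bar>) < e / 2"
        unfolding eventually_sequentially by blast
      have e2: "0 < e / 2" using e by simp
      obtain h where h: "continuous_on UNIV h" "\<And>i. i \<in> I \<Longrightarrow> integrable (M i) h"
          "\<And>i. i \<in> I \<Longrightarrow> (LINT x|M i. \<bar>U j x - h x\<bar>) < e / 2"
        using seq.IH[of j] iU e2 by metis
      have "(LINT x|M i. \<bar>u x - h x\<bar>) < e" if "i \<in> I" for i
      proof -
        have iu': "integrable (M i) u" using iu that by blast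
        have "(LINT x|M i. \<bar>u x - h x\<bar>) \<le> (LINT x|M i. \<bar>u x - U j x\<bar> + \<bar>U j x - h x\<bar>)"
          by (intro integral_mono) (use iu' iU[OF that] h(2)[OF that] in auto)
        also have "\<dots> = (LINT x|M i. \<bar>u x - U j x\<bar>) + (LINT x|M i. \<bar>U j x - h x\<bar>)"
          by (intro Bochner_Integration.integral_add) (use iu' iU[OF that] h(2)[OF that] in auto)
        also have "\<dots> < e" using h(3)[OF that] j[OF that] by simp
        finally show ?thesis .
      qed
      then show "\<exists>h. continuous_on UNIV h \<and> (\<forall>i\<in>I. integrable (M i) h \<and> (LINT x|M i. \<bar>u x - h x\<bar>) < e)"
        using h by blast
    qed
  qed
  then show ?thesis using int e by blast
qed

section \<open>Angles, the Lebesgue decomposition and the logarithmic integral\<close>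

text \<open>This agrees with \<open>Arg2pi\<close>, which is 0 on the nonnegative reals, the set
  excluded from its continuity domain; the indicator form makes Borel measurability
  immediate.\<close>

definition circle_angle :: "complex \<Rightarrow> real" where
  "circle_angle z = indicator (- \<real>\<^sub>\<ge>\<^sub>0) z *\<^sub>R Arg2pi z"

lemma borel_measurable_circle_angle [measurable]: "circle_angle \<in> borel_measurable borel"
proof -
  have "continuous_on (- \<real>\<^sub>\<ge>\<^sub>0) Arg2pi"
    by (intro continuous_at_imp_continuous_on ballI continuous_at_Arg2pi) auto
  then show ?thesis
    unfolding circle_angle_def[abs_def]
    by (intro borel_measurable_continuous_on_indicator) (auto intro!: borel_comp borel_closed)
qed

lemma circle_angle_cis:
  assumes "0 \<le> \<theta>" "\<theta> < 2 * pi"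
  shows "circle_angle (cis \<theta>) = \<theta>"
proof -
  have a: "Arg2pi (cis \<theta>) = \<theta>"
    using assms by (intro Arg2pi_unique[of 1]) (auto simp: cis_conv_exp)
  show ?thesis
  proof (cases "cis \<theta> \<in> \<real>\<^sub>\<ge>\<^sub>0")
    case True
    then have "Arg2pi (cis \<theta>) = 0" unfolding Arg2pi_eq_0 complex_nonneg_Reals_iff complex_is_Real_iff by blast
    then show ?thesis using True a by (simp add: circle_angle_def)
  next
    case False
    then show ?thesis using a by (simp add: circle_angle_def)
  qed
qed

lemma AE_dtheta_range: "AE \<theta> in dtheta. 0 \<le> \<theta> \<and> \<theta> < 2 * pi"
proof -
  have "AE \<theta> in lborel. \<theta> \<noteq> 2 * pi" by (rule AE_lborel_singleton)
  then show ?thesis unfolding AE_dtheta_iff by eventually_elim auto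
qed

lemma measurable_cis_circle [measurable]: "cis \<in> dtheta \<rightarrow>\<^sub>M circle_borel"
  unfolding circle_borel_def
  by (rule measurable_restrict_space2)
    (auto intro!: borel_measurable_continuous_onI continuous_intros simp: measurable_cong_sets[OF sets_dtheta refl])

locale opuc_decomposition = opuc +
  fixes w :: "real \<Rightarrow> real" and \<mu>s :: "complex measure"
  assumes decomposition: "lebesgue_decomposition \<mu> w \<mu>s"
begin

lemma w_measurable [measurable]: "w \<in> borel_measurable borel"
  using decomposition by (simp add: lebesgue_decomposition_def)

lemma w_nonneg: "AE \<theta> in dtheta. 0 \<le> w \<theta>"
  using decomposition unfolding AE_dtheta_iff lebesgue_decomposition_def by auto

definition ac_part :: "complex measure" where
  "ac_part = distr (density dtheta (\<lambda>\<theta>. ennreal (w \<theta>))) circle_borel cis"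

lemma sets_mu_circle: "sets \<mu> = sets circle_borel"
  using sets_mu by (simp add: circle_borel_def)

lemma sets_ac_part [simp]: "sets ac_part = sets circle_borel"
  by (simp add: ac_part_def)

lemma emeasure_decomposition:
  "A \<in> sets \<mu> \<Longrightarrow> emeasure \<mu> A = emeasure ac_part A + emeasure \<mu>s A"
  using decomposition unfolding lebesgue_decomposition_def ac_part_def sets_mu_circle by blast

lemma nn_integral_ac_part:
  assumes "\<phi> \<in> borel_measurable \<mu>"
  shows "(\<integral>\<^sup>+z. \<phi> z \<partial>ac_part) = (\<integral>\<^sup>+\<theta>. ennreal (w \<theta>) * \<phi> (cis \<theta>) \<partial>dtheta)"
proof -
  have [measurable]: "\<phi> \<in> borel_measurable circle_borel"
    using assms by (simp add: measurable_cong_sets[OF sets_mu_circle refl])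
  have m: "cis \<in> density dtheta (\<lambda>\<theta>. ennreal (w \<theta>)) \<rightarrow>\<^sub>M circle_borel" by simp
  have "(\<integral>\<^sup>+z. \<phi> z \<partial>ac_part) = (\<integral>\<^sup>+\<theta>. \<phi> (cis \<theta>) \<partial>density dtheta (\<lambda>\<theta>. ennreal (w \<theta>)))"
    unfolding ac_part_def by (rule nn_integral_distr[OF m]) simp
  also have "\<dots> = (\<integral>\<^sup>+\<theta>. ennreal (w \<theta>) * \<phi> (cis \<theta>) \<partial>dtheta)"
    by (rule nn_integral_density) measurable
  finally show ?thesis .
qed

lemma nn_integral_w_le:
  assumes "\<phi> \<in> borel_measurable \<mu>"
  shows "(\<integral>\<^sup>+\<theta>. ennreal (w \<theta>) * \<phi> (cis \<theta>) \<partial>dtheta) \<le> (\<integral>\<^sup>+z. \<phi> z \<partial>\<mu>)"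
proof -
  have s: "sets ac_part = sets \<mu>" by (simp add: sets_mu_circle)
  have "ac_part \<le> \<mu>"
    unfolding le_measure[OF s] using emeasure_decomposition by (simp add: sets_mu_circle)
  from nn_integral_mono_measure[OF s this] show ?thesis
    unfolding nn_integral_ac_part[OF assms, symmetric] .
qed

lemma nn_integral_w: "(\<integral>\<^sup>+\<theta>. ennreal (w \<theta>) \<partial>dtheta) \<le> 1"
  using nn_integral_w_le[of "\<lambda>_. 1"] emeasure_space_1 by simp

text \<open>Dropping the singular part of \<mu>, which contributes nonnegatively, gives both
  integrability and the inequality.\<close>

lemma integral_w_continuous:
  fixes h :: "complex \<Rightarrow> real"
  assumes h: "continuous_on (sphere 0 1) h" "\<And>z. z \<in> sphere 0 1 \<Longrightarrow> 0 \<le> h z"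
  shows "integrable dtheta (\<lambda>\<theta>. w \<theta> * h (cis \<theta>))"
    and "(LINT \<theta>|dtheta. w \<theta> * h (cis \<theta>)) \<le> (LINT z|\<mu>. h z)"
proof -
  have [measurable]: "(\<lambda>\<theta>. h (cis \<theta>)) \<in> borel_measurable borel"
    by (intro borel_measurable_continuous_onI continuous_on_cis_compose h)
  have mh: "h \<in> borel_measurable \<mu>" by (rule measurable_mu[OF h(1)])
  have ih: "integrable \<mu> h" by (rule integrable_mu[OF h(1)])
  have AE0: "AE \<theta> in dtheta. 0 \<le> w \<theta> * h (cis \<theta>)"
    using w_nonneg by eventually_elim (use h(2) in auto)
  have "(\<integral>\<^sup>+\<theta>. ennreal (w \<theta> * h (cis \<theta>)) \<partial>dtheta) = (\<integral>\<^sup>+\<theta>. ennreal (w \<theta>) * ennreal (h (cis \<theta>)) \<partial>dtheta)"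
    by (rule nn_integral_cong_AE) (use w_nonneg in eventually_elim, use h(2) in \<open>auto simp: ennreal_mult\<close>)
  also have "\<dots> \<le> (\<integral>\<^sup>+z. ennreal (h z) \<partial>\<mu>)" by (rule nn_integral_w_le) (use mh in simp)
  also have "\<dots> = ennreal (LINT z|\<mu>. h z)"
    by (rule nn_integral_eq_integral[OF ih]) (use h(2) in \<open>auto intro!: AE_I2\<close>)
  finally have le: "(\<integral>\<^sup>+\<theta>. ennreal (w \<theta> * h (cis \<theta>)) \<partial>dtheta) \<le> ennreal (LINT z|\<mu>. h z)" .
  show int: "integrable dtheta (\<lambda>\<theta>. w \<theta> * h (cis \<theta>))"
    by (rule integrableI_nonneg) (use le AE0 in \<open>auto intro: le_less_trans\<close>)
  have "0 \<le> (LINT z|\<mu>. h z)" by (intro integral_nonneg_AE AE_I2) (use h(2) in auto)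
  then show "(LINT \<theta>|dtheta. w \<theta> * h (cis \<theta>)) \<le> (LINT z|\<mu>. h z)"
    using le unfolding nn_integral_eq_integral[OF int AE0] by simp
qed

definition log_integrand :: "real \<Rightarrow> ereal" where
  "log_integrand \<theta> = ereal (szego_weight (cis \<theta>)) * elog (w \<theta>)"

lemma szego_weight_cis: "0 \<le> szego_weight (cis \<theta>)" "szego_weight (cis \<theta>) \<le> 8"
  by (auto intro!: szego_weight_nonneg szego_weight_le)

lemma log_integrand_pos: "0 < w \<theta> \<Longrightarrow> log_integrand \<theta> = ereal (szego_weight (cis \<theta>) * ln (w \<theta>))"
  by (simp add: log_integrand_def elog_def)

lemma log_integrand_nonpos:
  "w \<theta> \<le> 0 \<Longrightarrow> log_integrand \<theta> = (if szego_weight (cis \<theta>) = 0 then 0 else - \<infinity>)"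
  using szego_weight_cis[of \<theta>] by (auto simp: log_integrand_def elog_def)

text \<open>ln w <= w, w has integral at most 1, and V <= 8 by the crude bounds (1 - c)^2 <= 4 and 1
  + c <= 2.\<close>

lemma positive_part_finite: "(\<integral>\<^sup>+\<theta>. e2ennreal (log_integrand \<theta>) \<partial>dtheta) < \<infinity>"
proof -
  have "(\<integral>\<^sup>+\<theta>. e2ennreal (log_integrand \<theta>) \<partial>dtheta) \<le> (\<integral>\<^sup>+\<theta>. 8 * ennreal (w \<theta>) \<partial>dtheta)"
  proof (rule nn_integral_mono)
    fix \<theta>
    show "e2ennreal (log_integrand \<theta>) \<le> 8 * ennreal (w \<theta>)"
    proof (cases "0 < w \<theta>")
      case True
      have "szego_weight (cis \<theta>) * ln (w \<theta>) \<le> szego_weight (cis \<theta>) * w \<theta>"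
        using szego_weight_cis[of \<theta>] ln_le_minus_one[OF True] by (intro mult_left_mono) auto
      also have "\<dots> \<le> 8 * w \<theta>" using szego_weight_cis[of \<theta>] True by (intro mult_right_mono) auto
      finally have "ennreal (szego_weight (cis \<theta>) * ln (w \<theta>)) \<le> ennreal (8 * w \<theta>)" by (rule ennreal_leI)
      then show ?thesis using True by (simp add: log_integrand_pos ennreal_mult flip: ennreal.rep_eq)
    next
      case False
      then show ?thesis by (simp add: log_integrand_nonpos e2ennreal_neg)
    qed
  qed
  also have "\<dots> = 8 * (\<integral>\<^sup>+\<theta>. ennreal (w \<theta>) \<partial>dtheta)" by (rule nn_integral_cmult) measurable
  also have "\<dots> \<le> 8 * 1" using nn_integral_w by (rule mult_left_mono) simp
  also have "\<dots> < \<infinity>" by simp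
  finally show ?thesis .
qed

definition negative_part :: ennreal where
  "negative_part = (\<integral>\<^sup>+\<theta>. e2ennreal (- log_integrand \<theta>) \<partial>dtheta)"

lemma ext_integral_finite_iff: "ext_integral dtheta log_integrand > - \<infinity> \<longleftrightarrow> negative_part < \<infinity>"
proof -
  define P where "P = (\<integral>\<^sup>+\<theta>. e2ennreal (log_integrand \<theta>) \<partial>dtheta)"
  have "P < \<infinity>" unfolding P_def by (rule positive_part_finite)
  then obtain p where p: "P = ennreal p" "0 \<le> p" by (cases P) auto
  have "ext_integral dtheta log_integrand = ereal p - enn2ereal negative_part"
    unfolding ext_integral_def P_def[symmetric] negative_part_def[symmetric] p(1) using p(2) by (simp add: enn2ereal_ennreal)
  then show ?thesis by (cases negative_part) (auto simp: enn2ereal_ennreal)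
qed

lemma log_integrand_measurable [measurable]: "log_integrand \<in> borel_measurable borel"
proof -
  have [measurable]: "(\<lambda>\<theta>. szego_weight (cis \<theta>)) \<in> borel_measurable borel"
    by (intro borel_measurable_continuous_onI continuous_intros)
  have "(\<lambda>\<theta>. elog (w \<theta>)) \<in> borel_measurable borel"
    unfolding elog_def[abs_def] by measurable
  then show ?thesis unfolding log_integrand_def[abs_def] by measurable
qed

text \<open>Write b for the n-th weight. Then ln b >= ln w - w / b, and 1 / b = |\<Phi>_n|^2 /
  \<open>norm_sq n\<close> has \<mu>-mean 1. With V <= 8 the last term costs at most 8 after
  integration, uniformly in n.\<close>

lemma bs_entropy_bounded_below:
  assumes fin: "negative_part < \<infinity>"
  shows "\<exists>C. \<forall>n. - C \<le> bs_entropy n"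
proof -
  define q where "q \<theta> = szego_weight (cis \<theta>) * ln (w \<theta>)" for \<theta>
  have [measurable]: "(\<lambda>\<theta>. szego_weight (cis \<theta>)) \<in> borel_measurable borel"
    by (intro borel_measurable_continuous_onI continuous_intros)
  have [measurable]: "q \<in> borel_measurable borel" unfolding q_def[abs_def] by measurable
  have AEw: "AE \<theta> in dtheta. szego_weight (cis \<theta>) = 0 \<or> 0 < w \<theta>"
  proof -
    have "AE \<theta> in dtheta. e2ennreal (- log_integrand \<theta>) \<noteq> \<infinity>"
      by (rule nn_integral_PInf_AE) (use fin in \<open>auto simp: negative_part_def\<close>)
    then show ?thesis
      by eventually_elim (auto simp: log_integrand_nonpos not_less top_ennreal.rep_eq split: if_splits)
  qed
  have iq: "integrable dtheta q"
  proof (rule integrableI_bounded)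
    have "(\<integral>\<^sup>+\<theta>. ennreal (norm (q \<theta>)) \<partial>dtheta)
        \<le> (\<integral>\<^sup>+\<theta>. e2ennreal (log_integrand \<theta>) + e2ennreal (- log_integrand \<theta>) \<partial>dtheta)"
    proof (rule nn_integral_mono_AE)
      show "AE \<theta> in dtheta. ennreal (norm (q \<theta>)) \<le> e2ennreal (log_integrand \<theta>) + e2ennreal (- log_integrand \<theta>)"
        using AEw
      proof eventually_elim
        case (elim \<theta>)
        show ?case
        proof (cases "0 < w \<theta>")
          case True
          then have "e2ennreal (log_integrand \<theta>) = ennreal (q \<theta>)" "e2ennreal (- log_integrand \<theta>) = ennreal (- q \<theta>)"
            by (simp_all add: log_integrand_pos q_def flip: ennreal.rep_eq)
          then show ?thesis by (cases "0 \<le> q \<theta>") (auto simp: ennreal_neg)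
        next
          case False
          then show ?thesis using elim by (simp add: q_def)
        qed
      qed
    qed
    also have "\<dots> = (\<integral>\<^sup>+\<theta>. e2ennreal (log_integrand \<theta>) \<partial>dtheta) + negative_part"
      unfolding negative_part_def by (rule nn_integral_add) measurable
    also have "\<dots> < \<infinity>" using positive_part_finite fin by simp
    finally show "(\<integral>\<^sup>+\<theta>. ennreal (norm (q \<theta>)) \<partial>dtheta) < \<infinity>" .
  qed simp
  have "(LINT \<theta>|dtheta. q \<theta>) - 8 \<le> bs_entropy n" for n
  proof -
    define h where "h z = szego_weight z * ((cmod (poly (\<Phi> n) z))\<^sup>2 / norm_sq n)" for z
    have h: "continuous_on (sphere 0 1) h" "\<And>z. z \<in> sphere 0 1 \<Longrightarrow> 0 \<le> h z"
      unfolding h_def using norm_sq_pos[of n] szego_weight_nonneg by (auto intro!: continuous_intros)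
    note wh = integral_w_continuous[OF h]
    have "(LINT z|\<mu>. h z) \<le> (LINT z|\<mu>. 8 / norm_sq n * (cmod (poly (\<Phi> n) z))\<^sup>2)"
    proof (rule integral_mono)
      fix z assume "z \<in> space \<mu>"
      then have "szego_weight z \<le> 8" by (intro szego_weight_le) simp
      then have "szego_weight z * ((cmod (poly (\<Phi> n) z))\<^sup>2 / norm_sq n) \<le> 8 * ((cmod (poly (\<Phi> n) z))\<^sup>2 / norm_sq n)"
        using norm_sq_pos[of n] by (intro mult_right_mono) auto
      then show "h z \<le> 8 / norm_sq n * (cmod (poly (\<Phi> n) z))\<^sup>2" by (simp add: h_def)
    qed (intro integrable_mu h continuous_intros)+
    also have "\<dots> = 8 / norm_sq n * norm_sq n" unfolding norm_sq_def by (rule integral_mult_right_zero)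
    also have "\<dots> = 8" using norm_sq_pos[of n] by simp
    finally have h8: "(LINT \<theta>|dtheta. w \<theta> * h (cis \<theta>)) \<le> 8" using wh(2) by simp
    have "(LINT \<theta>|dtheta. q \<theta> - w \<theta> * h (cis \<theta>)) \<le> bs_entropy n"
      unfolding bs_entropy_def
    proof (rule integral_mono_AE)
      show "AE \<theta> in dtheta. q \<theta> - w \<theta> * h (cis \<theta>) \<le> szego_weight (cis \<theta>) * ln (bs_weight n \<theta>)"
        using AEw
      proof eventually_elim
        case (elim \<theta>)
        show ?case
        proof (cases "0 < w \<theta>")
          case True
          define b where "b = bs_weight n \<theta>"
          have b: "0 < b" unfolding b_def by (rule bs_weight_pos)
          have "ln (w \<theta> / b) \<le> w \<theta> / b - 1" using True b by (intro ln_le_minus_one) simp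
          then have "ln (w \<theta>) - w \<theta> / b \<le> ln b" using True b by (simp add: ln_div)
          then have "szego_weight (cis \<theta>) * (ln (w \<theta>) - w \<theta> / b) \<le> szego_weight (cis \<theta>) * ln b"
            using szego_weight_cis by (intro mult_left_mono)
          moreover have "w \<theta> * h (cis \<theta>) = szego_weight (cis \<theta>) * (w \<theta> / b)"
            by (simp add: h_def b_def bs_weight_def)
          ultimately show ?thesis by (simp only: q_def b_def right_diff_distrib)
        next
          case False
          then show ?thesis using elim by (simp add: q_def h_def)
        qed
      qed
    next
      show "integrable dtheta (\<lambda>\<theta>. q \<theta> - w \<theta> * h (cis \<theta>))"
        by (rule Bochner_Integration.integrable_diff[OF iq wh(1)])
      show "integrable dtheta (\<lambda>\<theta>. szego_weight (cis \<theta>) * ln (bs_weight n \<theta>))"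
        by (rule integrable_szego_ln_bs)
    qed
    moreover have "(LINT \<theta>|dtheta. q \<theta> - w \<theta> * h (cis \<theta>))
        = (LINT \<theta>|dtheta. q \<theta>) - (LINT \<theta>|dtheta. w \<theta> * h (cis \<theta>))"
      by (rule Bochner_Integration.integral_diff[OF iq wh(1)])
    ultimately show ?thesis using h8 by linarith
  qed
  then show ?thesis by (intro exI[of _ "8 - (LINT \<theta>|dtheta. q \<theta>)"]) (simp add: algebra_simps)
qed

end

context opuc
begin

lemma entropy_bound_continuous:
  fixes h :: "complex \<Rightarrow> real"
  assumes h: "continuous_on (sphere 0 1) h" "\<And>z. z \<in> sphere 0 1 \<Longrightarrow> 0 < h z"
    and C: "\<And>n. - C \<le> bs_entropy (n + k)"
  shows "(LINT \<theta>|dtheta. szego_weight (cis \<theta>) * ln (h (cis \<theta>))) \<le> (LINT z|\<mu>. szego_weight z * h z) + C"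
proof -
  have cV: "continuous_on (sphere 0 1) szego_weight" by (intro continuous_intros)
  have ch: "continuous_on (sphere 0 1) (\<lambda>z. szego_weight z * h z)" by (intro continuous_intros h)
  have cl: "continuous_on (sphere 0 1) (\<lambda>z. szego_weight z * ln (h z))"
    using h(2) by (intro continuous_intros h(1)) force
  have iV: "integrable dtheta (\<lambda>\<theta>. szego_weight (cis \<theta>))" by (rule integrable_dtheta_cis[OF cV])
  have il: "integrable dtheta (\<lambda>\<theta>. szego_weight (cis \<theta>) * ln (h (cis \<theta>)))" by (rule integrable_dtheta_cis[OF cl])
  have ib: "integrable dtheta (\<lambda>\<theta>. bs_weight n \<theta> * (szego_weight (cis \<theta>) * h (cis \<theta>)))" for n
    using integrable_bs_weight[OF ch] by simp
  have le: "(LINT \<theta>|dtheta. szego_weight (cis \<theta>) * ln (h (cis \<theta>))) - C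
      \<le> (LINT \<theta>|dtheta. bs_weight (n + k) \<theta> * (szego_weight (cis \<theta>) * h (cis \<theta>)))" for n
  proof -
    have "bs_entropy (n + k) \<le> (LINT \<theta>|dtheta. bs_weight (n + k) \<theta> * (szego_weight (cis \<theta>) * h (cis \<theta>))
        - szego_weight (cis \<theta>) * ln (h (cis \<theta>)))"
      unfolding bs_entropy_def
    proof (rule integral_mono)
      fix \<theta>
      define b x v where "b = bs_weight (n + k) \<theta>" and "x = h (cis \<theta>)" and "v = szego_weight (cis \<theta>)"
      have b: "0 < b" "0 < x" "0 \<le> v"
        unfolding b_def x_def v_def using bs_weight_pos h(2) szego_weight_nonneg by auto
      have "ln (b * x) \<le> b * x - 1" using b by (intro ln_le_minus_one) simp
      then have "ln b \<le> b * x - ln x" using b by (simp add: ln_mult)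
      then have "v * ln b \<le> v * (b * x - ln x)" using b by (intro mult_left_mono)
      then show "v * ln b \<le> b * (v * x) - v * ln x" by (simp only: right_diff_distrib mult.left_commute)
    qed (rule integrable_szego_ln_bs Bochner_Integration.integrable_diff[OF ib il])+
    then show ?thesis using C[of n] unfolding Bochner_Integration.integral_diff[OF ib il] by linarith
  qed
  have "(\<lambda>n. LINT \<theta>|dtheta. bs_weight (n + k) \<theta> * (szego_weight (cis \<theta>) * h (cis \<theta>)))
      \<longlonglongrightarrow> (LINT z|\<mu>. szego_weight z * h z)"
    by (rule LIMSEQ_ignore_initial_segment[OF bs_weak_convergence[OF ch]])
  from LIMSEQ_le_const[OF this] le show ?thesis by force
qed

lemma entropy_bound_measurable:
  fixes g :: "complex \<Rightarrow> real"
  assumes g [measurable]: "g \<in> borel_measurable borel"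
    and b: "\<And>z. 1 \<le> g z" "\<And>z. g z \<le> b"
    and C: "\<And>n. - C \<le> bs_entropy (n + k)"
  shows "(LINT \<theta>|dtheta. szego_weight (cis \<theta>) * ln (g (cis \<theta>))) \<le> (LINT z|\<mu>. szego_weight z * g z) + C"
proof (rule field_le_epsilon)
  fix e :: real assume e: "0 < e"
  have cis_meas [measurable]: "cis \<in> borel_measurable dtheta"
    by (simp add: measurable_cong_sets[OF sets_dtheta refl] borel_measurable_continuous_onI continuous_intros)
  have id_meas [measurable]: "(\<lambda>z. z) \<in> \<mu> \<rightarrow>\<^sub>M borel" by (rule measurable_mu) (intro continuous_intros)
  define M where "M i = (if i then distr \<mu> borel (\<lambda>z. z) else distr dtheta borel cis)" for i
  have fin: "finite_measure (M i)" for i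
    unfolding M_def using finite_measure_distr[OF id_meas] dtheta.finite_measure_distr[OF cis_meas] by simp
  have sets: "sets (M i) = sets borel" for i by (simp add: M_def)
  have int: "integrable (M i) g" for i
  proof -
    interpret finite_measure "M i" by (rule fin)
    have "g \<in> borel_measurable (M i)" by (simp add: measurable_cong_sets[OF sets refl])
    moreover have "norm (g z) \<le> b" for z using b[of z] by simp
    ultimately show ?thesis by (intro integrable_const_bound[where B = b]) auto
  qed
  have g0: "0 \<le> g z" for z using b(1)[of z] by simp
  have e16: "0 < e / 16" using e by simp
  obtain h0 where h0: "continuous_on UNIV h0" "\<And>i. integrable (M i) h0"
      "\<And>i. (LINT x|M i. \<bar>g x - h0 x\<bar>) < e / 16"
    using L1_dense_continuous[of UNIV M g "e / 16", OF _ fin sets g g0 int e16] by auto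
  define h where "h z = max 1 (min b (h0 z))" for z
  have hc: "continuous_on S h" for S
    unfolding h_def using continuous_on_subset[OF h0(1)] by (intro continuous_intros) auto
  have h1: "1 \<le> h z" for z by (simp add: h_def)
  have b1: "1 \<le> b" using b[of 0] by simp
  have gh: "\<bar>g z - h z\<bar> \<le> \<bar>g z - h0 z\<bar>" for z unfolding h_def using b[of z] b1 by (auto simp: min_def max_def)
  have [measurable]: "h0 \<in> borel_measurable borel" by (rule borel_measurable_continuous_onI[OF h0(1)])
  have [measurable]: "h \<in> borel_measurable borel" by (rule borel_measurable_continuous_onI[OF hc])
  have [measurable]: "szego_weight \<in> borel_measurable borel"
    by (intro borel_measurable_continuous_onI continuous_intros)
  have gm: "(\<lambda>z. \<bar>g z - h0 z\<bar>) \<in> borel_measurable borel" by measurable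
  have D\<mu>: "integrable \<mu> (\<lambda>z. \<bar>g z - h0 z\<bar>)" "(LINT z|\<mu>. \<bar>g z - h0 z\<bar>) < e / 16"
    using integrable_distr_eq[OF id_meas gm] integral_distr[OF id_meas gm]
      Bochner_Integration.integrable_diff[OF int[of True] h0(2)[of True]] h0(3)[of True]
    by (simp_all add: M_def)
  have D\<theta>: "integrable dtheta (\<lambda>\<theta>. \<bar>g (cis \<theta>) - h0 (cis \<theta>)\<bar>)"
    "(LINT \<theta>|dtheta. \<bar>g (cis \<theta>) - h0 (cis \<theta>)\<bar>) < e / 16"
    using integrable_distr_eq[OF cis_meas gm] integral_distr[OF cis_meas gm]
      Bochner_Integration.integrable_diff[OF int[of False] h0(2)[of False]] h0(3)[of False]
    by (simp_all add: M_def)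
  have ig: "integrable \<mu> (\<lambda>z. szego_weight z * g z)"
    by (rule integrable_const_bound[where B = "8 * b"])
      (use szego_weight_nonneg szego_weight_le b g0 b1 in
        \<open>auto intro!: AE_I2 mult_mono simp: abs_mult measurable_mu\<close>)
  have ih: "integrable \<mu> (\<lambda>z. szego_weight z * h z)" by (intro integrable_mu continuous_intros hc)
  have "(LINT z|\<mu>. szego_weight z * h z) \<le> (LINT z|\<mu>. szego_weight z * g z + 8 * \<bar>g z - h0 z\<bar>)"
  proof (rule integral_mono[OF ih])
    fix z assume "z \<in> space \<mu>"
    then have v: "0 \<le> szego_weight z" "szego_weight z \<le> 8" using szego_weight_nonneg szego_weight_le by auto
    have "szego_weight z * (h z - g z) \<le> szego_weight z * \<bar>g z - h0 z\<bar>"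
      using v gh[of z] by (intro mult_left_mono) auto
    also have "\<dots> \<le> 8 * \<bar>g z - h0 z\<bar>" using v by (intro mult_right_mono) auto
    finally show "szego_weight z * h z \<le> szego_weight z * g z + 8 * \<bar>g z - h0 z\<bar>" by (simp add: right_diff_distrib)
  qed (intro Bochner_Integration.integrable_add ig integrable_mult_right D\<mu>)
  also have "\<dots> = (LINT z|\<mu>. szego_weight z * g z) + 8 * (LINT z|\<mu>. \<bar>g z - h0 z\<bar>)"
    by (simp only: Bochner_Integration.integral_add[OF ig integrable_mult_right[OF D\<mu>(1)]] integral_mult_right_zero)
  finally have 1: "(LINT z|\<mu>. szego_weight z * h z) \<le> (LINT z|\<mu>. szego_weight z * g z) + e / 2"
    using D\<mu>(2) by simp
  have il: "integrable dtheta (\<lambda>\<theta>. szego_weight (cis \<theta>) * ln (h (cis \<theta>)))"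
    by (rule integrable_dtheta_cis[where f = "\<lambda>z. szego_weight z * ln (h z)"])
      (use h1 in \<open>auto intro!: continuous_intros hc simp: less_le_trans[OF zero_less_one h1, THEN less_imp_neq, symmetric]\<close>)
  have im: "integrable dtheta (\<lambda>\<theta>. szego_weight (cis \<theta>) * ln (g (cis \<theta>)))"
  proof (rule dtheta.integrable_const_bound[where B = "8 * ln b"])
    show "AE \<theta> in dtheta. norm (szego_weight (cis \<theta>) * ln (g (cis \<theta>))) \<le> 8 * ln b"
    proof (rule AE_I2)
      fix \<theta>
      have "0 < g (cis \<theta>)" using b(1)[of "cis \<theta>"] by simp
      then have "0 \<le> ln (g (cis \<theta>))" "ln (g (cis \<theta>)) \<le> ln b" using b[of "cis \<theta>"] b1 by auto
      then show "norm (szego_weight (cis \<theta>) * ln (g (cis \<theta>))) \<le> 8 * ln b"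
        using szego_weight_nonneg[of "cis \<theta>"] szego_weight_le[of "cis \<theta>"]
        by (auto simp: abs_mult intro!: mult_mono)
    qed
  qed measurable
  have "(LINT \<theta>|dtheta. szego_weight (cis \<theta>) * ln (g (cis \<theta>)))
     \<le> (LINT \<theta>|dtheta. szego_weight (cis \<theta>) * ln (h (cis \<theta>)) + 8 * \<bar>g (cis \<theta>) - h0 (cis \<theta>)\<bar>)"
  proof (rule integral_mono[OF im])
    fix \<theta>
    define z where "z = cis \<theta>"
    have v: "0 \<le> szego_weight z" "szego_weight z \<le> 8"
      unfolding z_def using szego_weight_nonneg szego_weight_le by auto
    have pos: "0 < g z" "0 < h z" using b(1)[of z] h1[of z] by linarith+
    have "ln (g z) - ln (h z) = ln (g z / h z)" using pos by (simp add: ln_div)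
    also have "\<dots> \<le> g z / h z - 1" using pos by (intro ln_le_minus_one) simp
    also have "\<dots> = (g z - h z) / h z" using pos by (simp add: diff_divide_distrib)
    also have "\<dots> \<le> \<bar>g z - h z\<bar> / 1" using h1[of z] by (intro frac_le) auto
    also have "\<dots> \<le> \<bar>g z - h0 z\<bar>" using gh by simp
    finally have "szego_weight z * (ln (g z) - ln (h z)) \<le> szego_weight z * \<bar>g z - h0 z\<bar>"
      using v by (intro mult_left_mono) auto
    also have "\<dots> \<le> 8 * \<bar>g z - h0 z\<bar>" using v by (intro mult_right_mono) auto
    finally show "szego_weight z * ln (g z) \<le> szego_weight z * ln (h z) + 8 * \<bar>g z - h0 z\<bar>"
      by (simp add: right_diff_distrib)
  qed (intro Bochner_Integration.integrable_add il integrable_mult_right D\<theta>)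
  also have "\<dots> = (LINT \<theta>|dtheta. szego_weight (cis \<theta>) * ln (h (cis \<theta>)))
      + 8 * (LINT \<theta>|dtheta. \<bar>g (cis \<theta>) - h0 (cis \<theta>)\<bar>)"
    by (simp only: Bochner_Integration.integral_add[OF il integrable_mult_right[OF D\<theta>(1)]] integral_mult_right_zero)
  finally have 2: "(LINT \<theta>|dtheta. szego_weight (cis \<theta>) * ln (g (cis \<theta>)))
      \<le> (LINT \<theta>|dtheta. szego_weight (cis \<theta>) * ln (h (cis \<theta>))) + e / 2"
    using D\<theta>(2) by simp
  have "0 < h z" for z using h1[of z] by linarith
  from entropy_bound_continuous[OF hc this C] 1 2
  show "(LINT \<theta>|dtheta. szego_weight (cis \<theta>) * ln (g (cis \<theta>))) \<le> (LINT z|\<mu>. szego_weight z * g z) + C + e"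
    by linarith
qed

end

context opuc_decomposition
begin

lemma emeasure_mu_restrict_ac:
  obtains N where "N \<in> sets borel" "AE \<theta> in dtheta. cis \<theta> \<notin> N"
    "\<And>\<phi>. \<phi> \<in> borel_measurable \<mu> \<Longrightarrow>
      (\<integral>\<^sup>+z. indicator (- N) z * \<phi> z \<partial>\<mu>) = (\<integral>\<^sup>+\<theta>. ennreal (w \<theta>) * (indicator (- N) (cis \<theta>) * \<phi> (cis \<theta>)) \<partial>dtheta)"
proof -
  obtain N where N: "N \<in> sets circle_borel" "emeasure (distr dtheta circle_borel cis) N = 0"
    "emeasure \<mu>s (sphere 0 1 - N) = 0"
    using decomposition unfolding lebesgue_decomposition_def by blast
  have NB: "N \<in> sets borel"
    using N(1) unfolding circle_borel_def by (auto simp: sets_restrict_space)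
  have "AE \<theta> in dtheta. cis \<theta> \<notin> N"
  proof -
    have "emeasure dtheta (cis -` N) = 0"
      using N(2) by (simp add: emeasure_distr[OF measurable_cis_circle N(1)])
    moreover have "cis -` N \<in> sets dtheta" using measurable_sets[OF measurable_cis_circle N(1)] by simp
    ultimately show ?thesis by (intro AE_I[where N = "cis -` N"]) auto
  qed
  moreover have "(\<integral>\<^sup>+z. indicator (- N) z * \<phi> z \<partial>\<mu>) = (\<integral>\<^sup>+\<theta>. ennreal (w \<theta>) * (indicator (- N) (cis \<theta>) * \<phi> (cis \<theta>)) \<partial>dtheta)"
    if \<phi> [measurable]: "\<phi> \<in> borel_measurable \<mu>" for \<phi>
  proof -
    define S where "S = sphere 0 1 - N"
    have S: "S \<in> sets \<mu>" unfolding S_def using N(1) sets_mu_circle by (metis sets.compl_sets space_mu)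
    have S': "S \<in> sets ac_part" using S sets_mu_circle by simp
    have eq: "density \<mu> (indicator S) = density ac_part (indicator S)"
    proof (rule measure_eqI)
      show "sets (density \<mu> (indicator S)) = sets (density ac_part (indicator S))"
        by (simp add: sets_mu_circle)
      fix A assume "A \<in> sets (density \<mu> (indicator S))"
      then have A: "A \<in> sets \<mu>" by simp
      have sing: "sets \<mu>s = sets \<mu>"
        using decomposition sets_mu_circle by (simp add: lebesgue_decomposition_def)
      have "emeasure \<mu>s (S \<inter> A) \<le> emeasure \<mu>s S"
        by (rule emeasure_mono) (use S sing in auto)
      then have "emeasure \<mu>s (S \<inter> A) = 0" using N(3) by (simp add: S_def)
      moreover have "S \<inter> A \<in> sets \<mu>" using S A by auto
      ultimately have "emeasure \<mu> (S \<inter> A) = emeasure ac_part (S \<inter> A)"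
        using emeasure_decomposition by simp
      then show "emeasure (density \<mu> (indicator S)) A = emeasure (density ac_part (indicator S)) A"
        using S S' A by (simp add: emeasure_restricted sets_mu_circle)
    qed
    have \<phi>': "\<phi> \<in> borel_measurable ac_part"
      using \<phi> by (simp add: measurable_cong_sets[OF sets_mu_circle refl] measurable_cong_sets[OF sets_ac_part refl])
    have "(\<integral>\<^sup>+z. indicator (- N) z * \<phi> z \<partial>\<mu>) = (\<integral>\<^sup>+z. indicator S z * \<phi> z \<partial>\<mu>)"
      by (rule nn_integral_cong) (auto simp: S_def indicator_def)
    also have "\<dots> = (\<integral>\<^sup>+z. \<phi> z \<partial>density \<mu> (indicator S))"
      using S by (intro nn_integral_density[symmetric]) auto
    also have "\<dots> = (\<integral>\<^sup>+z. indicator S z * \<phi> z \<partial>ac_part)"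
      unfolding eq by (intro nn_integral_density borel_measurable_indicator S' \<phi>')
    also have "\<dots> = (\<integral>\<^sup>+\<theta>. ennreal (w \<theta>) * (indicator S (cis \<theta>) * \<phi> (cis \<theta>)) \<partial>dtheta)"
      using S by (intro nn_integral_ac_part) simp
    also have "\<dots> = (\<integral>\<^sup>+\<theta>. ennreal (w \<theta>) * (indicator (- N) (cis \<theta>) * \<phi> (cis \<theta>)) \<partial>dtheta)"
      by (rule nn_integral_cong) (auto simp: S_def indicator_def)
    finally show ?thesis .
  qed
  ultimately show thesis using NB that by blast
qed

lemma truncated_negative_part_le:
  assumes C: "\<And>n. - C \<le> bs_entropy (n + k)" and \<delta>: "0 < \<delta>" "\<delta> \<le> 1"
  shows "(\<integral>\<^sup>+\<theta>. ennreal (szego_weight (cis \<theta>) * - ln (max \<delta> (min 1 (w \<theta>)))) \<partial>dtheta) \<le> ennreal (24 + C)"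
proof -
  obtain N where N [measurable]: "N \<in> sets borel" and AEN: "AE \<theta> in dtheta. cis \<theta> \<notin> N"
    and split: "\<And>\<phi>. \<phi> \<in> borel_measurable \<mu> \<Longrightarrow>
      (\<integral>\<^sup>+z. indicator (- N) z * \<phi> z \<partial>\<mu>) = (\<integral>\<^sup>+\<theta>. ennreal (w \<theta>) * (indicator (- N) (cis \<theta>) * \<phi> (cis \<theta>)) \<partial>dtheta)"
    by (rule emeasure_mu_restrict_ac) blast
  define g where "g z = (if z \<in> N then 1 else 1 / max \<delta> (min 1 (w (circle_angle z))))" for z
  have [measurable]: "g \<in> borel_measurable borel" unfolding g_def[abs_def] by measurable
  have [measurable]: "szego_weight \<in> borel_measurable borel"
    by (intro borel_measurable_continuous_onI continuous_intros)
  have id_meas [measurable]: "(\<lambda>z. z) \<in> \<mu> \<rightarrow>\<^sub>M borel" by (rule measurable_mu) (intro continuous_intros)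
  have g1: "1 \<le> g z" and gb: "g z \<le> 1 / \<delta>" for z
    using \<delta> by (auto simp: g_def field_simps max_def min_def)
  have g0: "0 \<le> g z" for z using g1[of z] by simp
  have gm: "g \<in> borel_measurable \<mu>" "szego_weight \<in> borel_measurable \<mu>"
    by (rule measurable_compose[OF id_meas]; measurable)+
  have m1: "(\<lambda>z. ennreal (szego_weight z * g z)) \<in> borel_measurable \<mu>"
    using gm by measurable
  have m2: "(\<lambda>z. indicator (- N) z :: ennreal) \<in> borel_measurable \<mu>"
    by (rule measurable_compose[OF id_meas]) measurable
  have AEw: "AE \<theta> in dtheta. g (cis \<theta>) = 1 / max \<delta> (min 1 (w \<theta>))"
    using AEN AE_dtheta_range by eventually_elim (simp add: g_def circle_angle_cis)
  have ig: "integrable \<mu> (\<lambda>z. szego_weight z * g z)"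
    by (rule integrable_const_bound[where B = "8 * (1 / \<delta>)"])
      (use szego_weight_nonneg szego_weight_le gb g0 gm \<delta> in \<open>auto intro!: AE_I2 mult_mono simp: abs_mult simp del: times_divide_eq_right\<close>)
  have "ennreal (LINT z|\<mu>. szego_weight z * g z) = (\<integral>\<^sup>+z. ennreal (szego_weight z * g z) \<partial>\<mu>)"
    by (rule nn_integral_eq_integral[symmetric, OF ig]) (use szego_weight_nonneg g0 in \<open>auto intro!: AE_I2\<close>)
  also have "\<dots> \<le> (\<integral>\<^sup>+z. 8 + indicator (- N) z * ennreal (szego_weight z * g z) \<partial>\<mu>)"
  proof (rule nn_integral_mono)
    fix z assume "z \<in> space \<mu>"
    then have "ennreal (szego_weight z) \<le> ennreal 8" using szego_weight_le by (intro ennreal_leI) simp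
    then have "ennreal (szego_weight z) \<le> 8" by simp
    then show "ennreal (szego_weight z * g z) \<le> 8 + indicator (- N) z * ennreal (szego_weight z * g z)"
      by (cases "z \<in> N") (auto simp: g_def)
  qed
  also have "\<dots> = (\<integral>\<^sup>+z. 8 \<partial>\<mu>) + (\<integral>\<^sup>+z. indicator (- N) z * ennreal (szego_weight z * g z) \<partial>\<mu>)"
    by (intro nn_integral_add borel_measurable_times m1 m2) auto
  also have "(\<integral>\<^sup>+z. 8 \<partial>\<mu>) = 8" using emeasure_space_1 by simp
  also have "(\<integral>\<^sup>+z. indicator (- N) z * ennreal (szego_weight z * g z) \<partial>\<mu>)
      = (\<integral>\<^sup>+\<theta>. ennreal (w \<theta>) * (indicator (- N) (cis \<theta>) * ennreal (szego_weight (cis \<theta>) * g (cis \<theta>))) \<partial>dtheta)"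
    by (rule split[OF m1])
  also have "\<dots> \<le> (\<integral>\<^sup>+\<theta>. 8 + 8 * ennreal (w \<theta>) \<partial>dtheta)"
  proof (rule nn_integral_mono_AE)
    show "AE \<theta> in dtheta. ennreal (w \<theta>) * (indicator (- N) (cis \<theta>) * ennreal (szego_weight (cis \<theta>) * g (cis \<theta>)))
        \<le> 8 + 8 * ennreal (w \<theta>)"
      using AEw AEN w_nonneg
    proof eventually_elim
      case (elim \<theta>)
      define x v where "x = w \<theta>" and "v = szego_weight (cis \<theta>)"
      have x: "0 \<le> x" and v: "0 \<le> v" "v \<le> 8"
        using elim szego_weight_cis by (auto simp: x_def v_def)
      have "x \<le> (1 + x) * max \<delta> (min 1 x)"
      proof (cases "x \<le> 1")
        case True
        have "1 * x \<le> (1 + x) * max \<delta> (min 1 x)" using x True by (intro mult_mono) auto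
        then show ?thesis by simp
      next
        case False
        have "(1 + x) * 1 \<le> (1 + x) * max \<delta> (min 1 x)" using x False by (intro mult_left_mono) auto
        then show ?thesis by simp
      qed
      then have "x / max \<delta> (min 1 x) \<le> 1 + x" using \<delta> by (simp add: pos_divide_le_eq less_max_iff_disj)
      then have "v * (x / max \<delta> (min 1 x)) \<le> 8 * (1 + x)" using v x \<delta> by (intro mult_mono) auto
      then have le: "ennreal (x * (v * (1 / max \<delta> (min 1 x)))) \<le> ennreal (8 + 8 * x)"
        by (intro ennreal_leI) (simp add: mult.commute)
      have "ennreal x * ennreal (v * (1 / max \<delta> (min 1 x))) = ennreal (x * (v * (1 / max \<delta> (min 1 x))))"
        by (rule ennreal_mult'[OF x, symmetric])
      also note le
      also have "ennreal (8 + 8 * x) = 8 + 8 * ennreal x" using x by (simp add: ennreal_plus ennreal_mult)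
      finally show ?case unfolding elim(1) x_def v_def using elim(2) by simp
    qed
  qed
  also have "\<dots> = 8 + 8 * (\<integral>\<^sup>+\<theta>. ennreal (w \<theta>) \<partial>dtheta)"
    using dtheta.emeasure_space_1 by (simp add: nn_integral_add nn_integral_cmult)
  also have "\<dots> \<le> 8 + 8 * 1" by (intro add_mono mult_left_mono nn_integral_w) auto
  finally have "ennreal (LINT z|\<mu>. szego_weight z * g z) \<le> ennreal 24" by (simp add: add.assoc[symmetric])
  then have Vg: "(LINT z|\<mu>. szego_weight z * g z) \<le> 24" by (subst (asm) ennreal_le_iff) auto
  define r where "r \<theta> = szego_weight (cis \<theta>) * - ln (max \<delta> (min 1 (w \<theta>)))" for \<theta>
  have [measurable]: "(\<lambda>\<theta>. szego_weight (cis \<theta>)) \<in> borel_measurable borel"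
    by (intro borel_measurable_continuous_onI continuous_intros)
  have rm [measurable]: "r \<in> borel_measurable borel" unfolding r_def[abs_def] by measurable
  have r0: "0 \<le> r \<theta>" and rb: "r \<theta> \<le> 8 * - ln \<delta>" for \<theta>
  proof -
    have m: "0 < max \<delta> (min 1 (w \<theta>))" "max \<delta> (min 1 (w \<theta>)) \<le> 1" "\<delta> \<le> max \<delta> (min 1 (w \<theta>))"
      using \<delta> by auto
    have l: "0 \<le> - ln (max \<delta> (min 1 (w \<theta>)))" using m by simp
    have l': "- ln (max \<delta> (min 1 (w \<theta>))) \<le> - ln \<delta>" using m \<delta> by simp
    show "0 \<le> r \<theta>" unfolding r_def using l szego_weight_cis by (intro mult_nonneg_nonneg)
    show "r \<theta> \<le> 8 * - ln \<delta>" unfolding r_def using l l' szego_weight_cis[of \<theta>] by (intro mult_mono) auto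
  qed
  have ir: "integrable dtheta r"
    by (rule dtheta.integrable_const_bound[where B = "8 * - ln \<delta>"]) (use r0 rb in auto)
  have "(LINT \<theta>|dtheta. r \<theta>) = (LINT \<theta>|dtheta. szego_weight (cis \<theta>) * ln (g (cis \<theta>)))"
  proof (rule integral_cong_AE)
    show "AE \<theta> in dtheta. r \<theta> = szego_weight (cis \<theta>) * ln (g (cis \<theta>))"
      using AEw
    proof eventually_elim
      case (elim \<theta>)
      have "0 < max \<delta> (min 1 (w \<theta>))" using \<delta> by auto
      then show ?case unfolding elim r_def by (simp add: ln_div)
    qed
    have [measurable]: "cis \<in> borel_measurable borel"
      by (intro borel_measurable_continuous_onI continuous_intros)
    show "(\<lambda>\<theta>. szego_weight (cis \<theta>) * ln (g (cis \<theta>))) \<in> borel_measurable dtheta" by measurable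
  qed simp
  also have "\<dots> \<le> (LINT z|\<mu>. szego_weight z * g z) + C"
    by (rule entropy_bound_measurable[OF _ g1 gb C]) measurable
  finally have "(LINT \<theta>|dtheta. r \<theta>) \<le> 24 + C" using Vg by simp
  moreover have "(\<integral>\<^sup>+\<theta>. ennreal (r \<theta>) \<partial>dtheta) = ennreal (LINT \<theta>|dtheta. r \<theta>)"
    by (rule nn_integral_eq_integral[OF ir]) (use r0 in auto)
  ultimately show ?thesis unfolding r_def[symmetric] by (simp add: ennreal_leI)
qed

lemma negative_part_finite:
  assumes C: "\<And>n. - C \<le> bs_entropy (n + k)"
  shows "negative_part < \<infinity>"
proof -
  define u where "u m \<theta> = ennreal (szego_weight (cis \<theta>) * - ln (max (1 / real (Suc m)) (min 1 (w \<theta>))))" for m \<theta>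
  have [measurable]: "(\<lambda>\<theta>. szego_weight (cis \<theta>)) \<in> borel_measurable borel"
    by (intro borel_measurable_continuous_onI continuous_intros)
  have um: "u m \<in> borel_measurable dtheta" for m unfolding u_def[abs_def] by measurable
  have inc: "incseq u"
  proof (rule incseq_SucI, rule le_funI)
    fix m \<theta>
    have d: "1 / real (Suc (Suc m)) \<le> 1 / real (Suc m)" by (intro divide_left_mono) auto
    have p: "0 < 1 / real (Suc (Suc m))" by simp
    have "ln (max (1 / real (Suc (Suc m))) (min 1 (w \<theta>))) \<le> ln (max (1 / real (Suc m)) (min 1 (w \<theta>)))"
      by (rule ln_mono) (use d p in \<open>linarith | simp add: less_max_iff_disj del: of_nat_Suc\<close>)+
    then show "u m \<theta> \<le> u (Suc m) \<theta>" unfolding u_def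
      using szego_weight_cis[of \<theta>] by (intro ennreal_leI mult_left_mono) auto
  qed
  have "negative_part \<le> (\<integral>\<^sup>+\<theta>. (SUP m. u m \<theta>) \<partial>dtheta)"
    unfolding negative_part_def
  proof (rule nn_integral_mono)
    fix \<theta>
    show "e2ennreal (- log_integrand \<theta>) \<le> (SUP m. u m \<theta>)"
    proof (cases "0 < w \<theta>")
      case True
      then obtain m where m: "1 / real (Suc m) < w \<theta>" using nat_approx_posE by blast
      show ?thesis
      proof (rule SUP_upper2[of m])
        have "1 / real (Suc m) \<le> 1" by simp
        then have "max (1 / real (Suc m)) (min 1 (w \<theta>)) = min 1 (w \<theta>)" using m by (auto simp: max_def min_def)
        moreover have "ln (min 1 (w \<theta>)) \<le> ln (w \<theta>)" using True by (intro ln_mono) auto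
        then have "szego_weight (cis \<theta>) * - ln (w \<theta>) \<le> szego_weight (cis \<theta>) * - ln (min 1 (w \<theta>))"
          using szego_weight_cis[of \<theta>] by (intro mult_left_mono) auto
        ultimately have "ennreal (szego_weight (cis \<theta>) * - ln (w \<theta>)) \<le> u m \<theta>"
          unfolding u_def by (simp add: ennreal_leI)
        then show "e2ennreal (- log_integrand \<theta>) \<le> u m \<theta>"
          using True by (simp add: log_integrand_pos flip: ennreal.rep_eq)
      qed simp
    next
      case False
      show ?thesis
      proof (cases "szego_weight (cis \<theta>) = 0")
        case True
        then show ?thesis using False by (simp add: log_integrand_nonpos)
      next
        case V: False
        then have v: "0 < szego_weight (cis \<theta>)" using szego_weight_cis[of \<theta>] by linarith
        have top: "(SUP m. u m \<theta>) = top"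
        proof (rule ennreal_SUP_eq_top)
          fix n :: nat
          obtain m where m: "exp (real n / szego_weight (cis \<theta>)) \<le> real m" using real_arch_simple by blast
          have "max (1 / real (Suc m)) (min 1 (w \<theta>)) = 1 / real (Suc m)"
            using False by (intro max_absorb1) (simp add: min_def divide_nonneg_nonneg order_trans[of _ 0])
          then have "u m \<theta> = ennreal (szego_weight (cis \<theta>) * ln (real (Suc m)))"
            by (simp add: u_def ln_div del: of_nat_Suc)
          moreover have "real n / szego_weight (cis \<theta>) \<le> ln (real (Suc m))"
            using m by (simp add: ln_ge_iff)
          then have "real n \<le> szego_weight (cis \<theta>) * ln (real (Suc m))"
            using v by (simp add: pos_divide_le_eq mult.commute del: of_nat_Suc)
          ultimately have "of_nat n \<le> u m \<theta>"
            by (simp add: ennreal_leI del: of_nat_Suc flip: ennreal_of_nat_eq_real_of_nat)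
          then show "\<exists>i\<in>UNIV. of_nat n \<le> u i \<theta>" by blast
        qed
        show ?thesis unfolding top by (rule top_greatest)
      qed
    qed
  qed
  also have "\<dots> = (SUP m. \<integral>\<^sup>+\<theta>. u m \<theta> \<partial>dtheta)"
    by (rule nn_integral_monotone_convergence_SUP[OF inc um])
  also have "\<dots> \<le> ennreal (24 + C)"
    unfolding u_def by (rule SUP_least) (rule truncated_negative_part_le[OF C], auto)
  also have "\<dots> < \<infinity>" by simp
  finally show ?thesis .
qed

lemma bs_entropy_telescope:
  "bs_entropy (N + 3) = bs_entropy 3 + (\<Sum>n<N. sum_rule_term (verblunsky \<Phi> n) (verblunsky \<Phi> (n + 1))
     (verblunsky \<Phi> (n + 2)) (verblunsky \<Phi> (n + 3)))"
proof (induction N)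
  case (Suc N)
  have s: "Suc N + 3 = N + 4" by simp
  show ?case using bs_entropy_step[of N] Suc unfolding sum.lessThan_Suc s by argo
qed simp

lemma negative_part_finite_iff:
  "negative_part < \<infinity> \<longleftrightarrow> (\<exists>C. \<forall>N. - C \<le> (\<Sum>n<N. sum_rule_term (verblunsky \<Phi> n)
     (verblunsky \<Phi> (n + 1)) (verblunsky \<Phi> (n + 2)) (verblunsky \<Phi> (n + 3))))" (is "_ \<longleftrightarrow> (\<exists>C. \<forall>N. - C \<le> ?S N)")
proof
  assume "negative_part < \<infinity>"
  then obtain C where C: "\<And>n. - C \<le> bs_entropy n" using bs_entropy_bounded_below by blast
  have "- (C + bs_entropy 3) \<le> ?S N" for N
    using C[of "N + 3"] unfolding bs_entropy_telescope by linarith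
  then show "\<exists>C. \<forall>N. - C \<le> ?S N" by blast
next
  assume "\<exists>C. \<forall>N. - C \<le> ?S N"
  then obtain C where C: "\<And>N. - C \<le> ?S N" by blast
  have "- (C - bs_entropy 3) \<le> bs_entropy (N + 3)" for N
    using C[of N] unfolding bs_entropy_telescope by linarith
  then show "negative_part < \<infinity>" by (rule negative_part_finite)
qed

end

theorem theorem4p30:
  fixes \<mu> \<mu>s :: "complex measure"
    and w :: "real \<Rightarrow> real"
    and \<Phi> :: "nat \<Rightarrow> complex poly"
    and \<alpha> :: "nat \<Rightarrow> complex"
  assumes "prob_on_circle \<mu>"
    and "infinite (measure_support \<mu>)"
    and "lebesgue_decomposition \<mu> w \<mu>s"
    and "monic_orthogonal_polys \<mu> \<Phi>"
    and "\<alpha> = verblunsky \<Phi>"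
    and "(\<lambda>n. left_shift \<alpha> n - \<alpha> n) \<in> ell 2"
  shows "ext_integral dtheta
           (\<lambda>\<theta>. ereal ((1 - cos \<theta>)\<^sup>2 * (1 + cos \<theta>)) * elog (w \<theta>)) > - \<infinity>
         \<longleftrightarrow> \<alpha> \<in> ell 6"
proof -
  interpret opuc_decomposition \<mu> \<Phi> w \<mu>s
    by unfold_locales (fact assms)+
  have "(\<lambda>\<theta>. ereal ((1 - cos \<theta>)\<^sup>2 * (1 + cos \<theta>)) * elog (w \<theta>)) = log_integrand"
    by (simp add: fun_eq_iff log_integrand_def szego_weight_def)
  moreover have "negative_part < \<infinity> \<longleftrightarrow> \<alpha> \<in> ell 6"
    unfolding negative_part_finite_iff assms(5)
    using sum_rule_bounded_below_iff[of "verblunsky \<Phi>"] cmod_verblunsky_less_1 assms(5,6)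
    by (simp add: ell_def left_shift_def)
  ultimately show ?thesis using ext_integral_finite_iff by simp
qed

end
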